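(* Let $\mathcal L$ be a weak $PM$-structure with semi-simple algebras $\mathcal A=\bigoplus_{1\le i\le r}End(V_i)$, $\mathcal B=\bigoplus_{1\le j\le s}End(W_j)$, $\dim V_i=m_i$, $\dim W_j=n_j$, and suppose its $r\times s$ matrix of multiplicities $A=(a_{i,j})$ is indecomposable. Then, after a possible permutation of rows and columns and a possible transposition (which exchanges the roles of the $m_i$ and the $n_j$), $A$ is one of the following, where $m$ is a positive integer: 1. $A=(2)$; $r=s=1$, $n_1=m_1=m$ (Dynkin diagram $\tilde A_1$). 2. $a_{i,i}=a_{i,i+1}=1$ and $a_{i,j}=0$ for other pairs; $r=s=k\ge2$, indices modulo $k$, $n_i=m_i=m$ ($\tilde A_{2k-1}$). 3. $A=\begin{pmatrix}1&1&0&0\\1&0&1&0\\1&0&0&1\end{pmatrix}$; $n_1=3m$, $n_2=n_3=n_4=m$, $m_1=m_2=m_3=2m$ ($\tilde E_6$). 4. $A=(1,1,1,1)$; $r=1$, $s=4$, $n_1=n_2=n_3=n_4=m$, $m_1=2m$ ($\tilde D_4$). 5. $r=k-1$, $s=k+2$, $k\ge3$; $a_{1,1}=a_{1,2}=a_{1,3}=1$; $a_{i,i+1}=a_{i,i+2}=1$ for $2\le i\le k-2$; $a_{k-1,k}=a_{k-1,k+1}=a_{k-1,k+2}=1$; $a_{i,j}=0$ otherwise; $n_1=n_2=n_{k+1}=n_{k+2}=m$, $n_3=\dots=n_k=2m$, $m_1=\dots=m_{k-1}=2m$ ($\tilde D_{2k}$). 6. $r=s=k\ge3$; $a_{1,1}=a_{1,2}=a_{1,3}=1$;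 $a_{i,i+1}=a_{i,i+2}=1$ for $2\le i\le k-2$; $a_{k-1,k}=a_{k,k}=1$; $a_{i,j}=0$ otherwise; $n_1=n_2=m$, $n_3=\dots=n_k=2m$, $m_1=\dots=m_{k-2}=2m$, $m_{k-1}=m_k=m$ ($\tilde D_{2k-1}$). 7. $A=\begin{pmatrix}1&1&0&0&0\\0&1&1&1&0\\0&0&0&1&1\end{pmatrix}$; $n_1=m$, $n_2=3m$, $n_3=2m$, $n_4=3m$, $n_5=m$, $m_1=2m$, $m_2=4m$, $m_3=2m$ ($\tilde E_7$). 8. $A=\begin{pmatrix}1&0&0&0&0\\1&1&1&0&0\\0&0&1&1&0\\0&0&0&1&1\end{pmatrix}$; $n_1=4m$, $n_2=3m$, $n_3=5m$, $n_4=3m$, $n_5=m$, $m_1=2m$, $m_2=6m$, $m_3=4m$, $m_4=2m$ ($\tilde E_8$).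
   Context: A weak $PM$-structure (of some size $N$) on a finite-dimensional complex vector space $\mathcal L$ consists of: two subspaces $\mathcal A,\mathcal B\subset\mathcal L$ and an element $1\in\mathcal A\cap\mathcal B$; a non-degenerate symmetric bilinear form $(\cdot,\cdot)$ on $\mathcal L$; associative products on $\mathcal A$ and on $\mathcal B$, both with unity $1$; a left (unital) action of $\mathcal B$ and a right (unital) action of $\mathcal A$ on $\mathcal L$ that commute with each other; such that (1) $\dim\mathcal A\cap\mathcal B=\dim\mathcal L/(\mathcal A+\mathcal B)=N$ and $\mathcal A\cap\mathcal B$ is an algebra isomorphic to $\mathbb C\oplus\dots\oplus\mathbb C$ ($N$ copies); (2) the actions of $\mathcal B$ on $\mathcal B\subset\mathcal L$ and of $\mathcal A$ on $\mathcal A\subset\mathcal L$ are the products of $\mathcal B$ and $\mathcal A$; (3) $(a_1,a_2)=(b_1,b_2)=0$, $(b_1b_2,v)=(b_1,b_2v)$, $(v,a_1a_2)=(va_1,a_2)$ for all $a_1,a_2\in\mathcal A$, $b_1,b_2\in\mathcal B$, $v\in\mathcal L$. Here $V_i,W_j$ are non-zero finite-dimensional complex vector spaces. The matrix of multiplicities $(a_{i,j})$, with non-negative integer entries, is defined by the isomorphism $\mathcal L\cong\bigoplus_{i,j}(V_i^\star\otimes W_j)^{a_{i,j}}$ of left $\mathcal B$-, right $\mathcal A$-modules (exponents denote direct sums of copies). A matrix $(a_{i,j})$ is decomposable if there exist partitions $\{1,\dots,r\}=I\sqcup I'$, $\{1,\dots,s\}=J\sqcup J'$ with $I\sqcup J$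 and $I'\sqcup J'$ non-empty such that $a_{i,j}=0$ for $(i,j)\in(I\times J')\sqcup(I'\times J)$; otherwise it is indecomposable. *)

theory Defs
  imports
    Complex_Main
    "HOL-Library.Function_Algebras"
    "HOL-Combinatorics.Permutations"
begin

section \<open>Linear algebra relative to subspaces\<close>

text \<open>
  Vector spaces are given by a scalar multiplication satisfying the locale
  \<^locale>\<open>vector_space\<close>.  Families of spaces of varying dimension are families of subspaces of
  one ambient vector space, so linearity has to be relativised to sets.
\<close>

definition linear_on ::
  "(complex \<Rightarrow> 'a::ab_group_add \<Rightarrow> 'a) \<Rightarrow> (complex \<Rightarrow> 'b::ab_group_add \<Rightarrow> 'b) \<Rightarrow> 'a set \<Rightarrow> ('a \<Rightarrow> 'b) \<Rightarrow> bool"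
  where "linear_on s1 s2 S f \<longleftrightarrow>
    (\<forall>x\<in>S. \<forall>y\<in>S. f (x + y) = f x + f y) \<and> (\<forall>c. \<forall>x\<in>S. f (s1 c x) = s2 c (f x))"

definition bilinear_on ::
  "(complex \<Rightarrow> 'a::ab_group_add \<Rightarrow> 'a) \<Rightarrow> (complex \<Rightarrow> 'b::ab_group_add \<Rightarrow> 'b) \<Rightarrow>
   (complex \<Rightarrow> 'c::ab_group_add \<Rightarrow> 'c) \<Rightarrow> 'a set \<Rightarrow> 'b set \<Rightarrow> ('a \<Rightarrow> 'b \<Rightarrow> 'c) \<Rightarrow> bool"
  where "bilinear_on s1 s2 s3 S T f \<longleftrightarrow>
    (\<forall>x\<in>S. linear_on s2 s3 T (f x)) \<and> (\<forall>y\<in>T. linear_on s1 s3 S (\<lambda>x. f x y))"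

definition linear_iso_on ::
  "(complex \<Rightarrow> 'a::ab_group_add \<Rightarrow> 'a) \<Rightarrow> (complex \<Rightarrow> 'b::ab_group_add \<Rightarrow> 'b) \<Rightarrow>
   'a set \<Rightarrow> 'b set \<Rightarrow> ('a \<Rightarrow> 'b) \<Rightarrow> bool"
  where "linear_iso_on s1 s2 S T f \<longleftrightarrow> linear_on s1 s2 S f \<and> bij_betw f S T"

definition algebra_iso_on ::
  "(complex \<Rightarrow> 'a::ab_group_add \<Rightarrow> 'a) \<Rightarrow> (complex \<Rightarrow> 'b::ab_group_add \<Rightarrow> 'b) \<Rightarrow>
   'a set \<Rightarrow> 'b set \<Rightarrow> ('a \<Rightarrow> 'a \<Rightarrow> 'a) \<Rightarrow> ('b \<Rightarrow> 'b \<Rightarrow> 'b) \<Rightarrow> ('a \<Rightarrow> 'b) \<Rightarrow> bool"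
  where "algebra_iso_on s1 s2 S T mul1 mul2 f \<longleftrightarrow>
    linear_iso_on s1 s2 S T f \<and> (\<forall>x\<in>S. \<forall>y\<in>S. f (mul1 x y) = mul2 (f x) (f y))"

definition fin_dim_subspace :: "(complex \<Rightarrow> 'a::ab_group_add \<Rightarrow> 'a) \<Rightarrow> 'a set \<Rightarrow> bool"
  where "fin_dim_subspace s S \<longleftrightarrow>
    module.subspace s S \<and> (\<exists>X. finite X \<and> module.span s X = S)"

text \<open>
  An associative bilinear product with unity on a subspace; values of \<open>mul\<close> outside \<open>S\<close> are
  irrelevant.
\<close>

definition unital_algebra_on ::
  "(complex \<Rightarrow> 'a::ab_group_add \<Rightarrow> 'a) \<Rightarrow> 'a set \<Rightarrow> ('a \<Rightarrow> 'a \<Rightarrow> 'a) \<Rightarrow> 'a \<Rightarrow> bool"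
  where "unital_algebra_on s S mul e \<longleftrightarrow>
    module.subspace s S \<and> e \<in> S \<and>
    (\<forall>x\<in>S. \<forall>y\<in>S. mul x y \<in> S) \<and>
    bilinear_on s s s S S mul \<and>
    (\<forall>x\<in>S. \<forall>y\<in>S. \<forall>z\<in>S. mul (mul x y) z = mul x (mul y z)) \<and>
    (\<forall>x\<in>S. mul e x = x \<and> mul x e = x)"

text \<open>Pointwise scalar multiplication on functions; addition is that of \<^theory>\<open>HOL-Library.Function_Algebras\<close>.\<close>

definition fscale :: "(complex \<Rightarrow> 'b \<Rightarrow> 'b) \<Rightarrow> complex \<Rightarrow> ('a \<Rightarrow> 'b) \<Rightarrow> 'a \<Rightarrow> 'b"
  where "fscale s c f = (\<lambda>x. s c (f x))"

text \<open>
  External direct sum over a finite index set.  Here and below, functions are normalised to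
  vanish outside their domain, so that equality of functions is equality on the domain.
\<close>

definition direct_sum :: "'i set \<Rightarrow> ('i \<Rightarrow> 'b::zero set) \<Rightarrow> ('i \<Rightarrow> 'b) set"
  where "direct_sum I S = {F. \<forall>i. if i \<in> I then F i \<in> S i else F i = 0}"

definition End_space :: "(complex \<Rightarrow> 'v::ab_group_add \<Rightarrow> 'v) \<Rightarrow> 'v set \<Rightarrow> ('v \<Rightarrow> 'v) set"
  where "End_space s V = {f. linear_on s s V f \<and> f ` V \<subseteq> V \<and> (\<forall>x. x \<notin> V \<longrightarrow> f x = 0)}"

definition dual_space :: "(complex \<Rightarrow> 'v::ab_group_add \<Rightarrow> 'v) \<Rightarrow> 'v set \<Rightarrow> ('v \<Rightarrow> complex) set"
  where "dual_space s V = {\<xi>. linear_on s (*) V \<xi> \<and> (\<forall>x. x \<notin> V \<longrightarrow> \<xi> x = 0)}"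


section \<open>Tensor products\<close>

text \<open>
  The tensor product of \<open>U\<close> and \<open>W\<close> is realised inside the dual of the space of bilinear forms
  on \<open>U \<times> W\<close>: the pure tensor of \<open>u\<close> and \<open>w\<close> is evaluation of bilinear forms at \<open>(u, w)\<close>, and
  \<open>tensor_product\<close> is the span of the pure tensors.  Over a field the canonical map
  from the tensor product to this dual is injective, so this is a model of the tensor product.
\<close>

definition pure_tensor ::
  "(complex \<Rightarrow> 'u::ab_group_add \<Rightarrow> 'u) \<Rightarrow> (complex \<Rightarrow> 'w::ab_group_add \<Rightarrow> 'w) \<Rightarrow> 'u set \<Rightarrow> 'w set \<Rightarrow>
   'u \<Rightarrow> 'w \<Rightarrow> ('u \<Rightarrow> 'w \<Rightarrow> complex) \<Rightarrow> complex"
  where "pure_tensor sU sW U W u w =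
    (\<lambda>\<beta>. if bilinear_on sU sW (*) U W \<beta> then \<beta> u w else 0)"

definition tensor_product ::
  "(complex \<Rightarrow> 'u::ab_group_add \<Rightarrow> 'u) \<Rightarrow> (complex \<Rightarrow> 'w::ab_group_add \<Rightarrow> 'w) \<Rightarrow> 'u set \<Rightarrow> 'w set \<Rightarrow>
   (('u \<Rightarrow> 'w \<Rightarrow> complex) \<Rightarrow> complex) set"
  where "tensor_product sU sW U W =
    module.span (fscale (*)) {pure_tensor sU sW U W u w | u w. u \<in> U \<and> w \<in> W}"

text \<open>The map induced on the tensor product of \<open>U\<close> and \<open>W\<close> by endomorphisms \<open>f\<close> of \<open>U\<close> and \<open>g\<close> of \<open>W\<close>.\<close>

definition tensor_map ::
  "(complex \<Rightarrow> 'u::ab_group_add \<Rightarrow> 'u) \<Rightarrow> (complex \<Rightarrow> 'w::ab_group_add \<Rightarrow> 'w) \<Rightarrow> 'u set \<Rightarrow> 'w set \<Rightarrow>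
   ('u \<Rightarrow> 'u) \<Rightarrow> ('w \<Rightarrow> 'w) \<Rightarrow> (('u \<Rightarrow> 'w \<Rightarrow> complex) \<Rightarrow> complex) \<Rightarrow> ('u \<Rightarrow> 'w \<Rightarrow> complex) \<Rightarrow> complex"
  where "tensor_map sU sW U W f g t =
    (\<lambda>\<beta>. if bilinear_on sU sW (*) U W \<beta> then t (\<lambda>u w. \<beta> (f u) (g w)) else 0)"

lemma tensor_map_pure_tensor:
  assumes "linear_on sU sU U f" "f ` U \<subseteq> U" "linear_on sW sW W g" "g ` W \<subseteq> W"
  shows "tensor_map sU sW U W f g (pure_tensor sU sW U W u w) = pure_tensor sU sW U W (f u) (g w)"
proof
  fix \<beta> :: "'a \<Rightarrow> 'b \<Rightarrow> complex"
  have "bilinear_on sU sW (*) U W (\<lambda>u w. \<beta> (f u) (g w))" if "bilinear_on sU sW (*) U W \<beta>"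
    using that assms unfolding bilinear_on_def linear_on_def by (simp add: image_subset_iff)
  then show "tensor_map sU sW U W f g (pure_tensor sU sW U W u w) \<beta> = pure_tensor sU sW U W (f u) (g w) \<beta>"
    by (simp add: tensor_map_def pure_tensor_def)
qed


section \<open>Weak PM-structures\<close>

text \<open>
  The space \<open>\<L>\<close> is the whole type \<open>'l\<close>; \<open>lact b v\<close> is the left action of \<open>\<B>\<close> and
  \<open>ract v a\<close> the right action of \<open>\<A>\<close>.  The size is positive: for size \<open>0\<close> one would have
  \<open>1 = 0\<close> and \<open>\<L> = 0\<close>.  In \<open>inter_alg\<close> it is immaterial which of the two products is used:
  for \<open>x\<close>, \<open>y\<close> in the intersection, \<open>mulB x y = lact x (ract e y) = ract (lact x e) y = mulA x y\<close>.
\<close>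

locale weak_PM_structure = vector_space scale
  for scale :: "complex \<Rightarrow> 'l::ab_group_add \<Rightarrow> 'l" +
  fixes A B :: "'l set"
    and e :: 'l
    and form :: "'l \<Rightarrow> 'l \<Rightarrow> complex"
    and mulA mulB :: "'l \<Rightarrow> 'l \<Rightarrow> 'l"
    and lact ract :: "'l \<Rightarrow> 'l \<Rightarrow> 'l"
    and N :: nat
  assumes fin_dim: "fin_dim_subspace scale UNIV"
    and form_bilinear: "bilinear_on scale scale (*) UNIV UNIV form"
    and form_sym: "form v w = form w v"
    and form_nondeg: "(\<And>w. form v w = 0) \<Longrightarrow> v = 0"
    and alg_A: "unital_algebra_on scale A mulA e"
    and alg_B: "unital_algebra_on scale B mulB e"
    and lact_bilinear: "bilinear_on scale scale scale B UNIV lact"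
    and lact_mul: "b \<in> B \<Longrightarrow> b' \<in> B \<Longrightarrow> lact (mulB b b') v = lact b (lact b' v)"
    and lact_unit: "lact e v = v"
    and ract_bilinear: "bilinear_on scale scale scale UNIV A ract"
    and ract_mul: "a \<in> A \<Longrightarrow> a' \<in> A \<Longrightarrow> ract v (mulA a a') = ract (ract v a) a'"
    and ract_unit: "ract v e = v"
    and acts_commute: "b \<in> B \<Longrightarrow> a \<in> A \<Longrightarrow> ract (lact b v) a = lact b (ract v a)"
    and N_pos: "N > 0"
    and dim_inter: "dim (A \<inter> B) = N"
    and dim_quot: "dim (UNIV :: 'l set) = dim {a + b | a b. a \<in> A \<and> b \<in> B} + N"
    and inter_alg: "\<exists>\<theta>. algebra_iso_on scale (fscale (*)) (A \<inter> B)
            (direct_sum {1..N} (\<lambda>_. UNIV :: complex set)) mulA (\<lambda>x y i. x i * y i) \<theta>"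
    and lact_B: "b \<in> B \<Longrightarrow> b' \<in> B \<Longrightarrow> lact b b' = mulB b b'"
    and ract_A: "a \<in> A \<Longrightarrow> a' \<in> A \<Longrightarrow> ract a a' = mulA a a'"
    and form_A: "a \<in> A \<Longrightarrow> a' \<in> A \<Longrightarrow> form a a' = 0"
    and form_B: "b \<in> B \<Longrightarrow> b' \<in> B \<Longrightarrow> form b b' = 0"
    and form_lact: "b \<in> B \<Longrightarrow> b' \<in> B \<Longrightarrow> form (mulB b b') v = form b (lact b' v)"
    and form_ract: "a \<in> A \<Longrightarrow> a' \<in> A \<Longrightarrow> form v (mulA a a') = form (ract v a) a'"


section \<open>Semi-simple algebras and the matrix of multiplicities\<close>

text \<open>
  \<open>\<rho>\<close> identifies the algebra on \<open>S\<close> with the direct sum of \<open>End(V\<^sub>i)\<close>, \<open>1 \<le> i \<le> r\<close>, where the \<open>V\<^sub>i\<close>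
  are non-zero subspaces of dimension \<open>d i\<close> of an ambient complex vector space.
\<close>

definition semisimple_decomposition ::
  "(complex \<Rightarrow> 'l::ab_group_add \<Rightarrow> 'l) \<Rightarrow> 'l set \<Rightarrow> ('l \<Rightarrow> 'l \<Rightarrow> 'l) \<Rightarrow>
   (complex \<Rightarrow> 'v::ab_group_add \<Rightarrow> 'v) \<Rightarrow> nat \<Rightarrow> (nat \<Rightarrow> 'v set) \<Rightarrow> (nat \<Rightarrow> nat) \<Rightarrow> ('l \<Rightarrow> nat \<Rightarrow> 'v \<Rightarrow> 'v) \<Rightarrow> bool"
  where "semisimple_decomposition s S mul sV r V d \<rho> \<longleftrightarrow>
    vector_space sV \<and>
    (\<forall>i\<in>{1..r}. fin_dim_subspace sV (V i) \<and> V i \<noteq> {0} \<and> vector_space.dim sV (V i) = d i) \<and>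
    algebra_iso_on s (fscale (fscale sV)) S (direct_sum {1..r} (\<lambda>i. End_space sV (V i)))
      mul (\<lambda>F G i. F i \<circ> G i) \<rho>"

text \<open>
  \<open>a\<close> is the matrix of multiplicities if there is an isomorphism \<open>\<Psi>\<close> of left \<open>\<B>\<close>-, right
  \<open>\<A>\<close>-modules from \<open>\<L>\<close> to the direct sum, over \<open>(i, j, p)\<close> with \<open>1 \<le> p \<le> a i j\<close>, of copies of the
  tensor product of the dual of \<open>V\<^sub>i\<close> with \<open>W\<^sub>j\<close>.  The algebra \<open>\<A>\<close> acts on the dual of \<open>V\<^sub>i\<close> from the right by
  precomposition.
\<close>

definition multiplicity_matrix ::
  "(complex \<Rightarrow> 'l::ab_group_add \<Rightarrow> 'l) \<Rightarrow> 'l set \<Rightarrow> 'l set \<Rightarrow> ('l \<Rightarrow> 'l \<Rightarrow> 'l) \<Rightarrow> ('l \<Rightarrow> 'l \<Rightarrow> 'l) \<Rightarrow>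
   (complex \<Rightarrow> 'v::ab_group_add \<Rightarrow> 'v) \<Rightarrow> nat \<Rightarrow> (nat \<Rightarrow> 'v set) \<Rightarrow> ('l \<Rightarrow> nat \<Rightarrow> 'v \<Rightarrow> 'v) \<Rightarrow>
   (complex \<Rightarrow> 'w::ab_group_add \<Rightarrow> 'w) \<Rightarrow> nat \<Rightarrow> (nat \<Rightarrow> 'w set) \<Rightarrow> ('l \<Rightarrow> nat \<Rightarrow> 'w \<Rightarrow> 'w) \<Rightarrow>
   (nat \<Rightarrow> nat \<Rightarrow> nat) \<Rightarrow> bool"
  where "multiplicity_matrix scale A B lact ract sV r V \<rho>A sW s W \<rho>B a \<longleftrightarrow>
    (\<exists>\<Psi>. linear_iso_on scale (fscale (fscale (*))) UNIV
            (direct_sum {(i, j, p). i \<in> {1..r} \<and> j \<in> {1..s} \<and> p \<in> {1..a i j}}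
              (\<lambda>(i, j, p). tensor_product (fscale (*)) sW (dual_space sV (V i)) (W j))) \<Psi> \<and>
      (\<forall>x\<in>B. \<forall>v. \<forall>i\<in>{1..r}. \<forall>j\<in>{1..s}. \<forall>p\<in>{1..a i j}.
         \<Psi> (lact x v) (i, j, p) =
         tensor_map (fscale (*)) sW (dual_space sV (V i)) (W j) id (\<rho>B x j) (\<Psi> v (i, j, p))) \<and>
      (\<forall>x\<in>A. \<forall>v. \<forall>i\<in>{1..r}. \<forall>j\<in>{1..s}. \<forall>p\<in>{1..a i j}.
         \<Psi> (ract v x) (i, j, p) =
         tensor_map (fscale (*)) sW (dual_space sV (V i)) (W j) (\<lambda>\<xi>. \<xi> \<circ> \<rho>A x i) id (\<Psi> v (i, j, p))))"


section \<open>Matrices\<close>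

text \<open>
  An \<open>r \<times> s\<close> matrix is a function \<open>nat \<Rightarrow> nat \<Rightarrow> nat\<close> of which only the entries with indices in
  \<open>{1..r} \<times> {1..s}\<close> matter.
\<close>

definition decomposable :: "nat \<Rightarrow> nat \<Rightarrow> (nat \<Rightarrow> nat \<Rightarrow> nat) \<Rightarrow> bool"
  where "decomposable r s a \<longleftrightarrow>
    (\<exists>I I' J J'. I \<union> I' = {1..r} \<and> I \<inter> I' = {} \<and> J \<union> J' = {1..s} \<and> J \<inter> J' = {} \<and>
       (I \<noteq> {} \<or> J \<noteq> {}) \<and> (I' \<noteq> {} \<or> J' \<noteq> {}) \<and>
       (\<forall>i\<in>I. \<forall>j\<in>J'. a i j = 0) \<and> (\<forall>i\<in>I'. \<forall>j\<in>J. a i j = 0))"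

definition vector_is :: "nat \<Rightarrow> (nat \<Rightarrow> nat) \<Rightarrow> nat list \<Rightarrow> bool"
  where "vector_is l d xs \<longleftrightarrow> map d [1..<Suc l] = xs"

definition matrix_is :: "nat \<Rightarrow> nat \<Rightarrow> (nat \<Rightarrow> nat \<Rightarrow> nat) \<Rightarrow> nat list list \<Rightarrow> bool"
  where "matrix_is r s a rows \<longleftrightarrow> map (\<lambda>i. map (a i) [1..<Suc s]) [1..<Suc r] = rows"

text \<open>
  In the following definitions \<open>d\<close> stands for the dimensions \<open>m\<^sub>1, \<dots>, m\<^sub>r\<close> attached to the rows,
  \<open>n\<close> for the dimensions \<open>n\<^sub>1, \<dots>, n\<^sub>s\<close> attached to the columns, and \<open>m\<close> is the common factor.
\<close>

definition type_A1 :: "nat \<Rightarrow> nat \<Rightarrow> (nat \<Rightarrow> nat \<Rightarrow> nat) \<Rightarrow> (nat \<Rightarrow> nat) \<Rightarrow> (nat \<Rightarrow> nat) \<Rightarrow> nat \<Rightarrow> bool"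
  where "type_A1 r s a d n m \<longleftrightarrow>
    r = 1 \<and> s = 1 \<and> a 1 1 = 2 \<and> d 1 = m \<and> n 1 = m"

definition type_A_odd :: "nat \<Rightarrow> nat \<Rightarrow> (nat \<Rightarrow> nat \<Rightarrow> nat) \<Rightarrow> (nat \<Rightarrow> nat) \<Rightarrow> (nat \<Rightarrow> nat) \<Rightarrow> nat \<Rightarrow> bool"
  where "type_A_odd r s a d n m \<longleftrightarrow>
    (\<exists>k\<ge>2. r = k \<and> s = k \<and>
      (\<forall>i\<in>{1..k}. \<forall>j\<in>{1..k}. a i j = (if j = i \<or> j mod k = (i + 1) mod k then 1 else 0)) \<and>
      (\<forall>i\<in>{1..k}. d i = m) \<and> (\<forall>j\<in>{1..k}. n j = m))"

definition type_E6 :: "nat \<Rightarrow> nat \<Rightarrow> (nat \<Rightarrow> nat \<Rightarrow> nat) \<Rightarrow> (nat \<Rightarrow> nat) \<Rightarrow> (nat \<Rightarrow> nat) \<Rightarrow> nat \<Rightarrow> bool"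
  where "type_E6 r s a d n m \<longleftrightarrow>
    r = 3 \<and> s = 4 \<and>
    matrix_is r s a
      [[1, 1, 0, 0],
       [1, 0, 1, 0],
       [1, 0, 0, 1]] \<and>
    vector_is s n [3 * m, m, m, m] \<and> vector_is r d [2 * m, 2 * m, 2 * m]"

definition type_D4 :: "nat \<Rightarrow> nat \<Rightarrow> (nat \<Rightarrow> nat \<Rightarrow> nat) \<Rightarrow> (nat \<Rightarrow> nat) \<Rightarrow> (nat \<Rightarrow> nat) \<Rightarrow> nat \<Rightarrow> bool"
  where "type_D4 r s a d n m \<longleftrightarrow>
    r = 1 \<and> s = 4 \<and> matrix_is r s a [[1, 1, 1, 1]] \<and>
    vector_is s n [m, m, m, m] \<and> vector_is r d [2 * m]"

definition type_D_even :: "nat \<Rightarrow> nat \<Rightarrow> (nat \<Rightarrow> nat \<Rightarrow> nat) \<Rightarrow> (nat \<Rightarrow> nat) \<Rightarrow> (nat \<Rightarrow> nat) \<Rightarrow> nat \<Rightarrow> bool"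
  where "type_D_even r s a d n m \<longleftrightarrow>
    (\<exists>k\<ge>3. r = k - 1 \<and> s = k + 2 \<and>
      (\<forall>i\<in>{1..r}. \<forall>j\<in>{1..s}. a i j =
        (if (i = 1 \<and> j \<in> {1, 2, 3}) \<or>
            (i \<in> {2..k - 2} \<and> j \<in> {i + 1, i + 2}) \<or>
            (i = k - 1 \<and> j \<in> {k, k + 1, k + 2})
         then 1 else 0)) \<and>
      (\<forall>j\<in>{1, 2, k + 1, k + 2}. n j = m) \<and> (\<forall>j\<in>{3..k}. n j = 2 * m) \<and>
      (\<forall>i\<in>{1..k - 1}. d i = 2 * m))"

definition type_D_odd :: "nat \<Rightarrow> nat \<Rightarrow> (nat \<Rightarrow> nat \<Rightarrow> nat) \<Rightarrow> (nat \<Rightarrow> nat) \<Rightarrow> (nat \<Rightarrow> nat) \<Rightarrow> nat \<Rightarrow> bool"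
  where "type_D_odd r s a d n m \<longleftrightarrow>
    (\<exists>k\<ge>3. r = k \<and> s = k \<and>
      (\<forall>i\<in>{1..k}. \<forall>j\<in>{1..k}. a i j =
        (if (i = 1 \<and> j \<in> {1, 2, 3}) \<or>
            (i \<in> {2..k - 2} \<and> j \<in> {i + 1, i + 2}) \<or>
            (i \<in> {k - 1, k} \<and> j = k)
         then 1 else 0)) \<and>
      (\<forall>j\<in>{1, 2}. n j = m) \<and> (\<forall>j\<in>{3..k}. n j = 2 * m) \<and>
      (\<forall>i\<in>{1..k - 2}. d i = 2 * m) \<and> (\<forall>i\<in>{k - 1, k}. d i = m))"

definition type_E7 :: "nat \<Rightarrow> nat \<Rightarrow> (nat \<Rightarrow> nat \<Rightarrow> nat) \<Rightarrow> (nat \<Rightarrow> nat) \<Rightarrow> (nat \<Rightarrow> nat) \<Rightarrow> nat \<Rightarrow> bool"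
  where "type_E7 r s a d n m \<longleftrightarrow>
    r = 3 \<and> s = 5 \<and>
    matrix_is r s a
      [[1, 1, 0, 0, 0],
       [0, 1, 1, 1, 0],
       [0, 0, 0, 1, 1]] \<and>
    vector_is s n [m, 3 * m, 2 * m, 3 * m, m] \<and> vector_is r d [2 * m, 4 * m, 2 * m]"

definition type_E8 :: "nat \<Rightarrow> nat \<Rightarrow> (nat \<Rightarrow> nat \<Rightarrow> nat) \<Rightarrow> (nat \<Rightarrow> nat) \<Rightarrow> (nat \<Rightarrow> nat) \<Rightarrow> nat \<Rightarrow> bool"
  where "type_E8 r s a d n m \<longleftrightarrow>
    r = 4 \<and> s = 5 \<and>
    matrix_is r s a
      [[1, 0, 0, 0, 0],
       [1, 1, 1, 0, 0],
       [0, 0, 1, 1, 0],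
       [0, 0, 0, 1, 1]] \<and>
    vector_is s n [4 * m, 3 * m, 5 * m, 3 * m, m] \<and> vector_is r d [2 * m, 6 * m, 4 * m, 2 * m]"

definition affine_list :: "nat \<Rightarrow> nat \<Rightarrow> (nat \<Rightarrow> nat \<Rightarrow> nat) \<Rightarrow> (nat \<Rightarrow> nat) \<Rightarrow> (nat \<Rightarrow> nat) \<Rightarrow> bool"
  where "affine_list r s a d n \<longleftrightarrow>
    (\<exists>m>0. type_A1 r s a d n m \<or> type_A_odd r s a d n m \<or> type_E6 r s a d n m \<or>
      type_D4 r s a d n m \<or> type_D_even r s a d n m \<or> type_D_odd r s a d n m \<or>
      type_E7 r s a d n m \<or> type_E8 r s a d n m)"

end

theory Submission
  imports Defs
begin

text \<open>
  Let \<open>\<epsilon>\<close> be the unit of a summand \<open>End(V\<^sub>i)\<close> of \<open>\<A>\<close>.  In \<open>\<L>\<epsilon>\<close> the subspace \<open>\<A>\<epsilon>\<close> is isotropic,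
  and the form pairs it with \<open>\<L>\<epsilon>\<close> without left kernel, so \<open>dim \<L>\<epsilon> \<ge> 2 dim \<A>\<epsilon>\<close>, that is
  \<open>\<Sum>\<^sub>j a\<^sub>i\<^sub>j n\<^sub>j \<ge> 2 m\<^sub>i\<close>.  Symmetrically \<open>\<Sum>\<^sub>i a\<^sub>i\<^sub>j m\<^sub>i \<ge> 2 n\<^sub>j\<close>.  Since \<open>dim \<L> = dim \<A> + dim \<B>\<close>, all of these
  are equalities: on the connected bipartite graph with edge multiplicities \<open>a\<^sub>i\<^sub>j\<close>, twice the value of the
  positive function \<open>d = (m, n)\<close> at a vertex is the sum of its values at the neighbours.

  Such graphs are classified by looking at a vertex \<open>x\<close> where \<open>d\<close> is maximal.  A double edge is the whole graph.
  Otherwise every neighbour \<open>y\<close> of a vertex \<open>z\<close> has \<open>2 d(y) \<ge> d(z)\<close>, hence a path along which \<open>d\<close> decreases cannot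
  branch, and \<open>d\<close> decreases on it in an arithmetic progression down to a leaf.  If all neighbours of \<open>x\<close> are
  smaller, \<open>x\<close> is the centre of a star of such arms, and either there are four of them, all of length 1, or three
  of them, whose lengths satisfy \<open>1/p + 1/q + 1/r = 1\<close>.  If not, the maximal vertices form a cycle or a path with
  two leaves attached to each end.
\<close>

section \<open>Coordinates on subspaces\<close>

text \<open>The right action of the first algebra touches only the dual factor of a summand, so
  \<epsilon> keeps exactly the summands of its row. Hence \<open>\<L>\<epsilon>\<close> has
  dimension \<open>m\<^sub>i\<close> times the weighted row sum, \<open>\<A>\<epsilon>\<close> has
  dimension \<open>m\<^sub>i\<close> squared, and the inequality for the row first appears
  multiplied by \<open>m\<^sub>i\<close>. In this form the inequalities can be added: the right-hand
  sides of all rows sum to \<open>dim \<L>\<close>, and so do those of all columns, which is why one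
  upper bound on \<open>dim \<L>\<close> forces equality everywhere. What remains says that d is a
  positive vector in the kernel of the generalised Cartan matrix of a connected graph; the m of the
  tables is its smallest value. The bound \<open>2 d(y) \<ge> d(z)\<close> holds because z is itself
  a term of the sum at y, and it is what limits the number of neighbours of a vertex. The tables
  distinguish rows from columns, so the graph is read off from a row only, and a start in a column
  is reduced to this by transposition.\<close>

lemma vector_space_times: "vector_space ((*) :: complex \<Rightarrow> complex \<Rightarrow> complex)"
  by unfold_locales (simp_all add: algebra_simps)

lemma vector_space_fscale:
  assumes "vector_space s"
  shows "vector_space (fscale s :: complex \<Rightarrow> ('a \<Rightarrow> 'b::ab_group_add) \<Rightarrow> 'a \<Rightarrow> 'b)"
proof -
  interpret vector_space s by fact
  show ?thesis
    by unfold_locales (auto simp: fscale_def fun_eq_iff scale_right_distrib scale_left_distrib)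
qed

lemma sum_apply: "(\<Sum>i\<in>I. F i) x = (\<Sum>i\<in>I. F i x)"
  by (induction I rule: infinite_finite_induct) auto

lemma subspaceI':
  assumes "vector_space s" "0 \<in> S" "\<And>x y. x \<in> S \<Longrightarrow> y \<in> S \<Longrightarrow> x + y \<in> S" "\<And>c x. x \<in> S \<Longrightarrow> s c x \<in> S"
  shows "module.subspace s S"
proof -
  interpret vector_space s by fact
  show ?thesis using assms(2-) by (simp add: subspace_def)
qed

lemma subspaceD:
  assumes "vector_space s" "module.subspace s S"
  shows "0 \<in> S" "x \<in> S \<Longrightarrow> y \<in> S \<Longrightarrow> x + y \<in> S" "x \<in> S \<Longrightarrow> s c x \<in> S"
proof -
  interpret vector_space s by fact
  show "0 \<in> S" "x \<in> S \<Longrightarrow> y \<in> S \<Longrightarrow> x + y \<in> S" "x \<in> S \<Longrightarrow> s c x \<in> S"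
    using assms(2) by (auto simp: subspace_def)
qed

lemma subspace_sum':
  assumes "vector_space s" "module.subspace s S" "\<And>i. i \<in> I \<Longrightarrow> x i \<in> S"
  shows "(\<Sum>i\<in>I. s (c i) (x i)) \<in> S"
proof -
  interpret vector_space s by fact
  show ?thesis using assms(2,3) by (intro subspace_sum subspace_scale) auto
qed

lemma linear_onD:
  assumes "linear_on s1 s2 S f"
  shows "x \<in> S \<Longrightarrow> y \<in> S \<Longrightarrow> f (x + y) = f x + f y" "x \<in> S \<Longrightarrow> f (s1 c x) = s2 c (f x)"
  using assms by (auto simp: linear_on_def)

lemma linear_on_0:
  assumes "vector_space s1" "module.subspace s1 S" "linear_on s1 s2 S f"
  shows "f 0 = 0"
  using linear_onD(1)[OF assms(3), of 0 0] subspaceD(1)[OF assms(1,2)] by simp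

lemma linear_on_sum:
  assumes "vector_space s1" "module.subspace s1 S" "linear_on s1 s2 S f" "\<And>i. i \<in> I \<Longrightarrow> x i \<in> S"
  shows "f (\<Sum>i\<in>I. s1 (c i) (x i)) = (\<Sum>i\<in>I. s2 (c i) (f (x i)))"
  using assms(4)
proof (induction I rule: infinite_finite_induct)
  case (insert j J)
  have "s1 (c j) (x j) \<in> S" using insert subspaceD(3)[OF assms(1,2)] by auto
  moreover have "(\<Sum>i\<in>J. s1 (c i) (x i)) \<in> S" using insert by (intro subspace_sum'[OF assms(1,2)]) auto
  ultimately have "f (s1 (c j) (x j) + (\<Sum>i\<in>J. s1 (c i) (x i))) =
      f (s1 (c j) (x j)) + f (\<Sum>i\<in>J. s1 (c i) (x i))"
    by (rule linear_onD(1)[OF assms(3)])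
  then show ?case using insert linear_onD(2)[OF assms(3), of "x j" "c j"] by simp
qed (use linear_on_0[OF assms(1-3)] in auto)

text \<open>A basis \<open>D\<close> of the intersection is extended separately to \<open>DA\<close>
  and \<open>DB\<close>. Their union spans the sum, and \<open>D \<subseteq> DA \<inter> DB\<close>
  bounds the overlap from below.\<close>

lemma (in vector_space) dim_plus_inter_le:
  assumes fin: "finite T" "UNIV = span T" and A: "subspace A" and B: "subspace B"
  shows "dim {x + y | x y. x \<in> A \<and> y \<in> B} + dim (A \<inter> B) \<le> dim A + dim B"
proof -
  obtain D where D: "D \<subseteq> A \<inter> B" "independent D" "A \<inter> B \<subseteq> span D" "card D = dim (A \<inter> B)"
    using basis_exists by blast
  obtain DA where DA: "D \<subseteq> DA" "DA \<subseteq> A" "independent DA" "A \<subseteq> span DA"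
    using maximal_independent_subset_extend[of D A] D by blast
  obtain DB where DB: "D \<subseteq> DB" "DB \<subseteq> B" "independent DB" "B \<subseteq> span DB"
    using maximal_independent_subset_extend[of D B] D by blast
  have fin': "finite DA" "finite DB"
    using independent_span_bound[OF fin(1) DA(3)] independent_span_bound[OF fin(1) DB(3)] fin(2) by auto
  have dims: "dim A = card DA" "dim B = card DB"
    using dim_span_eq_card_independent[OF DA(3)] dim_span_eq_card_independent[OF DB(3)]
      span_subspace[OF DA(2,4) A] span_subspace[OF DB(2,4) B] by simp_all
  obtain E where E: "E \<subseteq> {x + y | x y. x \<in> A \<and> y \<in> B}" "independent E"
    "card E = dim {x + y | x y. x \<in> A \<and> y \<in> B}"
    using basis_exists by blast
  have "E \<subseteq> span (DA \<union> DB)"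
  proof
    fix e assume "e \<in> E"
    then obtain x y where "e = x + y" "x \<in> A" "y \<in> B" using E(1) by blast
    then show "e \<in> span (DA \<union> DB)"
      using DA(4) DB(4) span_mono[of DA "DA \<union> DB"] span_mono[of DB "DA \<union> DB"]
      by (auto intro!: span_add)
  qed
  then have "card E \<le> card (DA \<union> DB)" using independent_span_bound[of "DA \<union> DB" E] E(2) fin' by auto
  moreover have "card D \<le> card (DA \<inter> DB)" using DA(1) DB(1) fin' by (intro card_mono) auto
  moreover have "card (DA \<union> DB) + card (DA \<inter> DB) = card DA + card DB"
    using card_Un_Int[OF fin'] by simp
  ultimately show ?thesis using D(4) E(3) dims by linarith
qed

text \<open>A finite basis \<open>b\<close> with its dual coordinates. The index type is free, so
  that bases of Hom spaces, direct sums and tensor products can be indexed by pairs. The Kronecker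
  delta gives independence and injectivity of \<open>b\<close> at once.\<close>

definition coordinate_system ::
  "(complex \<Rightarrow> 'a::ab_group_add \<Rightarrow> 'a) \<Rightarrow> 'a set \<Rightarrow> 'i set \<Rightarrow> ('i \<Rightarrow> 'a) \<Rightarrow> ('a \<Rightarrow> 'i \<Rightarrow> complex) \<Rightarrow> bool"
  where "coordinate_system s S I b \<phi> \<longleftrightarrow> module.subspace s S \<and> finite I \<and> (\<forall>i\<in>I. b i \<in> S) \<and>
    (\<forall>i\<in>I. linear_on s (*) S (\<lambda>x. \<phi> x i)) \<and>
    (\<forall>x\<in>S. x = (\<Sum>i\<in>I. s (\<phi> x i) (b i))) \<and>
    (\<forall>i\<in>I. \<forall>j\<in>I. \<phi> (b i) j = (if i = j then 1 else 0))"

lemma coordinate_systemD: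
  assumes "coordinate_system s S I b \<phi>"
  shows "module.subspace s S" "finite I" "\<And>i. i \<in> I \<Longrightarrow> b i \<in> S"
    "\<And>i. i \<in> I \<Longrightarrow> linear_on s (*) S (\<lambda>x. \<phi> x i)"
    "\<And>x. x \<in> S \<Longrightarrow> (\<Sum>i\<in>I. s (\<phi> x i) (b i)) = x"
    "\<And>i j. i \<in> I \<Longrightarrow> j \<in> I \<Longrightarrow> \<phi> (b i) j = (if i = j then 1 else 0)"
  using assms unfolding coordinate_system_def by auto

text \<open>Finiteness is included because \<open>dim\<close> is 0 for a space without a finite
  basis.\<close>

definition has_dim :: "(complex \<Rightarrow> 'a::ab_group_add \<Rightarrow> 'a) \<Rightarrow> 'a set \<Rightarrow> nat \<Rightarrow> bool"
  where "has_dim s S k \<longleftrightarrow> fin_dim_subspace s S \<and> vector_space.dim s S = k"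

lemma has_dim_subspace: "has_dim s S k \<Longrightarrow> module.subspace s S"
  by (simp add: has_dim_def fin_dim_subspace_def)

lemma has_dim_coordinate_system:
  assumes s: "vector_space s" and cs: "coordinate_system s S I b \<phi>"
  shows "has_dim s S (card I)"
proof -
  interpret vector_space s by fact
  note cs = coordinate_systemD[OF cs]
  have inj: "inj_on b I"
  proof (rule inj_onI)
    fix i j assume "i \<in> I" "j \<in> I" "b i = b j"
    then show "i = j" using cs(6)[of i j] cs(6)[of j j] by (auto split: if_splits)
  qed
  have "independent (b ` I)"
  proof (rule independent_if_scalars_zero)
    fix f x assume eq: "(\<Sum>x\<in>b ` I. s (f x) x) = 0" and "x \<in> b ` I"
    then obtain j where j: "j \<in> I" "x = b j" by blast
    have "0 = \<phi> (\<Sum>i\<in>I. s (f (b i)) (b i)) j"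
      using linear_on_0[OF s cs(1) cs(4)[OF j(1)]] eq sum.reindex[OF inj, of "\<lambda>x. s (f x) x"] by simp
    also have "\<dots> = (\<Sum>i\<in>I. f (b i) * \<phi> (b i) j)"
      by (rule linear_on_sum[OF s cs(1) cs(4)[OF j(1)] cs(3)])
    also have "\<dots> = (\<Sum>i\<in>I. if i = j then f (b i) else 0)" using cs(6) j by (intro sum.cong) auto
    also have "\<dots> = f x" using cs(2) j by simp
    finally show "f x = 0" by simp
  qed (use cs in auto)
  moreover have span: "span (b ` I) = S"
  proof (rule span_subspace[OF _ _ cs(1)])
    show "S \<subseteq> span (b ` I)"
    proof
      fix x assume "x \<in> S"
      have "(\<Sum>i\<in>I. s (\<phi> x i) (b i)) \<in> span (b ` I)" by (intro span_sum span_scale span_base) auto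
      then show "x \<in> span (b ` I)" using cs(5)[OF \<open>x \<in> S\<close>] by simp
    qed
  qed (use cs in auto)
  ultimately have "dim S = card (b ` I)" by (metis dim_span_eq_card_independent)
  then show ?thesis
    unfolding has_dim_def fin_dim_subspace_def using card_image[OF inj] span cs(1,2) by auto
qed

lemma coordinate_system_exists:
  assumes s: "vector_space s" and "fin_dim_subspace s S"
  obtains I \<phi> where "coordinate_system s S I (\<lambda>x. x) \<phi>" "card I = vector_space.dim s S"
proof -
  interpret vector_space s by fact
  obtain X where S: "subspace S" and X: "finite X" "span X = S"
    using assms(2) by (auto simp: fin_dim_subspace_def)
  obtain I where I: "I \<subseteq> S" "independent I" "S \<subseteq> span I" "card I = dim S" using basis_exists by blast
  have fin: "finite I" using independent_span_bound[OF X(1) I(2)] I(1) X(2) by simp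
  have sp: "x \<in> span I" if "x \<in> S" for x using that I(3) by blast
  have "coordinate_system s S I (\<lambda>x. x) (representation I)"
    unfolding coordinate_system_def
  proof (intro conjI ballI)
    show "linear_on s (*) S (\<lambda>x. representation I x i)" for i
      unfolding linear_on_def using sp representation_add[OF I(2)] representation_scale[OF I(2)] by auto
    show "x = (\<Sum>i\<in>I. s (representation I x i) i)" if "x \<in> S" for x
      using sum_representation_eq[OF I(2) sp[OF that] fin order_refl] by simp
    show "representation I i j = (if i = j then 1 else 0)" if "i \<in> I" for i j
      using representation_basis[OF I(2) that] by auto
  qed (use S fin I in auto)
  then show ?thesis using that I(4) by blast
qed

section \<open>Coordinates on Hom spaces, direct sums and isomorphic copies\<close>

definition Hom_space ::
  "(complex \<Rightarrow> 'a::ab_group_add \<Rightarrow> 'a) \<Rightarrow> (complex \<Rightarrow> 'b::ab_group_add \<Rightarrow> 'b) \<Rightarrow> 'a set \<Rightarrow> 'b set \<Rightarrow> ('a \<Rightarrow> 'b) set"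
  where "Hom_space s1 s2 V W = {f. linear_on s1 s2 V f \<and> f ` V \<subseteq> W \<and> (\<forall>x. x \<notin> V \<longrightarrow> f x = 0)}"

lemma End_space_eq: "End_space s V = Hom_space s s V V"
  by (simp add: End_space_def Hom_space_def)

lemma dual_space_eq: "dual_space s V = Hom_space s (*) V UNIV"
  by (simp add: dual_space_def Hom_space_def)

text \<open>The basis consists of the matrix units taking \<open>b i\<close> to \<open>c j\<close>,
  extended by zero off \<open>V\<close> as the normalisation demands; the coordinates of a map are
  its matrix entries.\<close>

lemma coordinate_system_Hom:
  assumes s1: "vector_space s1" and s2: "vector_space s2"
    and V: "coordinate_system s1 V I b \<phi>" and W: "coordinate_system s2 W J c \<psi>"
  shows "coordinate_system (fscale s2) (Hom_space s1 s2 V W) (I \<times> J)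
    (\<lambda>(i, j) v. if v \<in> V then s2 (\<phi> v i) (c j) else 0) (\<lambda>f (i, j). \<psi> (f (b i)) j)"
proof -
  interpret W: vector_space s2 by fact
  note V = coordinate_systemD[OF V] and W = coordinate_systemD[OF W]
  note Vs = subspaceD[OF s1 V(1)] and Ws = subspaceD[OF s2 W(1)]
  show ?thesis
    unfolding coordinate_system_def
  proof (intro conjI ballI)
    show "module.subspace (fscale s2) (Hom_space s1 s2 V W)"
      by (rule subspaceI'[OF vector_space_fscale[OF s2]])
        (use Ws in \<open>auto simp: Hom_space_def linear_on_def fscale_def W.scale_right_distrib W.scale_left_commute image_subset_iff\<close>)
    show "finite (I \<times> J)" using V W by simp
  next
    fix k assume "k \<in> I \<times> J"
    then obtain i j where k: "k = (i, j)" "i \<in> I" "j \<in> J" by blast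
    show "(case k of (i, j) \<Rightarrow> \<lambda>v. if v \<in> V then s2 (\<phi> v i) (c j) else 0) \<in> Hom_space s1 s2 V W"
      using k Ws W(3) Vs linear_onD[OF V(4)[OF k(2)]]
      by (auto simp: Hom_space_def linear_on_def W.scale_left_distrib)
    show "linear_on (fscale s2) (*) (Hom_space s1 s2 V W) (\<lambda>f. case k of (i, j) \<Rightarrow> \<psi> (f (b i)) j)"
      using k V(3)[OF k(2)] linear_onD[OF W(4)[OF k(3)]]
      unfolding linear_on_def by (auto simp: Hom_space_def fscale_def image_subset_iff)
  next
    fix f assume f: "f \<in> Hom_space s1 s2 V W"
    show "f = (\<Sum>k\<in>I \<times> J. fscale s2 (case k of (i, j) \<Rightarrow> \<psi> (f (b i)) j)
        (case k of (i, j) \<Rightarrow> \<lambda>v. if v \<in> V then s2 (\<phi> v i) (c j) else 0))" (is "f = ?F")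
    proof
      fix v
      have F: "?F v = (\<Sum>i\<in>I. \<Sum>j\<in>J. s2 (\<psi> (f (b i)) j) (if v \<in> V then s2 (\<phi> v i) (c j) else 0))"
        by (simp add: sum_apply fscale_def sum.cartesian_product split_def)
      show "f v = ?F v"
      proof (cases "v \<in> V")
        case True
        have "?F v = (\<Sum>i\<in>I. s2 (\<phi> v i) (\<Sum>j\<in>J. s2 (\<psi> (f (b i)) j) (c j)))"
          unfolding F using True by (simp add: W.scale_sum_right mult.commute)
        also have "\<dots> = (\<Sum>i\<in>I. s2 (\<phi> v i) (f (b i)))"
          using W(5) V(3) f by (intro sum.cong refl) (auto simp: Hom_space_def)
        also have "\<dots> = f (\<Sum>i\<in>I. s1 (\<phi> v i) (b i))"
          using f by (intro linear_on_sum[OF s1 V(1) _ V(3), symmetric]) (simp add: Hom_space_def)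
        also have "\<dots> = f v" using V(5)[OF True] by simp
        finally show ?thesis by simp
      next
        case False
        then show ?thesis using f unfolding F by (simp add: Hom_space_def)
      qed
    qed
  next
    fix k k' assume "k \<in> I \<times> J" "k' \<in> I \<times> J"
    then obtain i j i' j' where k: "k = (i, j)" "i \<in> I" "j \<in> J" "k' = (i', j')" "i' \<in> I" "j' \<in> J" by blast
    show "(case k' of (i', j') \<Rightarrow>
        \<psi> ((case k of (i, j) \<Rightarrow> \<lambda>v. if v \<in> V then s2 (\<phi> v i) (c j) else 0) (b i')) j') =
        (if k = k' then 1 else 0)"
      using k V(3) V(6) W(6) linear_onD(2)[OF W(4)[OF k(6)] W(3)[OF k(3)]]
        linear_on_0[OF s2 W(1) W(4)[OF k(6)]] by auto
  qed
qed

text \<open>The target of the dual space, which is thereby treated as a Hom space into one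
  dimension.\<close>

lemma coordinate_system_complex: "coordinate_system (*) (UNIV :: complex set) {()} (\<lambda>_. 1) (\<lambda>x _. x)"
  unfolding coordinate_system_def using subspaceI'[OF vector_space_times, of UNIV] by (auto simp: linear_on_def)

lemma coordinate_system_direct_sum:
  assumes s: "vector_space s" and K: "finite K"
    and cs: "\<And>k. k \<in> K \<Longrightarrow> coordinate_system s (S k) (I k) (b k) (\<phi> k)"
  shows "coordinate_system (fscale s) (direct_sum K S) (Sigma K I)
    (\<lambda>(k, i) k'. if k' = k then b k i else 0) (\<lambda>F (k, i). \<phi> k (F k) i)"
proof -
  interpret vector_space s by fact
  note cs' = coordinate_systemD[OF cs]
  note sub = subspaceD[OF s cs'(1)]
  show ?thesis
    unfolding coordinate_system_def
  proof (intro conjI ballI)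
    show "module.subspace (fscale s) (direct_sum K S)"
      by (rule subspaceI'[OF vector_space_fscale[OF s]])
        (use sub in \<open>auto simp: direct_sum_def fscale_def split: if_splits\<close>)
    show "finite (Sigma K I)" using K cs'(2) by auto
  next
    fix x assume "x \<in> Sigma K I"
    then obtain k i where x: "x = (k, i)" "k \<in> K" "i \<in> I k" by blast
    show "(case x of (k, i) \<Rightarrow> \<lambda>k'. if k' = k then b k i else 0) \<in> direct_sum K S"
      using x cs'(3) sub(1) by (auto simp: direct_sum_def)
    show "linear_on (fscale s) (*) (direct_sum K S) (\<lambda>F. case x of (k, i) \<Rightarrow> \<phi> k (F k) i)"
      unfolding linear_on_def
    proof (intro conjI ballI allI)
      fix F G assume "F \<in> direct_sum K S" "G \<in> direct_sum K S"
      then have "F k \<in> S k" "G k \<in> S k" using x(2) by (auto simp: direct_sum_def split: if_splits)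
      then show "(case x of (k, i) \<Rightarrow> \<phi> k ((F + G) k) i) =
          (case x of (k, i) \<Rightarrow> \<phi> k (F k) i) + (case x of (k, i) \<Rightarrow> \<phi> k (G k) i)"
        using linear_onD(1)[OF cs'(4)[OF x(2,3)]] x(1) by simp
    next
      fix c F assume "F \<in> direct_sum K S"
      then have "F k \<in> S k" using x(2) by (auto simp: direct_sum_def split: if_splits)
      then show "(case x of (k, i) \<Rightarrow> \<phi> k (fscale s c F k) i) = c * (case x of (k, i) \<Rightarrow> \<phi> k (F k) i)"
        using linear_onD(2)[OF cs'(4)[OF x(2,3)]] x(1) by (simp add: fscale_def)
    qed
  next
    fix F assume F: "F \<in> direct_sum K S"
    show "F = (\<Sum>x\<in>Sigma K I. fscale s (case x of (k, i) \<Rightarrow> \<phi> k (F k) i)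
        (case x of (k, i) \<Rightarrow> \<lambda>k'. if k' = k then b k i else 0))" (is "F = ?G")
    proof
      fix k'
      have "?G k' = (\<Sum>(k, i)\<in>Sigma K I. s (\<phi> k (F k) i) (if k' = k then b k i else 0))"
        by (simp add: sum_apply fscale_def split_def)
      also have "\<dots> = (\<Sum>k\<in>K. \<Sum>i\<in>I k. s (\<phi> k (F k) i) (if k' = k then b k i else 0))"
        using K cs'(2) by (subst sum.Sigma) auto
      also have "\<dots> = (\<Sum>k\<in>K. if k = k' then F k' else 0)"
      proof (rule sum.cong[OF refl])
        fix k assume k: "k \<in> K"
        then have "F k \<in> S k" using F by (auto simp: direct_sum_def split: if_splits)
        then show "(\<Sum>i\<in>I k. s (\<phi> k (F k) i) (if k' = k then b k i else 0)) = (if k = k' then F k' else 0)"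
          using cs'(5)[OF k] by auto
      qed
      also have "\<dots> = F k'" using K F by (auto simp: direct_sum_def)
      finally show "F k' = ?G k'" by simp
    qed
  next
    fix x y assume "x \<in> Sigma K I" "y \<in> Sigma K I"
    then obtain k i k' i' where "x = (k, i)" "k \<in> K" "i \<in> I k" "y = (k', i')" "k' \<in> K" "i' \<in> I k'" by blast
    then show "(case y of (k', i') \<Rightarrow> \<phi> k' ((case x of (k, i) \<Rightarrow> \<lambda>k'. if k' = k then b k i else 0) k') i') =
        (if x = y then 1 else 0)"
      using cs'(6) linear_on_0[OF s cs'(1) cs'(4)] by auto
  qed
qed

lemma coordinate_system_iso:
  assumes s1: "vector_space s1" and s2: "vector_space s2"
    and S: "module.subspace s1 S" and f: "linear_iso_on s1 s2 S T f" and T: "coordinate_system s2 T I c \<psi>"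
  shows "coordinate_system s1 S I (\<lambda>i. inv_into S f (c i)) (\<lambda>x. \<psi> (f x))"
proof -
  note cs = coordinate_systemD[OF T]
  have lin: "linear_on s1 s2 S f" and bij: "bij_betw f S T" using f by (auto simp: linear_iso_on_def)
  have fS: "f x \<in> T" if "x \<in> S" for x using bij that by (auto simp: bij_betw_def)
  have inv: "inv_into S f y \<in> S" "f (inv_into S f y) = y" if "y \<in> T" for y
    using bij that by (auto simp: bij_betw_def inv_into_into f_inv_into_f)
  show ?thesis
    unfolding coordinate_system_def
  proof (intro conjI ballI)
    fix i assume i: "i \<in> I"
    show "inv_into S f (c i) \<in> S" using inv cs(3) i by simp
    show "linear_on s1 (*) S (\<lambda>x. \<psi> (f x) i)"
      using linear_onD[OF lin] linear_onD[OF cs(4)[OF i]] fS by (simp add: linear_on_def)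
    show "\<psi> (f (inv_into S f (c i))) j = (if i = j then 1 else 0)" if "j \<in> I" for j
      using inv cs(3,6) i that by simp
  next
    fix x assume x: "x \<in> S"
    have sum: "(\<Sum>i\<in>I. s1 (\<psi> (f x) i) (inv_into S f (c i))) \<in> S"
      using inv cs(3) by (intro subspace_sum'[OF s1 S]) auto
    have "f (\<Sum>i\<in>I. s1 (\<psi> (f x) i) (inv_into S f (c i))) = (\<Sum>i\<in>I. s2 (\<psi> (f x) i) (f (inv_into S f (c i))))"
      using inv cs(3) by (intro linear_on_sum[OF s1 S lin]) auto
    also have "\<dots> = (\<Sum>i\<in>I. s2 (\<psi> (f x) i) (c i))" using inv cs(3) by (intro sum.cong) auto
    also have "\<dots> = f x" using cs(5)[OF fS[OF x]] .
    finally show "x = (\<Sum>i\<in>I. s1 (\<psi> (f x) i) (inv_into S f (c i)))"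
      using bij x sum by (auto simp: bij_betw_def inj_on_def)
  qed (use S cs in auto)
qed

section \<open>Tensor products and isotropic subspaces\<close>

lemma bilinear_onD:
  assumes "bilinear_on s1 s2 s3 S T \<beta>"
  shows "x \<in> S \<Longrightarrow> linear_on s2 s3 T (\<beta> x)" "y \<in> T \<Longrightarrow> linear_on s1 s3 S (\<lambda>x. \<beta> x y)"
  using assms by (auto simp: bilinear_on_def)

lemma tensor_product_subspace: "module.subspace (fscale (*)) (tensor_product sU sW U W)"
proof -
  interpret T: vector_space "fscale (*) :: complex \<Rightarrow> (('a \<Rightarrow> 'b \<Rightarrow> complex) \<Rightarrow> complex) \<Rightarrow> _"
    by (rule vector_space_fscale[OF vector_space_times])
  show ?thesis unfolding tensor_product_def by (rule T.subspace_span)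
qed

lemma tensor_product_induct [consumes 1, case_names zero add scale pure]:
  assumes "t \<in> tensor_product sU sW U W"
    and "P (\<lambda>_. 0)" "\<And>t t'. P t \<Longrightarrow> P t' \<Longrightarrow> P (\<lambda>\<beta>. t \<beta> + t' \<beta>)" "\<And>c t. P t \<Longrightarrow> P (\<lambda>\<beta>. c * t \<beta>)"
    and "\<And>u w. u \<in> U \<Longrightarrow> w \<in> W \<Longrightarrow> P (pure_tensor sU sW U W u w)"
  shows "P t"
proof -
  interpret T: vector_space "fscale (*) :: complex \<Rightarrow> (('a \<Rightarrow> 'b \<Rightarrow> complex) \<Rightarrow> complex) \<Rightarrow> _"
    by (rule vector_space_fscale[OF vector_space_times])
  have "T.subspace {t. P t}"
    unfolding T.subspace_def using assms(2-4) by (auto simp: fscale_def plus_fun_def zero_fun_def)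
  then have "tensor_product sU sW U W \<subseteq> {t. P t}"
    unfolding tensor_product_def using assms(5) by (intro T.span_minimal) auto
  then show ?thesis using assms(1) by blast
qed

lemma tensor_product_not_bilinear:
  assumes "t \<in> tensor_product sU sW U W" "\<not> bilinear_on sU sW (*) U W \<beta>"
  shows "t \<beta> = 0"
  using assms(1) by (induction rule: tensor_product_induct) (use assms(2) in \<open>auto simp: pure_tensor_def\<close>)

text \<open>A pure tensor returns 0 on a function that is not bilinear, so agreement on
  \<open>U\<close> and \<open>W\<close> is accompanied by bilinearity of both functions;
  \<open>bilinear_on_cong\<close> supplies it when \<open>U\<close> and \<open>W\<close> are
  subspaces.\<close>

lemma tensor_product_cong:
  assumes "t \<in> tensor_product sU sW U W"
    and "bilinear_on sU sW (*) U W \<beta>" "bilinear_on sU sW (*) U W \<beta>'"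
    and "\<And>u w. u \<in> U \<Longrightarrow> w \<in> W \<Longrightarrow> \<beta> u w = \<beta>' u w"
  shows "t \<beta> = t \<beta>'"
  using assms(1) by (induction rule: tensor_product_induct) (use assms(2-) in \<open>auto simp: pure_tensor_def\<close>)

text \<open>Both branches of \<open>pure_tensor\<close> give 0 here, the value of \<beta> as well as
  the default.\<close>

lemma tensor_product_vanish:
  assumes "t \<in> tensor_product sU sW U W" "\<And>u w. u \<in> U \<Longrightarrow> w \<in> W \<Longrightarrow> \<beta> u w = 0"
  shows "t \<beta> = 0"
  using assms(1) by (induction rule: tensor_product_induct) (use assms(2) in \<open>auto simp: pure_tensor_def\<close>)

lemma bilinear_on_cong:
  assumes sU: "vector_space sU" "module.subspace sU U" and sW: "vector_space sW" "module.subspace sW W"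
    and "bilinear_on sU sW s U W \<beta>" and eq: "\<And>u w. u \<in> U \<Longrightarrow> w \<in> W \<Longrightarrow> \<beta> u w = \<beta>' u w"
  shows "bilinear_on sU sW s U W \<beta>'"
proof -
  note U = subspaceD[OF sU] and W = subspaceD[OF sW]
  have "linear_on sW s W (\<beta>' u)" if "u \<in> U" for u
    using bilinear_onD(1)[OF assms(5) that] W that unfolding linear_on_def by (simp flip: eq)
  moreover have "linear_on sU s U (\<lambda>u. \<beta>' u w)" if "w \<in> W" for w
    using bilinear_onD(2)[OF assms(5) that] U that unfolding linear_on_def by (simp flip: eq)
  ultimately show ?thesis by (simp add: bilinear_on_def)
qed

text \<open>This and \<open>tensor_map_zero\<close> describe how the unit of a block acts on a
  summand. Such a unit is the identity only on its own space and zero off it, hence the pointwise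
  hypotheses.\<close>

lemma tensor_map_identity:
  assumes sU: "vector_space sU" "module.subspace sU U" and sW: "vector_space sW" "module.subspace sW W"
    and t: "t \<in> tensor_product sU sW U W"
    and f: "\<And>u. u \<in> U \<Longrightarrow> f u = u" and g: "\<And>w. w \<in> W \<Longrightarrow> g w = w"
  shows "tensor_map sU sW U W f g t = t"
proof
  fix \<beta>
  show "tensor_map sU sW U W f g t \<beta> = t \<beta>"
  proof (cases "bilinear_on sU sW (*) U W \<beta>")
    case True
    have "bilinear_on sU sW (*) U W (\<lambda>u w. \<beta> (f u) (g w))"
      by (rule bilinear_on_cong[OF sU sW True]) (use f g in auto)
    then have "t (\<lambda>u w. \<beta> (f u) (g w)) = t \<beta>"
      using f g by (intro tensor_product_cong[OF t _ True]) auto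
    then show ?thesis using True by (simp add: tensor_map_def)
  next
    case False
    then show ?thesis using tensor_product_not_bilinear[OF t] by (simp add: tensor_map_def)
  qed
qed

lemma tensor_map_zero:
  assumes sU: "vector_space sU" "module.subspace sU U" and sW: "vector_space sW" "module.subspace sW W"
    and t: "t \<in> tensor_product sU sW U W"
    and f: "\<And>u. u \<in> U \<Longrightarrow> f u \<in> U" and g: "\<And>w. w \<in> W \<Longrightarrow> g w \<in> W"
    and zero: "(\<forall>u\<in>U. f u = 0) \<or> (\<forall>w\<in>W. g w = 0)"
  shows "tensor_map sU sW U W f g t = 0"
proof
  fix \<beta>
  have "\<beta> (f u) (g w) = 0" if "bilinear_on sU sW (*) U W \<beta>" "u \<in> U" "w \<in> W" for u w
    using zero that linear_on_0[OF sU bilinear_onD(2)[OF that(1) g[OF that(3)]]]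
      linear_on_0[OF sW bilinear_onD(1)[OF that(1) f[OF that(2)]]] by auto
  then show "tensor_map sU sW U W f g t \<beta> = 0 \<beta>"
    using tensor_product_vanish[OF t] by (auto simp: tensor_map_def)
qed

text \<open>The coordinates of a tensor are its values at the product forms
  \<open>\<phi> u i * \<psi> w j\<close>. On pure tensors of basis vectors these are Kronecker
  deltas, which proves independence inside the dual of the bilinear forms; spanning follows by
  expanding a bilinear form in both arguments.\<close>

lemma coordinate_system_tensor:
  assumes sU: "vector_space sU" and sW: "vector_space sW"
    and U: "coordinate_system sU U I b \<phi>" and W: "coordinate_system sW W J c \<psi>"
  shows "coordinate_system (fscale (*)) (tensor_product sU sW U W) (I \<times> J)
    (\<lambda>(i, j). pure_tensor sU sW U W (b i) (c j)) (\<lambda>t (i, j). t (\<lambda>u w. \<phi> u i * \<psi> w j))"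
proof -
  interpret T: vector_space "fscale (*) :: complex \<Rightarrow> (('a \<Rightarrow> 'b \<Rightarrow> complex) \<Rightarrow> complex) \<Rightarrow> _"
    by (rule vector_space_fscale[OF vector_space_times])
  note U = coordinate_systemD[OF U] and W = coordinate_systemD[OF W]
  have bil: "bilinear_on sU sW (*) U W (\<lambda>u w. \<phi> u i * \<psi> w j)" if "i \<in> I" "j \<in> J" for i j
    using linear_onD[OF U(4)[OF that(1)]] linear_onD[OF W(4)[OF that(2)]]
    by (simp add: bilinear_on_def linear_on_def algebra_simps)
  show ?thesis
    unfolding coordinate_system_def
  proof (intro conjI ballI)
    show "module.subspace (fscale (*)) (tensor_product sU sW U W)" by (rule tensor_product_subspace)
    show "finite (I \<times> J)" using U W by simp
  next
    fix k assume "k \<in> I \<times> J"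
    then obtain i j where k: "k = (i, j)" "i \<in> I" "j \<in> J" by blast
    show "(case k of (i, j) \<Rightarrow> pure_tensor sU sW U W (b i) (c j)) \<in> tensor_product sU sW U W"
      unfolding tensor_product_def k(1) prod.case using k(2,3) U(3) W(3) by (intro T.span_base) blast
    show "linear_on (fscale (*)) (*) (tensor_product sU sW U W) (\<lambda>t. case k of (i, j) \<Rightarrow> t (\<lambda>u w. \<phi> u i * \<psi> w j))"
      unfolding k(1) by (simp add: linear_on_def fscale_def)
    show "(case k' of (i', j') \<Rightarrow> (case k of (i, j) \<Rightarrow> pure_tensor sU sW U W (b i) (c j)) (\<lambda>u w. \<phi> u i' * \<psi> w j')) =
      (if k = k' then 1 else 0)" if "k' \<in> I \<times> J" for k'
      using k that bil U(6) W(6) by (auto simp: pure_tensor_def split: if_splits)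
  next
    fix t assume "t \<in> tensor_product sU sW U W"
    then have "t \<beta> = (\<Sum>i\<in>I. \<Sum>j\<in>J. t (\<lambda>u w. \<phi> u i * \<psi> w j) * pure_tensor sU sW U W (b i) (c j) \<beta>)" for \<beta>
    proof (induction rule: tensor_product_induct)
      case (add t t')
      then show ?case by (simp add: algebra_simps sum.distrib)
    next
      case (scale k t)
      then show ?case by (simp add: sum_distrib_left mult.assoc)
    next
      case (pure u w)
      show ?case
      proof (cases "bilinear_on sU sW (*) U W \<beta>")
        case True
        have "\<beta> u w = \<beta> (\<Sum>i\<in>I. sU (\<phi> u i) (b i)) w" using U(5)[OF pure(1)] by simp
        also have "\<dots> = (\<Sum>i\<in>I. \<phi> u i * \<beta> (b i) w)"
          by (rule linear_on_sum[OF sU U(1) bilinear_onD(2)[OF True pure(2)] U(3)])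
        also have "\<dots> = (\<Sum>i\<in>I. \<phi> u i * \<beta> (b i) (\<Sum>j\<in>J. sW (\<psi> w j) (c j)))" using W(5)[OF pure(2)] by simp
        also have "\<dots> = (\<Sum>i\<in>I. \<phi> u i * (\<Sum>j\<in>J. \<psi> w j * \<beta> (b i) (c j)))"
          by (intro sum.cong refl arg_cong2[where f = "(*)"]
              linear_on_sum[OF sW W(1) bilinear_onD(1)[OF True U(3)] W(3)])
        also have "\<dots> = (\<Sum>i\<in>I. \<Sum>j\<in>J. \<phi> u i * \<psi> w j * \<beta> (b i) (c j))"
          by (simp add: sum_distrib_left mult.assoc)
        finally show ?thesis using True bil by (simp add: pure_tensor_def)
      next
        case False
        then show ?thesis by (simp add: pure_tensor_def)
      qed
    qed simp
    note expand = this
    show "t = (\<Sum>k\<in>I \<times> J. fscale (*) (case k of (i, j) \<Rightarrow> t (\<lambda>u w. \<phi> u i * \<psi> w j))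
        (case k of (i, j) \<Rightarrow> pure_tensor sU sW U W (b i) (c j)))" (is "t = ?R")
    proof
      fix \<beta>
      have "?R \<beta> = (\<Sum>i\<in>I. \<Sum>j\<in>J. t (\<lambda>u w. \<phi> u i * \<psi> w j) * pure_tensor sU sW U W (b i) (c j) \<beta>)"
        by (simp add: sum_apply fscale_def sum.cartesian_product split_def)
      then show "t \<beta> = ?R \<beta>" using expand[of \<beta>] by (rule trans[OF _ sym, rotated])
    qed
  qed
qed

section \<open>Isotropic subspaces\<close>

lemma (in vector_space) dim_le_card_fun_injective:
  fixes F :: "'b \<Rightarrow> 'c \<Rightarrow> 'a"
  assumes C: "finite C" and lin: "Vector_Spaces.linear scale (\<lambda>k f x. k * f x) F"
    and supp: "\<And>y c. c \<notin> C \<Longrightarrow> F y c = 0"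
    and Y: "subspace Y" and inj: "\<And>y. y \<in> Y \<Longrightarrow> F y = 0 \<Longrightarrow> y = 0"
  shows "dim Y \<le> card C"
proof -
  interpret F: Vector_Spaces.linear scale "\<lambda>k f x. k * f x" F by fact
  obtain B where B: "B \<subseteq> Y" "independent B" "Y \<subseteq> span B" "card B = dim Y" using basis_exists by blast
  have sp: "span B = Y" by (rule span_subspace[OF B(1,3) Y])
  have inj_Y: "inj_on F Y"
    unfolding F.inj_on_iff_eq_0[OF Y] using inj by blast
  define e where "e c = (\<lambda>x. if x = c then 1 else 0 :: 'a)" for c :: 'c
  have "F.vs2.independent (F ` B)"
    by (rule F.independent_injective_image[OF B(2)]) (use inj_Y sp in simp)
  moreover have "F ` B \<subseteq> F.vs2.span (e ` C)"
  proof
    fix f assume "f \<in> F ` B"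
    then have f: "\<And>c. c \<notin> C \<Longrightarrow> f c = 0" using supp by auto
    have "f = (\<Sum>c\<in>C. (\<lambda>x. f c * e c x))"
    proof
      fix x
      have "(\<Sum>c\<in>C. (\<lambda>x. f c * e c x)) x = (\<Sum>c\<in>C. if x = c then f c else 0)"
        by (induction C rule: infinite_finite_induct) (auto simp: e_def)
      then show "f x = (\<Sum>c\<in>C. (\<lambda>x. f c * e c x)) x" using C f by simp
    qed
    also have "\<dots> \<in> F.vs2.span (e ` C)" by (intro F.vs2.span_sum F.vs2.span_scale F.vs2.span_base) auto
    finally show "f \<in> F.vs2.span (e ` C)" .
  qed
  ultimately have "card (F ` B) \<le> card (e ` C)"
    using F.vs2.independent_span_bound[of "e ` C" "F ` B"] C by blast
  also have "\<dots> \<le> card C" using C by (rule card_image_le)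
  finally show ?thesis
    using card_image[OF inj_on_subset[OF inj_Y B(1)]] B(4) by simp
qed

text \<open>\<open>Y\<close> embeds into the dual of a complement of \<open>Y\<close> in \<open>X\<close>.\<close>
lemma (in vector_space) dim_isotropic_le:
  fixes form :: "'b \<Rightarrow> 'b \<Rightarrow> 'a"
  assumes fin: "finite T" "UNIV = span T"
    and add: "\<And>x y z. form (x + y) z = form x z + form y z" "\<And>x y z. form x (y + z) = form x y + form x z"
    and scale: "\<And>c x y. form (scale c x) y = c * form x y" "\<And>c x y. form x (scale c y) = c * form x y"
    and X: "subspace X" and Y: "subspace Y" "Y \<subseteq> X"
    and isotropic: "\<And>x y. x \<in> Y \<Longrightarrow> y \<in> Y \<Longrightarrow> form x y = 0"
    and nondeg: "\<And>y. y \<in> Y \<Longrightarrow> (\<And>x. x \<in> X \<Longrightarrow> form x y = 0) \<Longrightarrow> y = 0"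
  shows "2 * dim Y \<le> dim X"
proof -
  obtain D where D: "D \<subseteq> Y" "independent D" "Y \<subseteq> span D" "card D = dim Y" using basis_exists by blast
  have "D \<subseteq> X" using D(1) Y(2) by blast
  from maximal_independent_subset_extend[OF this D(2)]
  obtain E where E: "D \<subseteq> E" "E \<subseteq> X" "independent E" "X \<subseteq> span E" by blast
  have fin_E: "finite E" using independent_span_bound[OF fin(1) E(3)] unfolding fin(2)[symmetric] by blast
  have dimX: "dim X = card E"
    unfolding span_subspace[OF E(2,4) X, symmetric] by (rule dim_span_eq_card_independent[OF E(3)])
  define F where "F y = (\<lambda>c. if c \<in> E - D then form c y else 0)" for y
  have "dim Y \<le> card (E - D)"
  proof (rule dim_le_card_fun_injective[where F = F and C = "E - D" and Y = Y])
    show "Vector_Spaces.linear scale (\<lambda>k f x. k * f x) F"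
    proof -
      interpret F: vector_space "\<lambda>k f x. k * f x :: 'a"
        by unfold_locales (auto simp: fun_eq_iff algebra_simps)
      show ?thesis
        unfolding Vector_Spaces.linear_iff
        using vector_space_axioms F.vector_space_axioms by (auto simp: F_def fun_eq_iff add scale)
    qed
    fix y assume y: "y \<in> Y" "F y = 0"
    have "form x y = 0" if "x \<in> E" for x
    proof (cases "x \<in> D")
      case True
      then show ?thesis using isotropic[of x y] y(1) D(1) by blast
    next
      case False
      then show ?thesis using fun_cong[OF y(2), of x] that by (simp add: F_def)
    qed
    moreover have "form 0 y = 0" using scale(1)[of 0 0 y] by simp
    ultimately have "span E \<subseteq> {x. form x y = 0}"
      by (intro span_minimal) (auto simp: subspace_def add scale)
    then show "y = 0" using nondeg[OF y(1)] E(4) by blast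
  qed (use fin_E Y(1) in \<open>auto simp: F_def\<close>)
  also have "\<dots> = card E - card D" using E(1) fin_E finite_subset by (intro card_Diff_subset) auto
  finally show ?thesis using dimX D(4) card_mono[OF fin_E E(1)] by linarith
qed

section \<open>Dimensions of the semi-simple algebras and of the bimodule\<close>

lemma has_dim_obtain:
  assumes "vector_space s" "has_dim s S k"
  obtains I \<phi> where "coordinate_system s S I (\<lambda>x. x) \<phi>" "card I = k"
  using coordinate_system_exists[OF assms(1)] assms(2) unfolding has_dim_def by metis

lemma has_dim_Hom:
  assumes s1: "vector_space s1" and s2: "vector_space s2" and V: "has_dim s1 V k" and W: "has_dim s2 W l"
  shows "has_dim (fscale s2) (Hom_space s1 s2 V W) (k * l)"
proof -
  obtain I \<phi> where I: "coordinate_system s1 V I (\<lambda>x. x) \<phi>" "card I = k" by (rule has_dim_obtain[OF s1 V])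
  obtain J \<psi> where J: "coordinate_system s2 W J (\<lambda>x. x) \<psi>" "card J = l" by (rule has_dim_obtain[OF s2 W])
  show ?thesis
    using has_dim_coordinate_system[OF vector_space_fscale[OF s2] coordinate_system_Hom[OF s1 s2 I(1) J(1)]]
    by (simp add: card_cartesian_product I J)
qed

lemma has_dim_End:
  assumes "vector_space s" "has_dim s V k"
  shows "has_dim (fscale s) (End_space s V) (k * k)"
  unfolding End_space_eq using assms by (rule has_dim_Hom[OF _ assms(1) _ assms(2)])

lemma has_dim_dual:
  assumes "vector_space s" "has_dim s V k"
  shows "has_dim (fscale (*)) (dual_space s V) k"
  using has_dim_Hom[OF assms(1) vector_space_times assms(2)
      has_dim_coordinate_system[OF vector_space_times coordinate_system_complex]]
  by (simp add: dual_space_eq)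

lemma has_dim_tensor:
  assumes sU: "vector_space sU" and sW: "vector_space sW" and U: "has_dim sU U k" and W: "has_dim sW W l"
  shows "has_dim (fscale (*)) (tensor_product sU sW U W) (k * l)"
proof -
  obtain I \<phi> where I: "coordinate_system sU U I (\<lambda>x. x) \<phi>" "card I = k" by (rule has_dim_obtain[OF sU U])
  obtain J \<psi> where J: "coordinate_system sW W J (\<lambda>x. x) \<psi>" "card J = l" by (rule has_dim_obtain[OF sW W])
  show ?thesis
    using has_dim_coordinate_system[OF vector_space_fscale[OF vector_space_times]
        coordinate_system_tensor[OF sU sW I(1) J(1)]]
    by (simp add: card_cartesian_product I J)
qed

lemma has_dim_direct_sum:
  assumes s: "vector_space s" and K: "finite K" and dim: "\<And>k. k \<in> K \<Longrightarrow> has_dim s (S k) (f k)"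
  shows "has_dim (fscale s) (direct_sum K S) (\<Sum>k\<in>K. f k)"
proof -
  have "\<forall>k\<in>K. \<exists>I \<phi>. coordinate_system s (S k) I (\<lambda>x. x) \<phi> \<and> card I = f k"
    using has_dim_obtain[OF s dim] by metis
  then obtain I \<phi> where I: "\<And>k. k \<in> K \<Longrightarrow> coordinate_system s (S k) (I k) (\<lambda>x. x) (\<phi> k)"
    and card: "\<And>k. k \<in> K \<Longrightarrow> card (I k) = f k"
    by metis
  have "card (Sigma K I) = (\<Sum>k\<in>K. f k)"
    using K card coordinate_systemD(2)[OF I] by (subst card_SigmaI) auto
  moreover have "coordinate_system (fscale s) (direct_sum K S) (Sigma K I)
      (\<lambda>(k, i) k'. if k' = k then i else 0) (\<lambda>F (k, i). \<phi> k (F k) i)"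
    using coordinate_system_direct_sum[where S = S and I = I and b = "\<lambda>_ x. x" and \<phi> = \<phi>, OF s K I] .
  note has_dim_coordinate_system[OF vector_space_fscale[OF s] this]
  ultimately show ?thesis by simp
qed

lemma has_dim_preimage:
  assumes s1: "vector_space s1" and s2: "vector_space s2" and S: "module.subspace s1 S"
    and f: "linear_iso_on s1 s2 S T f" and T': "T' \<subseteq> T" "has_dim s2 T' k"
  shows "has_dim s1 {x \<in> S. f x \<in> T'} k"
proof -
  obtain I \<phi> where I: "coordinate_system s2 T' I (\<lambda>x. x) \<phi>" "card I = k" by (rule has_dim_obtain[OF s2 T'(2)])
  have lin: "linear_on s1 s2 S f" and bij: "bij_betw f S T" using f by (auto simp: linear_iso_on_def)
  note sub = subspaceD[OF s1 S] and sub' = subspaceD[OF s2 has_dim_subspace[OF T'(2)]]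
  have "module.subspace s1 {x \<in> S. f x \<in> T'}"
    by (rule subspaceI'[OF s1])
      (use sub sub' linear_onD[OF lin] linear_on_0[OF s1 S lin] in auto)
  moreover have "linear_iso_on s1 s2 {x \<in> S. f x \<in> T'} T' f"
    unfolding linear_iso_on_def
  proof
    show "linear_on s1 s2 {x \<in> S. f x \<in> T'} f" using lin by (auto simp: linear_on_def)
    show "bij_betw f {x \<in> S. f x \<in> T'} T'"
      using bij T'(1) unfolding bij_betw_def by (auto simp: inj_on_def image_iff)
  qed
  ultimately show ?thesis
    using has_dim_coordinate_system[OF s1 coordinate_system_iso[OF s1 s2 _ _ I(1)]] I(2) by simp
qed

lemma direct_sum_mono:
  assumes "R \<subseteq> K" "\<And>k. k \<in> K \<Longrightarrow> 0 \<in> S k"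
  shows "direct_sum R S \<subseteq> direct_sum K S"
proof
  fix F assume F: "F \<in> direct_sum R S"
  then have F: "\<And>k. k \<in> R \<Longrightarrow> F k \<in> S k" "\<And>k. k \<notin> R \<Longrightarrow> F k = 0"
    unfolding direct_sum_def by (simp_all split: if_splits)
  have "F k \<in> S k" if "k \<in> K" for k
    using F[of k] assms(2)[OF that] by (cases "k \<in> R") simp_all
  moreover have "F k = 0" if "k \<notin> K" for k
    using F(2) assms(1) that by blast
  ultimately show "F \<in> direct_sum K S" by (simp add: direct_sum_def)
qed

section \<open>Units of the matrix blocks\<close>

definition block_unit :: "(nat \<Rightarrow> 'v set) \<Rightarrow> nat \<Rightarrow> nat \<Rightarrow> 'v \<Rightarrow> 'v::zero"
  where "block_unit V i = (\<lambda>k x. if k = i \<and> x \<in> V i then x else 0)"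

lemma block_unit_in_direct_sum:
  assumes "vector_space sV" "module.subspace sV (V i)"
  shows "block_unit V i \<in> direct_sum {i} (\<lambda>i. End_space sV (V i))"
  using subspaceD[OF assms]
  by (auto simp: direct_sum_def block_unit_def End_space_def linear_on_def fun_eq_iff)

lemma block_unit_comp:
  assumes sV: "vector_space sV" "module.subspace sV (V i)" and F: "F \<in> direct_sum {i} (\<lambda>i. End_space sV (V i))"
  shows "(\<lambda>k. block_unit V i k \<circ> F k) = F" "(\<lambda>k. F k \<circ> block_unit V i k) = F"
proof -
  have Fi: "F i \<in> End_space sV (V i)" and Fk: "\<And>k. k \<noteq> i \<Longrightarrow> F k = 0"
    using F by (auto simp: direct_sum_def split: if_splits)
  have F0: "F i 0 = 0" using linear_on_0[OF sV, of sV "F i"] Fi by (simp add: End_space_def)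
  show "(\<lambda>k. block_unit V i k \<circ> F k) = F"
  proof (intro ext)
    fix k x show "(block_unit V i k \<circ> F k) x = F k x"
      using Fi Fk[of k] by (cases "k = i"; cases "x \<in> V i") (auto simp: block_unit_def End_space_def image_subset_iff)
  qed
  show "(\<lambda>k. F k \<circ> block_unit V i k) = F"
  proof (intro ext)
    fix k x show "(F k \<circ> block_unit V i k) x = F k x"
      using Fi Fk[of k] F0 by (cases "k = i"; cases "x \<in> V i") (auto simp: block_unit_def End_space_def)
  qed
qed

lemma semisimple_decomposition_has_dim:
  assumes "semisimple_decomposition s S mul sV r V d \<rho>" "i \<in> {1..r}"
  shows "has_dim sV (V i) (d i)"
  using assms by (simp add: semisimple_decomposition_def has_dim_def)

lemma semisimple_decomposition_dim_pos:
  assumes dec: "semisimple_decomposition s S mul sV r V d \<rho>" and i: "i \<in> {1..r}"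
  shows "d i > 0"
proof (rule ccontr)
  assume "\<not> d i > 0"
  have sV: "vector_space sV" using dec by (simp add: semisimple_decomposition_def)
  obtain I \<phi> where I: "coordinate_system sV (V i) I (\<lambda>x. x) \<phi>" "card I = d i"
    by (rule has_dim_obtain[OF sV semisimple_decomposition_has_dim[OF assms]])
  then have "I = {}" using \<open>\<not> d i > 0\<close> coordinate_systemD(2)[OF I(1)] by simp
  then have "x = 0" if "x \<in> V i" for x using coordinate_systemD(5)[OF I(1) that] by simp
  moreover have "0 \<in> V i" using subspaceD(1)[OF sV coordinate_systemD(1)[OF I(1)]] .
  ultimately have "V i = {0}" by blast
  then show False using dec i by (simp add: semisimple_decomposition_def)
qed

text \<open>For a singleton \<open>R\<close> this is the ideal generated by the unit of one block,
  for \<open>R = {1..r}\<close> the whole algebra.\<close>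

lemma semisimple_decomposition_has_dim_part:
  assumes dec: "semisimple_decomposition s S mul sV r V d \<rho>" and s: "vector_space s" "module.subspace s S"
    and R: "R \<subseteq> {1..r}"
  shows "has_dim s {x \<in> S. \<rho> x \<in> direct_sum R (\<lambda>i. End_space sV (V i))} (\<Sum>i\<in>R. d i * d i)"
proof -
  have sV: "vector_space sV" and \<rho>: "linear_iso_on s (fscale (fscale sV)) S (direct_sum {1..r} (\<lambda>i. End_space sV (V i))) \<rho>"
    using dec by (auto simp: semisimple_decomposition_def algebra_iso_on_def)
  have End: "has_dim (fscale sV) (End_space sV (V i)) (d i * d i)" if "i \<in> {1..r}" for i
    by (rule has_dim_End[OF sV semisimple_decomposition_has_dim[OF dec that]])
  have "has_dim (fscale (fscale sV)) (direct_sum R (\<lambda>i. End_space sV (V i))) (\<Sum>i\<in>R. d i * d i)"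
    using R End by (intro has_dim_direct_sum vector_space_fscale sV) (auto intro: finite_subset)
  moreover have "direct_sum R (\<lambda>i. End_space sV (V i)) \<subseteq> direct_sum {1..r} (\<lambda>i. End_space sV (V i))"
    using subspaceD(1)[OF vector_space_fscale[OF sV] has_dim_subspace[OF End]] by (intro direct_sum_mono R)
  ultimately show ?thesis
    using has_dim_preimage[OF s(1) vector_space_fscale[OF vector_space_fscale[OF sV]] s(2) \<rho>] by blast
qed

text \<open>\<open>block_unit V i\<close> lies in the range of the bijection \<open>\<rho>\<close>;
  its preimage \<open>u\<close> is the idempotent \<epsilon> that cuts out a row or a
  column.\<close>

lemma central_idempotent_exists:
  assumes dec: "semisimple_decomposition s S mul sV r V d \<rho>" and i: "i \<in> {1..r}"
    and closed: "\<And>x y. x \<in> S \<Longrightarrow> y \<in> S \<Longrightarrow> mul x y \<in> S"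
  obtains u where "u \<in> S" "\<rho> u = block_unit V i"
    "\<rho> u \<in> direct_sum {i} (\<lambda>i. End_space sV (V i))"
    "\<And>y. y \<in> S \<Longrightarrow> \<rho> y \<in> direct_sum {i} (\<lambda>i. End_space sV (V i)) \<Longrightarrow> mul u y = y \<and> mul y u = y"
proof -
  have sV: "vector_space sV"
    and bij: "bij_betw \<rho> S (direct_sum {1..r} (\<lambda>i. End_space sV (V i)))"
    and mul: "\<And>x y. x \<in> S \<Longrightarrow> y \<in> S \<Longrightarrow> \<rho> (mul x y) = (\<lambda>i. \<rho> x i \<circ> \<rho> y i)"
    using dec by (auto simp: semisimple_decomposition_def algebra_iso_on_def linear_iso_on_def)
  note V = has_dim_subspace[OF semisimple_decomposition_has_dim[OF dec]]
  have "direct_sum {i} (\<lambda>i. End_space sV (V i)) \<subseteq> direct_sum {1..r} (\<lambda>i. End_space sV (V i))"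
    using i subspaceD(1)[OF vector_space_fscale[OF sV] has_dim_subspace[OF has_dim_End[OF sV
          semisimple_decomposition_has_dim[OF dec]]]]
    by (intro direct_sum_mono) auto
  moreover note unit = block_unit_in_direct_sum[of sV V i, OF sV V[OF i]]
  ultimately have "block_unit V i \<in> \<rho> ` S" using bij by (auto simp: bij_betw_def)
  then obtain u where u: "u \<in> S" "\<rho> u = block_unit V i" by auto
  have "mul u y = y \<and> mul y u = y" if y: "y \<in> S" "\<rho> y \<in> direct_sum {i} (\<lambda>i. End_space sV (V i))" for y
  proof -
    have "\<rho> (mul u y) = \<rho> y" "\<rho> (mul y u) = \<rho> y"
      using mul u y(1) block_unit_comp[OF sV V[OF i] y(2)] by auto
    then show ?thesis using bij closed u y(1) by (auto simp: bij_betw_def inj_on_def)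
  qed
  then show ?thesis using that[of u] u unit by simp
qed

text \<open>The isomorphism \<open>\<Psi>\<close>, whose existence
  \<open>multiplicity_matrix\<close> asserts, becomes a parameter, since the parts of the bimodule
  belonging to one row or column are described through it.\<close>

locale semisimple_PM_structure = weak_PM_structure scale A B e form mulA mulB lact ract N
  for scale :: "complex \<Rightarrow> 'l::ab_group_add \<Rightarrow> 'l" and A B e form mulA mulB lact ract N +
  fixes sV :: "complex \<Rightarrow> 'v::ab_group_add \<Rightarrow> 'v" and sW :: "complex \<Rightarrow> 'w::ab_group_add \<Rightarrow> 'w"
    and V :: "nat \<Rightarrow> 'v set" and W :: "nat \<Rightarrow> 'w set"
    and r s :: nat and m n :: "nat \<Rightarrow> nat" and a :: "nat \<Rightarrow> nat \<Rightarrow> nat"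
    and \<rho>A \<rho>B \<Psi>
  assumes decA: "semisimple_decomposition scale A mulA sV r V m \<rho>A"
    and decB: "semisimple_decomposition scale B mulB sW s W n \<rho>B"
    and \<Psi>_iso: "linear_iso_on scale (fscale (fscale (*))) UNIV
            (direct_sum {(i, j, p). i \<in> {1..r} \<and> j \<in> {1..s} \<and> p \<in> {1..a i j}}
              (\<lambda>(i, j, p). tensor_product (fscale (*)) sW (dual_space sV (V i)) (W j))) \<Psi>"
    and \<Psi>_lact: "x \<in> B \<Longrightarrow> i \<in> {1..r} \<Longrightarrow> j \<in> {1..s} \<Longrightarrow> p \<in> {1..a i j} \<Longrightarrow>
         \<Psi> (lact x v) (i, j, p) =
         tensor_map (fscale (*)) sW (dual_space sV (V i)) (W j) id (\<rho>B x j) (\<Psi> v (i, j, p))"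
    and \<Psi>_ract: "x \<in> A \<Longrightarrow> i \<in> {1..r} \<Longrightarrow> j \<in> {1..s} \<Longrightarrow> p \<in> {1..a i j} \<Longrightarrow>
         \<Psi> (ract v x) (i, j, p) =
         tensor_map (fscale (*)) sW (dual_space sV (V i)) (W j) (\<lambda>\<xi>. \<xi> \<circ> \<rho>A x i) id (\<Psi> v (i, j, p))"
begin

text \<open>Rows and columns range over subsets, so that the whole bimodule, the part of one row and
  the part of one column are instances of a single dimension formula,
  \<open>has_dim_part\<close>.\<close>

definition copies :: "nat set \<Rightarrow> nat set \<Rightarrow> (nat \<times> nat \<times> nat) set"
  where "copies R C = {(i, j, p). i \<in> R \<and> j \<in> C \<and> p \<in> {1..a i j}}"

definition summand :: "nat \<times> nat \<times> nat \<Rightarrow> ((('v \<Rightarrow> complex) \<Rightarrow> 'w \<Rightarrow> complex) \<Rightarrow> complex) set"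
  where "summand = (\<lambda>(i, j, p). tensor_product (fscale (*)) sW (dual_space sV (V i)) (W j))"

lemma vs: "vector_space scale" "vector_space sV" "vector_space sW" "vector_space (fscale (*) :: complex \<Rightarrow> ('v \<Rightarrow> complex) \<Rightarrow> _)"
  using vector_space_axioms decA decB vector_space_fscale[OF vector_space_times]
  by (auto simp: semisimple_decomposition_def)

lemma \<Psi>_iso': "linear_iso_on scale (fscale (fscale (*))) UNIV (direct_sum (copies {1..r} {1..s}) summand) \<Psi>"
  using \<Psi>_iso unfolding copies_def summand_def .

lemma \<Psi>_inj: "\<Psi> v = \<Psi> v' \<longleftrightarrow> v = v'"
  and \<Psi>_range: "\<Psi> v \<in> direct_sum (copies {1..r} {1..s}) summand"
  using \<Psi>_iso' by (auto simp: linear_iso_on_def bij_betw_def inj_eq)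

lemma \<Psi>_mem: "i \<in> {1..r} \<Longrightarrow> j \<in> {1..s} \<Longrightarrow> p \<in> {1..a i j} \<Longrightarrow>
    \<Psi> v (i, j, p) \<in> tensor_product (fscale (*)) sW (dual_space sV (V i)) (W j)"
  and \<Psi>_zero: "(i, j, p) \<notin> copies {1..r} {1..s} \<Longrightarrow> \<Psi> v (i, j, p) = 0"
  using \<Psi>_range[of v] by (auto simp: direct_sum_def copies_def summand_def split: if_splits)

lemma has_dim_summand:
  "i \<in> {1..r} \<Longrightarrow> j \<in> {1..s} \<Longrightarrow> has_dim (fscale (*)) (summand (i, j, p)) (m i * n j)"
  unfolding summand_def prod.case
  by (intro has_dim_tensor has_dim_dual vs semisimple_decomposition_has_dim[OF decA]
      semisimple_decomposition_has_dim[OF decB])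

lemma dual_V: "i \<in> {1..r} \<Longrightarrow> module.subspace (fscale (*)) (dual_space sV (V i))"
  by (rule has_dim_subspace[OF has_dim_dual[OF vs(2) semisimple_decomposition_has_dim[OF decA]]])

lemma subspace_V: "i \<in> {1..r} \<Longrightarrow> module.subspace sV (V i)"
  by (rule has_dim_subspace[OF semisimple_decomposition_has_dim[OF decA]])

lemma subspace_W: "j \<in> {1..s} \<Longrightarrow> module.subspace sW (W j)"
  by (rule has_dim_subspace[OF semisimple_decomposition_has_dim[OF decB]])

lemma has_dim_part:
  assumes "R \<subseteq> {1..r}" "C \<subseteq> {1..s}"
  shows "has_dim scale {v. \<Psi> v \<in> direct_sum (copies R C) summand} (\<Sum>i\<in>R. \<Sum>j\<in>C. a i j * (m i * n j))"
proof -
  have fin: "finite R" "finite C" using assms finite_subset by auto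
  have copies: "copies R C = Sigma R (\<lambda>i. Sigma C (\<lambda>j. {1..a i j}))" by (auto simp: copies_def)
  have "has_dim (fscale (fscale (*))) (direct_sum (copies R C) summand) (\<Sum>(i, j, p)\<in>copies R C. m i * n j)"
  proof (rule has_dim_direct_sum)
    show "vector_space (fscale (*) :: complex \<Rightarrow> ((('v \<Rightarrow> complex) \<Rightarrow> 'w \<Rightarrow> complex) \<Rightarrow> complex) \<Rightarrow> _)"
      by (rule vector_space_fscale[OF vector_space_times])
    show "finite (copies R C)" unfolding copies using fin by auto
    show "has_dim (fscale (*)) (summand k) (case k of (i, j, p) \<Rightarrow> m i * n j)" if "k \<in> copies R C" for k
    proof -
      obtain i j p where k: "k = (i, j, p)" by (cases k)
      then have "i \<in> {1..r}" "j \<in> {1..s}" using that assms by (auto simp only: copies_def)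
      then show ?thesis unfolding k prod.case by (rule has_dim_summand)
    qed
  qed
  also have "(\<Sum>(i, j, p)\<in>copies R C. m i * n j) = (\<Sum>i\<in>R. \<Sum>j\<in>C. a i j * (m i * n j))"
  proof -
    have "(\<Sum>i\<in>R. \<Sum>j\<in>C. a i j * (m i * n j)) = (\<Sum>i\<in>R. \<Sum>j\<in>C. \<Sum>p\<in>{1..a i j}. m i * n j)" by simp
    also have "\<dots> = (\<Sum>i\<in>R. \<Sum>(j, p)\<in>Sigma C (\<lambda>j. {1..a i j}). m i * n j)"
      using fin by (intro sum.cong refl sum.Sigma) auto
    also have "\<dots> = (\<Sum>(i, j, p)\<in>copies R C. m i * n j)"
      unfolding copies using fin by (subst sum.Sigma) auto
    finally show ?thesis by simp
  qed
  finally have dim: "has_dim (fscale (fscale (*))) (direct_sum (copies R C) summand)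
      (\<Sum>i\<in>R. \<Sum>j\<in>C. a i j * (m i * n j))" .
  have sub: "direct_sum (copies R C) summand \<subseteq> direct_sum (copies {1..r} {1..s}) summand"
  proof (rule direct_sum_mono)
    show "copies R C \<subseteq> copies {1..r} {1..s}" using assms by (auto simp: copies_def)
    show "0 \<in> summand k" if "k \<in> copies {1..r} {1..s}" for k
    proof -
      obtain i j p where "k = (i, j, p)" by (cases k)
      then show ?thesis
        using that subspaceD(1)[OF vector_space_fscale[OF vector_space_times] has_dim_subspace[OF has_dim_summand[of i j p]]]
        by (auto simp: copies_def)
    qed
  qed
  show ?thesis
    using has_dim_preimage[OF vs(1) vector_space_fscale[OF vector_space_fscale[OF vector_space_times]]
        subspace_UNIV \<Psi>_iso' sub dim] by simp
qed

lemma subspace_A: "subspace A" and subspace_B: "subspace B"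
  using alg_A alg_B by (auto simp: unital_algebra_on_def)

lemma spanning_set_exists: "\<exists>T. finite T \<and> UNIV = span T"
  using fin_dim by (auto simp: fin_dim_subspace_def)

lemma form_linear:
  "form (x + y) z = form x z + form y z" "form x (y + z) = form x y + form x z"
  "form (scale c x) y = c * form x y" "form x (scale c y) = c * form x y"
  using form_bilinear by (auto simp: bilinear_on_def linear_on_def)

text \<open>\<open>X\<close> is \<open>\<L>u\<close> and \<open>Y\<close> is \<open>\<A>u\<close>
  for the unit \<open>u\<close> of block \<open>i\<close>. The common factor \<open>m i\<close> is
  kept because the right-hand sides then add up to the dimension of the bimodule;
  \<open>null_vector\<close> cancels it.\<close>

lemma row_le:
  assumes i: "i \<in> {1..r}"
  shows "2 * (m i * m i) \<le> (\<Sum>j\<in>{1..s}. a i j * (m i * n j))"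
proof -
  have closed: "mulA x y \<in> A" if "x \<in> A" "y \<in> A" for x y using alg_A that by (auto simp: unital_algebra_on_def)
  obtain u where u: "u \<in> A" "\<rho>A u = block_unit V i" "\<rho>A u \<in> direct_sum {i} (\<lambda>i. End_space sV (V i))"
    and unit: "\<And>y. y \<in> A \<Longrightarrow> \<rho>A y \<in> direct_sum {i} (\<lambda>i. End_space sV (V i)) \<Longrightarrow> mulA u y = y \<and> mulA y u = y"
    using central_idempotent_exists[OF decA i closed] by metis
  define X where "X = {v. \<Psi> v \<in> direct_sum (copies {i} {1..s}) summand}"
  define Y where "Y = {y \<in> A. \<rho>A y \<in> direct_sum {i} (\<lambda>i. End_space sV (V i))}"
  \<comment> \<open>The right action sees only the dual of \<open>V k\<close>, on which
    precomposition with the unit of block \<open>i\<close> is the identity for \<open>k = i\<close>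
    and zero otherwise.\<close>
  have act: "\<Psi> (ract v u) (k, j, p) = (if k = i then \<Psi> v (k, j, p) else 0)"
    if "k \<in> {1..r}" "j \<in> {1..s}" "p \<in> {1..a k j}" for v k j p
  proof (cases "k = i")
    case True
    have "\<xi> \<circ> \<rho>A u k = \<xi>" if "\<xi> \<in> dual_space sV (V k)" for \<xi>
      using that linear_on_0[OF vs(2) subspace_V[OF i], of "(*)" \<xi>] True
      by (auto simp: u block_unit_def dual_space_def fun_eq_iff)
    then have "tensor_map (fscale (*)) sW (dual_space sV (V k)) (W j) (\<lambda>\<xi>. \<xi> \<circ> \<rho>A u k) id (\<Psi> v (k, j, p)) =
        \<Psi> v (k, j, p)"
      by (intro tensor_map_identity[OF vs(4) dual_V[OF that(1)] vs(3) subspace_W[OF that(2)] \<Psi>_mem[OF that]]) auto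
    then show ?thesis unfolding \<Psi>_ract[OF u(1) that] using True by simp
  next
    case False
    have zero: "\<xi> \<circ> \<rho>A u k = 0" if "\<xi> \<in> dual_space sV (V k)" for \<xi>
      using that linear_on_0[OF vs(2) subspace_V[OF \<open>k \<in> {1..r}\<close>], of "(*)" \<xi>] False
      by (auto simp: u block_unit_def dual_space_def fun_eq_iff)
    have "0 \<in> dual_space sV (V k)" by (rule subspaceD(1)[OF vs(4) dual_V[OF that(1)]])
    then have "tensor_map (fscale (*)) sW (dual_space sV (V k)) (W j) (\<lambda>\<xi>. \<xi> \<circ> \<rho>A u k) id (\<Psi> v (k, j, p)) = 0"
      using zero by (intro tensor_map_zero[OF vs(4) dual_V[OF that(1)] vs(3) subspace_W[OF that(2)] \<Psi>_mem[OF that]]) auto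
    then show ?thesis unfolding \<Psi>_ract[OF u(1) that] using False by simp
  qed
  \<comment> \<open>The definition of \<open>X\<close> through \<open>\<Psi>\<close> yields its
    dimension; as the fixed space of \<open>u\<close> it is accessible to the identities of the
    form.\<close>
  have X: "v \<in> X \<longleftrightarrow> ract v u = v" for v
  proof -
    have "v \<in> X \<longleftrightarrow> (\<forall>k j p. (k, j, p) \<in> copies {1..r} {1..s} \<longrightarrow> k \<noteq> i \<longrightarrow> \<Psi> v (k, j, p) = 0)"
    proof
      assume "v \<in> X"
      then show "\<forall>k j p. (k, j, p) \<in> copies {1..r} {1..s} \<longrightarrow> k \<noteq> i \<longrightarrow> \<Psi> v (k, j, p) = 0"
        by (auto simp: X_def direct_sum_def copies_def)
    next
      assume *: "\<forall>k j p. (k, j, p) \<in> copies {1..r} {1..s} \<longrightarrow> k \<noteq> i \<longrightarrow> \<Psi> v (k, j, p) = 0"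
      show "v \<in> X"
        unfolding X_def direct_sum_def mem_Collect_eq
      proof
        fix x :: "nat \<times> nat \<times> nat"
        obtain k j p where x: "x = (k, j, p)" by (cases x)
        show "if x \<in> copies {i} {1..s} then \<Psi> v x \<in> summand x else \<Psi> v x = 0"
          using i * \<Psi>_mem[of k j p v] \<Psi>_zero[of k j p v] unfolding x by (auto simp: copies_def summand_def)
      qed
    qed
    also have "\<dots> \<longleftrightarrow> (\<forall>x. \<Psi> (ract v u) x = \<Psi> v x)"
    proof -
      have "\<Psi> (ract v u) (k, j, p) = \<Psi> v (k, j, p) \<longleftrightarrow>
          ((k, j, p) \<in> copies {1..r} {1..s} \<longrightarrow> k \<noteq> i \<longrightarrow> \<Psi> v (k, j, p) = 0)" for k j p
        using act[of k j p v] \<Psi>_zero[of k j p] by (cases "(k, j, p) \<in> copies {1..r} {1..s}") (auto simp: copies_def)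
      then show ?thesis by (simp add: split_paired_All)
    qed
    also have "\<dots> \<longleftrightarrow> ract v u = v" unfolding fun_eq_iff[symmetric] by (rule \<Psi>_inj)
    finally show ?thesis .
  qed
  have dimX: "has_dim scale X (\<Sum>j\<in>{1..s}. a i j * (m i * n j))"
    using has_dim_part[of "{i}" "{1..s}"] i by (simp add: X_def)
  have dimY: "has_dim scale Y (m i * m i)"
    using semisimple_decomposition_has_dim_part[OF decA vs(1) subspace_A, of "{i}"] i by (simp add: Y_def)
  obtain T where T: "finite T" "UNIV = span T" using spanning_set_exists by blast
  have "2 * dim Y \<le> dim X"
  proof (rule dim_isotropic_le[OF T form_linear])
    show "subspace X" "subspace Y" using has_dim_subspace dimX dimY by auto
    show "Y \<subseteq> X" using u(1) unit ract_A by (auto simp: X Y_def)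
    show "form x y = 0" if "x \<in> Y" "y \<in> Y" for x y using that form_A by (auto simp: Y_def)
    fix y assume y: "y \<in> Y" and orth: "\<And>x. x \<in> X \<Longrightarrow> form x y = 0"
    \<comment> \<open>An arbitrary \<open>v\<close> is replaced by \<open>vu\<close>, which lies in
      \<open>X\<close>: since \<open>y = uy\<close>, one has
      \<open>(v, y) = (v, uy) = (vu, y)\<close>.\<close>
    have "form y v = 0" for v
    proof -
      have "ract (ract v u) u = ract v u" using ract_mul[OF u(1) u(1)] unit[OF u(1,3)] by simp
      then have "form (ract v u) y = 0" using orth by (simp add: X)
      then have "form v (mulA u y) = 0" using form_ract[OF u(1)] y by (simp add: Y_def)
      then show ?thesis using unit[of y] y form_sym[of y v] by (simp add: Y_def)
    qed
    then show "y = 0" by (rule form_nondeg)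
  qed
  then show ?thesis using dimX dimY by (simp add: has_dim_def)
qed

text \<open>Mirror image of \<open>row_le\<close>. On this side the form moves the right factor of
  \<open>y\<close>, as in \<open>(yu, v) = (y, uv)\<close>, so \<open>y = yu\<close> takes the place
  of \<open>y = uy\<close>.\<close>

lemma col_le:
  assumes j: "j \<in> {1..s}"
  shows "2 * (n j * n j) \<le> (\<Sum>i\<in>{1..r}. a i j * (m i * n j))"
proof -
  have closed: "mulB x y \<in> B" if "x \<in> B" "y \<in> B" for x y using alg_B that by (auto simp: unital_algebra_on_def)
  obtain u where u: "u \<in> B" "\<rho>B u = block_unit W j" "\<rho>B u \<in> direct_sum {j} (\<lambda>j. End_space sW (W j))"
    and unit: "\<And>y. y \<in> B \<Longrightarrow> \<rho>B y \<in> direct_sum {j} (\<lambda>j. End_space sW (W j)) \<Longrightarrow> mulB u y = y \<and> mulB y u = y"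
    using central_idempotent_exists[OF decB j closed] by metis
  define X where "X = {v. \<Psi> v \<in> direct_sum (copies {1..r} {j}) summand}"
  define Y where "Y = {y \<in> B. \<rho>B y \<in> direct_sum {j} (\<lambda>j. End_space sW (W j))}"
  have act: "\<Psi> (lact u v) (i, k, p) = (if k = j then \<Psi> v (i, k, p) else 0)"
    if "i \<in> {1..r}" "k \<in> {1..s}" "p \<in> {1..a i k}" for v k i p
  proof (cases "k = j")
    case True
    have "\<rho>B u k w = w" if "w \<in> W k" for w
      using that True by (simp add: u block_unit_def)
    then have "tensor_map (fscale (*)) sW (dual_space sV (V i)) (W k) id (\<rho>B u k) (\<Psi> v (i, k, p)) = \<Psi> v (i, k, p)"
      by (intro tensor_map_identity[OF vs(4) dual_V[OF that(1)] vs(3) subspace_W[OF that(2)] \<Psi>_mem[OF that]]) auto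
    then show ?thesis unfolding \<Psi>_lact[OF u(1) that] using True by simp
  next
    case False
    have zero: "\<rho>B u k w = 0" for w
      using False by (simp add: u block_unit_def)
    have "0 \<in> W k" by (rule subspaceD(1)[OF vs(3) subspace_W[OF that(2)]])
    then have "tensor_map (fscale (*)) sW (dual_space sV (V i)) (W k) id (\<rho>B u k) (\<Psi> v (i, k, p)) = 0"
      using zero by (intro tensor_map_zero[OF vs(4) dual_V[OF that(1)] vs(3) subspace_W[OF that(2)] \<Psi>_mem[OF that]]) auto
    then show ?thesis unfolding \<Psi>_lact[OF u(1) that] using False by simp
  qed
  have X: "v \<in> X \<longleftrightarrow> lact u v = v" for v
  proof -
    have "v \<in> X \<longleftrightarrow> (\<forall>i k p. (i, k, p) \<in> copies {1..r} {1..s} \<longrightarrow> k \<noteq> j \<longrightarrow> \<Psi> v (i, k, p) = 0)"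
    proof
      assume "v \<in> X"
      then show "\<forall>i k p. (i, k, p) \<in> copies {1..r} {1..s} \<longrightarrow> k \<noteq> j \<longrightarrow> \<Psi> v (i, k, p) = 0"
        by (auto simp: X_def direct_sum_def copies_def)
    next
      assume *: "\<forall>i k p. (i, k, p) \<in> copies {1..r} {1..s} \<longrightarrow> k \<noteq> j \<longrightarrow> \<Psi> v (i, k, p) = 0"
      show "v \<in> X"
        unfolding X_def direct_sum_def mem_Collect_eq
      proof
        fix x :: "nat \<times> nat \<times> nat"
        obtain i k p where x: "x = (i, k, p)" by (cases x)
        show "if x \<in> copies {1..r} {j} then \<Psi> v x \<in> summand x else \<Psi> v x = 0"
          using j * \<Psi>_mem[of i k p v] \<Psi>_zero[of i k p v] unfolding x by (auto simp: copies_def summand_def)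
      qed
    qed
    also have "\<dots> \<longleftrightarrow> (\<forall>x. \<Psi> (lact u v) x = \<Psi> v x)"
    proof -
      have "\<Psi> (lact u v) (i, k, p) = \<Psi> v (i, k, p) \<longleftrightarrow>
          ((i, k, p) \<in> copies {1..r} {1..s} \<longrightarrow> k \<noteq> j \<longrightarrow> \<Psi> v (i, k, p) = 0)" for i k p
        using act[of i k p v] \<Psi>_zero[of i k p] by (cases "(i, k, p) \<in> copies {1..r} {1..s}") (auto simp: copies_def)
      then show ?thesis by (simp add: split_paired_All)
    qed
    also have "\<dots> \<longleftrightarrow> lact u v = v" unfolding fun_eq_iff[symmetric] by (rule \<Psi>_inj)
    finally show ?thesis .
  qed
  have dimX: "has_dim scale X (\<Sum>i\<in>{1..r}. a i j * (m i * n j))"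
    using has_dim_part[of "{1..r}" "{j}"] j by (simp add: X_def)
  have dimY: "has_dim scale Y (n j * n j)"
    using semisimple_decomposition_has_dim_part[OF decB vs(1) subspace_B, of "{j}"] j by (simp add: Y_def)
  obtain T where T: "finite T" "UNIV = span T" using spanning_set_exists by blast
  have "2 * dim Y \<le> dim X"
  proof (rule dim_isotropic_le[OF T form_linear])
    show "subspace X" "subspace Y" using has_dim_subspace dimX dimY by auto
    show "Y \<subseteq> X" using u(1) unit lact_B by (auto simp: X Y_def)
    show "form x y = 0" if "x \<in> Y" "y \<in> Y" for x y using that form_B by (auto simp: Y_def)
    fix y assume y: "y \<in> Y" and orth: "\<And>x. x \<in> X \<Longrightarrow> form x y = 0"
    have "form y v = 0" for v
    proof -
      have "lact u (lact u v) = lact u v" using lact_mul[OF u(1) u(1)] unit[OF u(1,3)] by simp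
      then have "form y (lact u v) = 0" using orth form_sym[of y "lact u v"] by (simp add: X)
      then have "form (mulB y u) v = 0" using form_lact[OF _ u(1)] y by (simp add: Y_def)
      then show ?thesis using unit[of y] y by (simp add: Y_def)
    qed
    then show "y = 0" by (rule form_nondeg)
  qed
  then show ?thesis using dimX dimY by (simp add: has_dim_def)
qed

lemma dim_A: "dim A = (\<Sum>i\<in>{1..r}. m i * m i)" and dim_B: "dim B = (\<Sum>j\<in>{1..s}. n j * n j)"
proof -
  have "{x \<in> A. \<rho>A x \<in> direct_sum {1..r} (\<lambda>i. End_space sV (V i))} = A"
    "{x \<in> B. \<rho>B x \<in> direct_sum {1..s} (\<lambda>j. End_space sW (W j))} = B"
    using decA decB by (auto simp: semisimple_decomposition_def algebra_iso_on_def linear_iso_on_def bij_betw_def)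
  then show "dim A = (\<Sum>i\<in>{1..r}. m i * m i)" "dim B = (\<Sum>j\<in>{1..s}. n j * n j)"
    using semisimple_decomposition_has_dim_part[OF decA vs(1) subspace_A order_refl]
      semisimple_decomposition_has_dim_part[OF decB vs(1) subspace_B order_refl]
    by (simp_all add: has_dim_def)
qed

text \<open>\<open>N\<close> is both the dimension of the intersection and the codimension of the
  sum, so it cancels in the dimension formula.\<close>

lemma total_le:
  "(\<Sum>i\<in>{1..r}. \<Sum>j\<in>{1..s}. a i j * (m i * n j)) \<le> (\<Sum>i\<in>{1..r}. m i * m i) + (\<Sum>j\<in>{1..s}. n j * n j)"
proof -
  have "dim (UNIV :: 'l set) = (\<Sum>i\<in>{1..r}. \<Sum>j\<in>{1..s}. a i j * (m i * n j))"
    using has_dim_part[OF order_refl order_refl] \<Psi>_range by (simp add: has_dim_def)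
  moreover obtain T where "finite T" "UNIV = span T" using spanning_set_exists by blast
  from dim_plus_inter_le[OF this subspace_A subspace_B]
  have "dim {x + y | x y. x \<in> A \<and> y \<in> B} + N \<le> dim A + dim B" unfolding dim_inter .
  ultimately show ?thesis using dim_quot dim_A dim_B by simp
qed

text \<open>The total \<open>?T\<close> is at least \<open>2 * dim A\<close> by rows, at least
  \<open>2 * dim B\<close> by columns, and at most \<open>dim A + dim B\<close>. So both lower
  bounds are attained, and then each inequality that was summed is an equality; positivity cancels
  the factors \<open>m i\<close> and \<open>n j\<close>.\<close>

lemma null_vector:
  shows "i \<in> {1..r} \<Longrightarrow> (\<Sum>j\<in>{1..s}. a i j * n j) = 2 * m i"
    and "j \<in> {1..s} \<Longrightarrow> (\<Sum>i\<in>{1..r}. a i j * m i) = 2 * n j"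
proof -
  let ?T = "\<Sum>i\<in>{1..r}. \<Sum>j\<in>{1..s}. a i j * (m i * n j)"
  have swap: "?T = (\<Sum>j\<in>{1..s}. \<Sum>i\<in>{1..r}. a i j * (m i * n j))" by (rule sum.swap)
  have rows: "(\<Sum>i\<in>{1..r}. 2 * (m i * m i)) \<le> ?T" by (intro sum_mono row_le)
  have cols: "(\<Sum>j\<in>{1..s}. 2 * (n j * n j)) \<le> ?T" unfolding swap by (intro sum_mono col_le)
  have "2 * ?T \<le> (\<Sum>i\<in>{1..r}. 2 * (m i * m i)) + (\<Sum>j\<in>{1..s}. 2 * (n j * n j))"
    using total_le by (simp add: sum_distrib_left[symmetric])
  then have eq: "(\<Sum>i\<in>{1..r}. 2 * (m i * m i)) = ?T" "(\<Sum>j\<in>{1..s}. 2 * (n j * n j)) = ?T"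
    using rows cols by linarith+
  show "(\<Sum>j\<in>{1..s}. a i j * n j) = 2 * m i" if i: "i \<in> {1..r}"
  proof -
    have "2 * (m i * m i) = (\<Sum>j\<in>{1..s}. a i j * (m i * n j))"
      using eq(1) row_le i by (rule sum_mono_inv) auto
    also have "\<dots> = m i * (\<Sum>j\<in>{1..s}. a i j * n j)" by (simp add: sum_distrib_left mult.left_commute)
    finally show ?thesis using semisimple_decomposition_dim_pos[OF decA i] by simp
  qed
  show "(\<Sum>i\<in>{1..r}. a i j * m i) = 2 * n j" if j: "j \<in> {1..s}"
  proof -
    have "2 * (n j * n j) = (\<Sum>i\<in>{1..r}. a i j * (m i * n j))"
      using eq(2)[unfolded swap] col_le j by (rule sum_mono_inv) auto
    also have "\<dots> = n j * (\<Sum>i\<in>{1..r}. a i j * m i)" by (simp add: sum_distrib_left mult_ac)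
    finally show ?thesis using semisimple_decomposition_dim_pos[OF decB j] by simp
  qed
qed

text \<open>By definition the empty matrix is indecomposable. It is excluded by
  \<open>N > 0\<close>: without rows \<open>A\<close> would be zero, and so would the
  intersection.\<close>

lemma r_pos: "r > 0"
proof (rule ccontr)
  assume "\<not> r > 0"
  moreover have "direct_sum {} (\<lambda>i. End_space sV (V i)) = {0}"
    by (auto simp: direct_sum_def fun_eq_iff)
  ultimately have "bij_betw \<rho>A A {0}"
    using decA by (auto simp: semisimple_decomposition_def algebra_iso_on_def linear_iso_on_def)
  then have "card A = 1" using bij_betw_same_card by fastforce
  then obtain x where "A = {x}" by (auto simp: card_1_singleton_iff)
  moreover have "0 \<in> A" using subspace_A by (rule subspace_0)
  ultimately have "A \<inter> B = span {}" using subspace_0[OF subspace_B] by auto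
  then have "dim (A \<inter> B) = 0" using dim_span_eq_card_independent[OF independent_empty] by (simp only: card.empty)
  then show False using dim_inter N_pos by simp
qed

end

section \<open>Graphs with a positive null vector\<close>

text \<open>\<open>d\<close> lies in the kernel of \<open>2 - w\<close>, the generalised Cartan
  matrix of the graph. Connectedness is stated as a closure principle because each case of the
  classification exhibits a set of vertices closed under neighbours and concludes that it is
  everything.\<close>

locale null_graph =
  fixes X :: "'x set" and w :: "'x \<Rightarrow> 'x \<Rightarrow> nat" and d :: "'x \<Rightarrow> nat"
  assumes finite_X: "finite X"
    and w_sym: "w x y = w y x"
    and w_irrefl: "w x x = 0"
    and d_pos: "x \<in> X \<Longrightarrow> d x > 0"
    and null: "x \<in> X \<Longrightarrow> (\<Sum>y\<in>X. w x y * d y) = 2 * d x"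
    and connected: "U \<subseteq> X \<Longrightarrow> U \<noteq> {} \<Longrightarrow> (\<And>x y. x \<in> U \<Longrightarrow> y \<in> X \<Longrightarrow> w x y > 0 \<Longrightarrow> y \<in> U) \<Longrightarrow> U = X"
begin

definition nb :: "'x \<Rightarrow> 'x set"
  where "nb x = {y \<in> X. w x y > 0}"

lemma finite_nb [simp]: "finite (nb x)"
  using finite_X by (simp add: nb_def)

lemma nb_sym: "x \<in> X \<Longrightarrow> y \<in> nb x \<Longrightarrow> x \<in> nb y"
  by (simp add: nb_def w_sym)

lemma nb_in_X: "y \<in> nb x \<Longrightarrow> y \<in> X"
  by (simp add: nb_def)

lemma nb_irrefl: "x \<notin> nb x"
  by (simp add: nb_def w_irrefl)

lemma closed_eq_X:
  assumes "U \<subseteq> X" "U \<noteq> {}" "\<And>x. x \<in> U \<Longrightarrow> nb x \<subseteq> U"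
  shows "U = X"
  using assms(3) by (intro connected assms(1,2)) (auto simp: nb_def)

lemma null_nb: "x \<in> X \<Longrightarrow> (\<Sum>y\<in>nb x. w x y * d y) = 2 * d x"
  unfolding null[symmetric] using finite_X by (intro sum.mono_neutral_left) (auto simp: nb_def)

lemma weighted_nb_le:
  assumes "x \<in> X" "y \<in> nb x"
  shows "w x y * d y \<le> 2 * d x"
proof -
  have "w x y * d y \<le> (\<Sum>y\<in>nb x. w x y * d y)"
    by (rule member_le_sum) (use assms in auto)
  then show ?thesis using null_nb[OF assms(1)] by simp
qed

text \<open>One neighbour already exhausts the sum \<open>2 * d x\<close>, and a second one would
  add a positive amount.\<close>

lemma nb_singleton:
  assumes "x \<in> X" "y \<in> nb x" "w x y * d y = 2 * d x"
  shows "nb x = {y}"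
proof (rule ccontr)
  assume "nb x \<noteq> {y}"
  then obtain z where z: "z \<in> nb x" "z \<noteq> y" using assms(2) by auto
  have "w x z * d z > 0" using z(1) d_pos by (simp add: nb_def)
  moreover have "(\<Sum>u\<in>{y, z}. w x u * d u) \<le> (\<Sum>u\<in>nb x. w x u * d u)"
    by (rule sum_mono2) (use assms z in auto)
  ultimately show False using null_nb[OF assms(1)] assms(3) z(2) by auto
qed

text \<open>Adding the bounds at both ends gives
  \<open>w x y * (d x + d y) \<le> 2 * (d x + d y)\<close>. Equality then holds at each end, which
  leaves no room for further neighbours.\<close>

lemma double_edge:
  assumes "x \<in> X" "y \<in> X" "w x y \<ge> 2"
  shows "nb x = {y} \<and> nb y = {x} \<and> w x y = 2 \<and> d x = d y"
proof -
  have y: "y \<in> nb x" and x: "x \<in> nb y" using assms by (auto simp: nb_def w_sym)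
  have 1: "w x y * d y \<le> 2 * d x" "w x y * d x \<le> 2 * d y"
    using weighted_nb_le[OF assms(1) y] weighted_nb_le[OF assms(2) x] by (auto simp: w_sym)
  have "w x y * (d x + d y) \<le> 2 * (d x + d y)" using 1 by (simp add: algebra_simps)
  moreover have "d x + d y > 0" using d_pos[OF assms(1)] by simp
  ultimately have "w x y \<le> 2" by (simp only: mult_le_cancel2)
  then have w: "w x y = 2" using assms(3) by simp
  then have "d x = d y" using 1 by simp
  with w y x assms show ?thesis
    using nb_singleton[of x y] nb_singleton[of y x] w_sym[of x y] by simp
qed

end

section \<open>Graphs without multiple edges\<close>

locale simple_null_graph = null_graph X w d
  for X :: "'x set" and w :: "'x \<Rightarrow> 'x \<Rightarrow> nat" and d :: "'x \<Rightarrow> nat" +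
  assumes simple: "x \<in> X \<Longrightarrow> y \<in> X \<Longrightarrow> w x y \<le> 1"
begin

lemma w_nb: "x \<in> X \<Longrightarrow> y \<in> X \<Longrightarrow> w x y = (if y \<in> nb x then 1 else 0)"
  using simple[of x y] by (auto simp: nb_def)

lemma sum_nb:
  assumes "x \<in> X"
  shows "(\<Sum>y\<in>nb x. d y) = 2 * d x"
proof -
  have "(\<Sum>y\<in>nb x. d y) = (\<Sum>y\<in>nb x. w x y * d y)"
    using assms w_nb nb_in_X by (intro sum.cong) auto
  then show ?thesis using null_nb[OF assms] by simp
qed

lemma half_le_nb:
  assumes "x \<in> X" "y \<in> nb x"
  shows "d x \<le> 2 * d y"
  using weighted_nb_le[of y x] nb_sym[OF assms] nb_in_X[OF assms(2)] w_nb[of y x] assms by auto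

lemma card_nb_half:
  assumes "x \<in> X" "R \<subseteq> nb x"
  shows "card R * d x \<le> 2 * (\<Sum>y\<in>R. d y)"
proof -
  have "card R * d x = (\<Sum>y\<in>R. d x)" by simp
  also have "\<dots> \<le> (\<Sum>y\<in>R. 2 * d y)" using half_le_nb assms by (intro sum_mono) auto
  finally show ?thesis by (simp add: sum_distrib_left)
qed

lemma nb_half:
  assumes "x \<in> X" "y \<in> nb x" "d x = 2 * d y"
  shows "nb y = {x}"
  using nb_sym[OF assms(1,2)] nb_in_X[OF assms(2)] w_nb[of y x] assms by (intro nb_singleton) auto

lemma sum_nb_diff:
  assumes "x \<in> X" "y \<in> nb x"
  shows "d x + (\<Sum>z\<in>nb y - {x}. d z) = 2 * d y"
  using sum_nb[of y] sum.remove[of "nb y" x d] nb_sym[OF assms] nb_in_X[OF assms(2)] by simp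

text \<open>The neighbours of \<open>y\<close> other than \<open>x\<close> sum to
  \<open>2 * d y - d x\<close>, which is less than \<open>d y\<close>, while each is at least half
  of \<open>d y\<close>; so there is at most one.\<close>

lemma descend:
  assumes x: "x \<in> X" and y: "y \<in> nb x" and less: "d y < d x"
  shows "nb y = {x} \<and> d x = 2 * d y \<or> (\<exists>z. nb y = {x, z} \<and> z \<noteq> x \<and> d x + d z = 2 * d y)"
proof -
  let ?R = "nb y - {x}"
  have eq: "d x + (\<Sum>z\<in>?R. d z) = 2 * d y" using sum_nb_diff[OF x y] .
  have yX: "y \<in> X" and xy: "x \<in> nb y" using nb_in_X[OF y] nb_sym[OF x y] by auto
  have "card ?R * d y \<le> 2 * (\<Sum>z\<in>?R. d z)" by (rule card_nb_half[OF yX]) auto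
  also have "\<dots> < 2 * d y" using eq less by simp
  finally have "card ?R < 2" by simp
  then consider "card ?R = 0" | "card ?R = 1" by linarith
  then show ?thesis
  proof cases
    case 1
    then have "?R = {}" by simp
    then have "nb y = {x}" using xy by blast
    then show ?thesis using eq by simp
  next
    case 2
    then obtain z where z: "?R = {z}" by (auto simp: card_1_singleton_iff)
    then have "nb y = {x, z}" "z \<noteq> x" using xy by auto
    moreover have "d x + d z = 2 * d y" using eq unfolding z by simp
    ultimately show ?thesis by blast
  qed
qed

text \<open>The neighbours of \<open>y\<close> other than \<open>x\<close> sum to \<open>d y\<close>
  and each is at least half of that. So there is one of the same value, or there are two of exactly
  half, and the latter are leaves by \<open>nb_half\<close>.\<close>

lemma level:
  assumes x: "x \<in> X" and y: "y \<in> nb x" and eq: "d y = d x"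
  shows "(\<exists>z. nb y = {x, z} \<and> z \<noteq> x \<and> d z = d x) \<or>
    (\<exists>p q. nb y = {x, p, q} \<and> p \<noteq> q \<and> p \<noteq> x \<and> q \<noteq> x \<and> 2 * d p = d x \<and> 2 * d q = d x \<and>
       nb p = {y} \<and> nb q = {y})"
proof -
  let ?R = "nb y - {x}"
  have yX: "y \<in> X" and xy: "x \<in> nb y" using nb_in_X[OF y] nb_sym[OF x y] by auto
  have R: "(\<Sum>z\<in>?R. d z) = d x" using sum_nb_diff[OF x y] eq by simp
  have "card ?R * d y \<le> 2 * (\<Sum>z\<in>?R. d z)" by (rule card_nb_half[OF yX]) auto
  then have "card ?R \<le> 2" using R eq d_pos[OF x] by simp
  moreover have "?R \<noteq> {}"
  proof
    assume "?R = {}"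
    with R have "d x = 0" by (metis sum.empty)
    with d_pos[OF x] show False by simp
  qed
  then have "card ?R \<noteq> 0" by (subst card_0_eq) auto
  ultimately consider "card ?R = 1" | "card ?R = 2" by linarith
  then show ?thesis
  proof cases
    case 1
    then obtain z where z: "?R = {z}" by (auto simp: card_1_singleton_iff)
    then have "nb y = {x, z}" "z \<noteq> x" using xy by auto
    moreover have "d z = d x" using R unfolding z by simp
    ultimately show ?thesis by blast
  next
    case 2
    then obtain p q where pq: "?R = {p, q}" "p \<noteq> q" by (auto simp: card_2_iff)
    then have nb: "nb y = {x, p, q}" "p \<noteq> x" "q \<noteq> x" using xy by auto
    have "d y \<le> 2 * d p" "d y \<le> 2 * d q" using half_le_nb[OF yX] nb by auto
    moreover have "d p + d q = d x" using R pq(2) unfolding pq(1) by simp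
    ultimately have "2 * d p = d x" "2 * d q = d x" using eq by auto
    moreover from this have "nb p = {y}" "nb q = {y}" using nb_half[OF yX] eq nb by auto
    ultimately show ?thesis using nb pq by blast
  qed
qed

text \<open>The list omits the starting vertex \<open>x\<close>. The clause for the leaf says that
  the arithmetic progression would reach 0 one step beyond it.\<close>

fun arm :: "'x \<Rightarrow> 'x list \<Rightarrow> bool" where
  "arm x [] \<longleftrightarrow> False"
| "arm x [y] \<longleftrightarrow> nb y = {x} \<and> d x = 2 * d y"
| "arm x (y # z # zs) \<longleftrightarrow> nb y = {x, z} \<and> z \<noteq> x \<and> d x + d z = 2 * d y \<and> arm y (z # zs)"

lemma arm_exists:
  assumes "x \<in> X" "y \<in> nb x" "d y < d x"
  shows "\<exists>ys. arm x (y # ys)"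
  using assms
proof (induction "d y" arbitrary: x y rule: less_induct)
  case less
  from descend[OF less.prems] show ?case
  proof
    assume "nb y = {x} \<and> d x = 2 * d y"
    then have "arm x [y]" by simp
    then show ?thesis by blast
  next
    assume "\<exists>z. nb y = {x, z} \<and> z \<noteq> x \<and> d x + d z = 2 * d y"
    then obtain z where z: "nb y = {x, z}" "z \<noteq> x" "d x + d z = 2 * d y" by blast
    then have "d z < d y" using less.prems by simp
    then obtain zs where "arm y (z # zs)"
      using less.hyps[of z y] z less.prems nb_in_X by auto
    then have "arm x (y # z # zs)" using z by simp
    then show ?thesis by blast
  qed
qed

text \<open>\<open>c\<close> is the value at the leaf and also the common difference; counted from
  the leaf, \<open>x\<close> is vertex number \<open>length ys + 2\<close>.\<close>

lemma arm_d:
  "arm x (y # ys) \<Longrightarrow> \<exists>c. d x = (length ys + 2) * c \<and> d y = (length ys + 1) * c"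
proof (induction ys arbitrary: x y)
  case (Cons z zs)
  have "arm y (z # zs)" using Cons.prems by simp
  from Cons.IH[OF this] obtain c where "d y = (length zs + 2) * c" "d z = (length zs + 1) * c" by blast
  moreover have "d x + d z = 2 * d y" using Cons.prems by simp
  ultimately show ?case by (intro exI[of _ c]) (simp add: algebra_simps)
qed auto

text \<open>The neighbours sum to \<open>2 * d x\<close>. Each is at least half of
  \<open>d x\<close>, so there are at most four; each is smaller than \<open>d x\<close>, so there
  are more than two.\<close>

lemma top_nbs:
  assumes x: "x \<in> X" and less: "\<And>y. y \<in> nb x \<Longrightarrow> d y < d x"
  shows "card (nb x) = 3 \<or> card (nb x) = 4 \<and> (\<forall>y\<in>nb x. d x = 2 * d y)"
proof -
  have "card (nb x) * d x \<le> 2 * (2 * d x)" using card_nb_half[OF x order_refl] sum_nb[OF x] by simp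
  then have c4: "card (nb x) \<le> 4" using d_pos[OF x] by simp
  have ne: "nb x \<noteq> {}" using sum_nb[OF x] d_pos[OF x] by auto
  have "2 * d x < (\<Sum>y\<in>nb x. d x)"
    unfolding sum_nb[OF x, symmetric] by (rule sum_strict_mono) (use ne less in auto)
  then have "2 < card (nb x)" by simp
  moreover have "\<forall>y\<in>nb x. d x = 2 * d y" if "card (nb x) = 4"
  proof
    fix y assume y: "y \<in> nb x"
    \<comment> \<open>The other three take at least three halves of \<open>d x\<close> from the sum,
      which leaves at most one half for \<open>y\<close>.\<close>
    have "card (nb x - {y}) = 3" using that y by simp
    then have "3 * d x \<le> 2 * (\<Sum>z\<in>nb x - {y}. d z)" using card_nb_half[OF x, of "nb x - {y}"] by auto
    moreover have "d y + (\<Sum>z\<in>nb x - {y}. d z) = 2 * d x"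
      using sum_nb[OF x] sum.remove[of "nb x" y d] y by simp
    ultimately show "d x = 2 * d y" using half_le_nb[OF x y] by simp
  qed
  ultimately show ?thesis using c4 by linarith
qed

text \<open>Interior vertices have no neighbours besides the adjacent ones on the path, while the
  further neighbours of the two ends are left open. The condition on \<open>vs ! 1\<close> covers
  length 2, where the clause for interior vertices is void.\<close>

definition level_path :: "'x \<Rightarrow> 'x list \<Rightarrow> bool"
  where "level_path x vs \<longleftrightarrow> distinct vs \<and> length vs \<ge> 2 \<and> vs ! 0 = x \<and> vs ! 1 \<in> nb x \<and>
    (\<forall>v\<in>set vs. v \<in> X \<and> d v = d x) \<and>
    (\<forall>i. 0 < i \<and> Suc i < length vs \<longrightarrow> nb (vs ! i) = {vs ! (i - 1), vs ! Suc i})"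

text \<open>A longest such path is taken; distinctness bounds its length. By \<open>level\<close>,
  applied to its last edge, either two leaves hang at the end or there is a next vertex of the same
  value. By maximality this vertex is on the path, and it can only be \<open>x\<close>, because the
  neighbours of interior vertices are already accounted for.\<close>

lemma level_path_exists:
  assumes x: "x \<in> X" and y: "y \<in> nb x" and eq: "d y = d x"
  obtains vs where "level_path x vs"
    and "(\<exists>p q. nb (last vs) = {vs ! (length vs - 2), p, q} \<and> p \<noteq> q \<and> 2 * d p = d x \<and> 2 * d q = d x \<and>
           nb p = {last vs} \<and> nb q = {last vs}) \<or>
         length vs \<ge> 3 \<and> nb (last vs) = {vs ! (length vs - 2), x}"
proof -
  have "\<exists>vs. level_path x vs \<and> (\<forall>us. level_path x us \<longrightarrow> length us \<le> length vs)"
  proof (rule ex_has_greatest_nat)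
    show "level_path x [x, y]"
      using x y eq nb_in_X[OF y] nb_irrefl[of x] by (auto simp: level_path_def)
    show "\<forall>vs. level_path x vs \<longrightarrow> length vs < Suc (card X)"
    proof (intro allI impI)
      fix vs assume "level_path x vs"
      then have "distinct vs" "set vs \<subseteq> X" by (auto simp: level_path_def)
      then show "length vs < Suc (card X)"
        using card_mono[OF finite_X, of "set vs"] distinct_card[of vs] by simp
    qed
  qed
  then obtain vs where vs: "level_path x vs"
    and max: "\<And>us. level_path x us \<Longrightarrow> length us \<le> length vs" by blast
  define k where "k = length vs - 2"
  have len: "length vs = Suc (Suc k)" using vs unfolding k_def level_path_def by linarith
  then have last: "last vs = vs ! Suc k" by (subst last_conv_nth) auto
  have inner: "nb (vs ! i) = {vs ! (i - 1), vs ! Suc i}" if "0 < i" "i \<le> k" for i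
    using vs that len by (auto simp: level_path_def)
  have dist: "distinct vs" and vsX: "\<And>i. i \<le> Suc k \<Longrightarrow> vs ! i \<in> X \<and> d (vs ! i) = d x"
    and vs0: "vs ! 0 = x" and vs1: "vs ! 1 \<in> nb x"
    using vs len by (auto simp: level_path_def)
  have inj: "i \<le> Suc k \<Longrightarrow> j \<le> Suc k \<Longrightarrow> vs ! i = vs ! j \<longleftrightarrow> i = j" for i j
    using dist len by (simp add: nth_eq_iff_index_eq)
  have step: "vs ! Suc k \<in> nb (vs ! k)"
  proof (cases "k = 0")
    case True
    then show ?thesis using vs0 vs1 by simp
  next
    case False
    then show ?thesis using inner[of k] by simp
  qed
  from level[OF conjunct1[OF vsX] step] vsX[of k] vsX[of "Suc k"]
  consider z where "nb (vs ! Suc k) = {vs ! k, z}" "z \<noteq> vs ! k" "d z = d x"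
    | p q where "nb (vs ! Suc k) = {vs ! k, p, q}" "p \<noteq> q" "2 * d p = d x" "2 * d q = d x"
      "nb p = {vs ! Suc k}" "nb q = {vs ! Suc k}"
    by force
  then show ?thesis
  proof cases
    case 1
    have zX: "z \<in> X" using 1 nb_in_X[of z "vs ! Suc k"] by auto
    have kz: "vs ! Suc k \<in> nb z" using 1 nb_sym[of "vs ! Suc k" z] vsX[of "Suc k"] by auto
    have "z = x"
    proof (rule ccontr)
      assume zx: "z \<noteq> x"
      have "z \<notin> set vs"
      proof
        assume "z \<in> set vs"
        then obtain i where i: "i \<le> Suc k" "z = vs ! i" by (auto simp: in_set_conv_nth len less_Suc_eq_le)
        then consider "i = 0" | "i = Suc k" | "i = k" | "0 < i" "i < k" by linarith
        then show False
        proof cases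
          case 1 then show ?thesis using i zx vs0 by simp
        next
          case 2 then show ?thesis using kz i nb_irrefl by auto
        next
          case 3 then show ?thesis using i 1 by simp
        next
          case 4
          then have "vs ! Suc k \<noteq> vs ! (i - 1)" "vs ! Suc k \<noteq> vs ! Suc i" by (subst inj; simp)+
          then show ?thesis using inner[of i] kz i 4 by auto
        qed
      qed
      moreover have "nb ((vs @ [z]) ! i) = {(vs @ [z]) ! (i - 1), (vs @ [z]) ! Suc i}"
        if "0 < i" "Suc i < length (vs @ [z])" for i
      proof (cases "i = Suc k")
        case True
        then show ?thesis using 1 len by (simp add: nth_append)
      next
        case False
        then show ?thesis using that inner[of i] len by (simp add: nth_append less_imp_diff_less)
      qed
      ultimately have "level_path x (vs @ [z])"
        using vs zX 1 len unfolding level_path_def by (auto simp: nth_append)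
      from max[OF this] show False by simp
    qed
    \<comment> \<open>For \<open>k = 0\<close> the vertex \<open>x\<close> would be
      \<open>vs ! k\<close>, from which \<open>z\<close> is distinct; so a closing path has at least
      three vertices.\<close>
    moreover from this have "k \<noteq> 0" using 1 vs0 by (intro notI) auto
    ultimately show ?thesis using that[OF vs] 1 last len by auto
  next
    case 2
    then show ?thesis using that[OF vs] last len by auto
  qed
qed

end

section \<open>Classification of the bipartite graphs\<close>

text \<open>The conclusion of the theorem as a predicate symmetric in rows and columns, which makes
  \<open>classified_transpose\<close> immediate.\<close>

definition classified :: "nat \<Rightarrow> nat \<Rightarrow> (nat \<Rightarrow> nat \<Rightarrow> nat) \<Rightarrow> (nat \<Rightarrow> nat) \<Rightarrow> (nat \<Rightarrow> nat) \<Rightarrow> bool"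
  where "classified r s a m n \<longleftrightarrow> (\<exists>\<sigma> \<tau>. \<sigma> permutes {1..r} \<and> \<tau> permutes {1..s} \<and>
    (affine_list r s (\<lambda>i j. a (\<sigma> i) (\<tau> j)) (m \<circ> \<sigma>) (n \<circ> \<tau>) \<or>
     affine_list s r (\<lambda>j i. a (\<sigma> i) (\<tau> j)) (n \<circ> \<tau>) (m \<circ> \<sigma>)))"

lemma classified_transpose: "classified s r (\<lambda>j i. a i j) n m \<Longrightarrow> classified r s a m n"
  unfolding classified_def by blast

lemma permutes_of_bij_betw:
  fixes f :: "nat \<Rightarrow> nat"
  assumes "bij_betw f {1..r'} {1..r}"
  obtains \<sigma> where "r' = r" "\<sigma> permutes {1..r}" "\<And>i. i \<in> {1..r} \<Longrightarrow> \<sigma> i = f i"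
proof -
  have r: "r' = r" using bij_betw_same_card[OF assms] by simp
  define \<sigma> where "\<sigma> i = (if i \<in> {1..r} then f i else i)" for i
  have "bij_betw \<sigma> {1..r} {1..r}"
    using assms r by (subst bij_betw_cong[of _ \<sigma> f]) (auto simp: \<sigma>_def)
  then have "\<sigma> permutes {1..r}" by (rule bij_imp_permutes) (auto simp: \<sigma>_def)
  then show ?thesis using that[of \<sigma>] r by (simp add: \<sigma>_def)
qed

text \<open>The graph yields numberings \<open>f\<close> and \<open>g\<close> by the index ranges of
  a table. Cardinalities identify these ranges with those of the matrix, and extension by the
  identity gives permutations, of which \<open>aff\<close> knows only the values inside the
  ranges.\<close>

lemma classifiedI:
  assumes f: "bij_betw f {1..r'} {1..r}" and g: "bij_betw g {1..s'} {1..s}"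
    and aff: "\<And>\<sigma> \<tau>. (\<And>i. i \<in> {1..r} \<Longrightarrow> \<sigma> i = f i) \<Longrightarrow> (\<And>j. j \<in> {1..s} \<Longrightarrow> \<tau> j = g j) \<Longrightarrow> r' = r \<Longrightarrow> s' = s \<Longrightarrow>
      affine_list r s (\<lambda>i j. a (\<sigma> i) (\<tau> j)) (m \<circ> \<sigma>) (n \<circ> \<tau>) \<or>
      affine_list s r (\<lambda>j i. a (\<sigma> i) (\<tau> j)) (n \<circ> \<tau>) (m \<circ> \<sigma>)"
  shows "classified r s a m n"
proof -
  obtain \<sigma> where \<sigma>: "r' = r" "\<sigma> permutes {1..r}" "\<And>i. i \<in> {1..r} \<Longrightarrow> \<sigma> i = f i"
    using permutes_of_bij_betw[OF f] by blast
  obtain \<tau> where \<tau>: "s' = s" "\<tau> permutes {1..s}" "\<And>i. i \<in> {1..s} \<Longrightarrow> \<tau> i = g i"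
    using permutes_of_bij_betw[OF g] by blast
  show ?thesis unfolding classified_def using \<sigma>(2) \<tau>(2) aff[OF \<sigma>(3) \<tau>(3) \<sigma>(1) \<tau>(1)] by blast
qed

lemma matrix_is_permuted:
  "matrix_is r s (\<lambda>i j. a (\<sigma> i) (\<tau> j)) rows \<longleftrightarrow>
    map (\<lambda>i. map (a i) (map \<tau> [1..<Suc s])) (map \<sigma> [1..<Suc r]) = rows"
  by (simp add: matrix_is_def o_def del: upt_Suc)

lemma matrix_is_permuted_transpose:
  "matrix_is s r (\<lambda>j i. a (\<sigma> i) (\<tau> j)) rows \<longleftrightarrow>
    map (\<lambda>j. map (\<lambda>i. a i j) (map \<sigma> [1..<Suc r])) (map \<tau> [1..<Suc s]) = rows"
  by (simp add: matrix_is_def o_def del: upt_Suc)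

lemma vector_is_permuted: "vector_is r (m \<circ> \<sigma>) xs \<longleftrightarrow> map m (map \<sigma> [1..<Suc r]) = xs"
  by (simp add: vector_is_def del: upt_Suc)

lemma bij_betw_nth_Suc:
  assumes "distinct xs"
  shows "bij_betw (\<lambda>i. xs ! (i - 1)) {1..length xs} (set xs)"
proof -
  have "bij_betw (\<lambda>i. i - 1) {1..length xs} {..<length xs}"
    by (rule bij_betw_byWitness[of _ Suc]) auto
  from bij_betw_trans[OF this bij_betw_nth[OF assms refl refl]] show ?thesis by (simp add: o_def)
qed

text \<open>Variant for tables of fixed size: \<open>fs\<close> and \<open>gs\<close> list the row
  and column indices in the order of the table, so that with \<open>matrix_is_permuted\<close> the
  comparison is an evaluation on explicit lists.\<close>

lemma classified_listsI:
  assumes fs: "distinct fs" "set fs = {1..r}" and gs: "distinct gs" "set gs = {1..s}"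
    and aff: "\<And>\<sigma> \<tau>. map \<sigma> [1..<Suc r] = fs \<Longrightarrow> map \<tau> [1..<Suc s] = gs \<Longrightarrow>
      r = length fs \<Longrightarrow> s = length gs \<Longrightarrow>
      affine_list r s (\<lambda>i j. a (\<sigma> i) (\<tau> j)) (m \<circ> \<sigma>) (n \<circ> \<tau>) \<or>
      affine_list s r (\<lambda>j i. a (\<sigma> i) (\<tau> j)) (n \<circ> \<tau>) (m \<circ> \<sigma>)"
  shows "classified r s a m n"
proof -
  have l: "map \<rho> [1..<Suc k] = xs" if "\<And>i. i \<in> {1..k} \<Longrightarrow> \<rho> i = xs ! (i - 1)" "length xs = k"
    for \<rho> :: "nat \<Rightarrow> nat" and k xs
    using that by (intro nth_equalityI) (auto simp del: upt_Suc)
  have f: "bij_betw (\<lambda>i. fs ! (i - 1)) {1..length fs} {1..r}"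
    and g: "bij_betw (\<lambda>i. gs ! (i - 1)) {1..length gs} {1..s}"
    using bij_betw_nth_Suc[OF fs(1)] bij_betw_nth_Suc[OF gs(1)] fs(2) gs(2) by auto
  show ?thesis
    by (rule classifiedI[OF f g], rule aff, (rule l, blast, simp)+, simp_all)
qed

section \<open>The bipartite graph of a matrix\<close>

fun edge_weight :: "('i \<Rightarrow> 'j \<Rightarrow> nat) \<Rightarrow> 'i + 'j \<Rightarrow> 'i + 'j \<Rightarrow> nat" where
  "edge_weight a (Inl i) (Inr j) = a i j"
| "edge_weight a (Inr j) (Inl i) = a i j"
| "edge_weight a _ _ = 0"

lemma edge_weight_sym: "edge_weight a x y = edge_weight a y x"
  by (cases x; cases y) auto

lemma decomposable_transpose:
  assumes "decomposable s r (\<lambda>j i. a i j)"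
  shows "decomposable r s a"
proof -
  from assms obtain J J' I I' where "J \<union> J' = {1..s} \<and> J \<inter> J' = {} \<and> I \<union> I' = {1..r} \<and> I \<inter> I' = {} \<and>
      (J \<noteq> {} \<or> I \<noteq> {}) \<and> (J' \<noteq> {} \<or> I' \<noteq> {}) \<and>
      (\<forall>j\<in>J. \<forall>i\<in>I'. a i j = 0) \<and> (\<forall>j\<in>J'. \<forall>i\<in>I. a i j = 0)"
    unfolding decomposable_def by (elim exE) (rule that)
  note * = this
  show ?thesis
    unfolding decomposable_def
    by (rule exI[of _ I], rule exI[of _ I'], rule exI[of _ J], rule exI[of _ J'])
      (insert *, elim conjE, intro conjI, simp_all, blast+)
qed

locale affine_bipartite =
  fixes r s :: nat and a :: "nat \<Rightarrow> nat \<Rightarrow> nat" and m n :: "nat \<Rightarrow> nat"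
  assumes m_pos: "i \<in> {1..r} \<Longrightarrow> m i > 0"
    and n_pos: "j \<in> {1..s} \<Longrightarrow> n j > 0"
    and row_null: "i \<in> {1..r} \<Longrightarrow> (\<Sum>j\<in>{1..s}. a i j * n j) = 2 * m i"
    and col_null: "j \<in> {1..s} \<Longrightarrow> (\<Sum>i\<in>{1..r}. a i j * m i) = 2 * n j"
    and indecomposable: "\<not> decomposable r s a"
    and nonempty: "r > 0"
begin

definition verts :: "(nat + nat) set"
  where "verts = {1..r} <+> {1..s}"

lemma in_verts [simp]: "Inl i \<in> verts \<longleftrightarrow> i \<in> {1..r}" "Inr j \<in> verts \<longleftrightarrow> j \<in> {1..s}"
  by (auto simp: verts_def)

text \<open>Connectedness is indecomposability read in the graph: a nonempty closed set of vertices
  has no edge to its complement, so a proper one would split rows and columns into a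
  decomposition.\<close>

sublocale null_graph verts "edge_weight a" "case_sum m n"
proof
  show "edge_weight a x y = edge_weight a y x" for x y by (rule edge_weight_sym)
  show "edge_weight a x x = 0" for x by (cases x) auto
  show "case_sum m n x > 0" if "x \<in> verts" for x using that m_pos n_pos by (cases x) auto
  show "(\<Sum>y\<in>verts. edge_weight a x y * case_sum m n y) = 2 * case_sum m n x"
    if "x \<in> verts" for x
    using that row_null col_null by (cases x) (auto simp: verts_def sum.Plus o_def)
next
  fix U :: "(nat + nat) set"
  assume U: "U \<subseteq> verts" "U \<noteq> {}"
    and closed: "\<And>x y. x \<in> U \<Longrightarrow> y \<in> verts \<Longrightarrow> edge_weight a x y > 0 \<Longrightarrow> y \<in> U"
  show "U = verts"
  proof (rule ccontr)
    assume ne: "U \<noteq> verts"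
    define I J where "I = {i. Inl i \<in> U}" and "J = {j. Inr j \<in> U}"
    have IJ: "I \<subseteq> {1..r}" "J \<subseteq> {1..s}" using U by (auto simp: I_def J_def verts_def)
    have U_eq: "U = I <+> J"
    proof (rule set_eqI)
      show "x \<in> U \<longleftrightarrow> x \<in> I <+> J" for x using U by (cases x) (auto simp: I_def J_def)
    qed
    have "decomposable r s a"
      unfolding decomposable_def
    proof (rule exI[of _ I], rule exI[of _ "{1..r} - I"], rule exI[of _ J], rule exI[of _ "{1..s} - J"],
        intro conjI)
      show "\<forall>i\<in>I. \<forall>j\<in>{1..s} - J. a i j = 0"
      proof (intro ballI)
        fix i j assume "i \<in> I" "j \<in> {1..s} - J"
        then show "a i j = 0" using closed[of "Inl i" "Inr j"] by (auto simp: I_def J_def)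
      qed
      show "\<forall>i\<in>{1..r} - I. \<forall>j\<in>J. a i j = 0"
      proof (intro ballI)
        fix i j assume "i \<in> {1..r} - I" "j \<in> J"
        then show "a i j = 0" using closed[of "Inr j" "Inl i"] by (auto simp: I_def J_def)
      qed
    qed (use IJ U ne U_eq in \<open>auto simp: verts_def\<close>)
    then show False using indecomposable by simp
  qed
qed (simp add: verts_def)

lemma transpose: "s > 0 \<Longrightarrow> affine_bipartite s r (\<lambda>j i. a i j) n m"
proof
  show "\<not> decomposable s r (\<lambda>j i. a i j)"
    using indecomposable decomposable_transpose by blast
qed (simp_all add: m_pos n_pos row_null[simplified] col_null[simplified])

lemma nb_InlD: "y \<in> nb (Inl i) \<Longrightarrow> \<exists>j. y = Inr j \<and> j \<in> {1..s}"
  by (cases y) (auto simp: nb_def)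

lemma nb_InrD: "y \<in> nb (Inr j) \<Longrightarrow> \<exists>i. y = Inl i \<and> i \<in> {1..r}"
  by (cases y) (auto simp: nb_def)

lemma s_pos: "s > 0"
proof (rule ccontr)
  assume "\<not> s > 0"
  then have "2 * m 1 = 0" using row_null[of 1] nonempty by simp
  then show False using m_pos[of 1] nonempty by simp
qed

lemma rows_cols:
  assumes "Inl ` R \<union> Inr ` C = verts"
  shows "{1..r} = R" "{1..s} = C"
proof -
  have "x \<in> {1..r} \<longleftrightarrow> x \<in> R" "x \<in> {1..s} \<longleftrightarrow> x \<in> C" for x
    unfolding in_verts[symmetric] assms[symmetric] by auto
  then show "{1..r} = R" "{1..s} = C" by blast+
qed

lemma classified_double:
  assumes "i \<in> {1..r}" "j \<in> {1..s}" "a i j \<ge> 2"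
  shows "classified r s a m n"
proof -
  have nb: "nb (Inl i) = {Inr j}" "nb (Inr j) = {Inl i}" and a: "a i j = 2" "m i = n j"
    using double_edge[of "Inl i" "Inr j"] assms by auto
  have "Inl ` {i} \<union> Inr ` {j} = verts"
    by (rule closed_eq_X) (use assms nb in auto)
  note R = rows_cols[OF this]
  show ?thesis
  proof (rule classified_listsI[of "[i]" _ "[j]"])
    fix \<sigma> \<tau> assume *: "map \<sigma> [1..<Suc r] = [i]" "map \<tau> [1..<Suc s] = [j]" "r = length [i]" "s = length [j]"
    have "type_A1 r s (\<lambda>i j. a (\<sigma> i) (\<tau> j)) (m \<circ> \<sigma>) (n \<circ> \<tau>) (m i)"
      using * a by (simp add: type_A1_def)
    moreover have "m i > 0" using m_pos assms(1) by blast
    ultimately show "affine_list r s (\<lambda>i j. a (\<sigma> i) (\<tau> j)) (m \<circ> \<sigma>) (n \<circ> \<tau>) \<or>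
      affine_list s r (\<lambda>j i. a (\<sigma> i) (\<tau> j)) (n \<circ> \<tau>) (m \<circ> \<sigma>)"
      unfolding affine_list_def by blast
  qed (use R in auto)
qed

end

locale simple_affine_bipartite = affine_bipartite +
  assumes a_le_1: "i \<in> {1..r} \<Longrightarrow> j \<in> {1..s} \<Longrightarrow> a i j \<le> 1"
begin

sublocale simple_null_graph verts "edge_weight a" "case_sum m n"
proof
  fix x y assume "x \<in> verts" "y \<in> verts"
  then show "edge_weight a x y \<le> 1"
    by (cases x; cases y) (auto simp: a_le_1 simp del: One_nat_def)
qed

lemma a_eq: "i \<in> {1..r} \<Longrightarrow> j \<in> {1..s} \<Longrightarrow> a i j = (if Inr j \<in> nb (Inl i) then 1 else 0)"
  using w_nb[of "Inl i" "Inr j"] by auto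

lemma a_eq': "i \<in> {1..r} \<Longrightarrow> j \<in> {1..s} \<Longrightarrow> a i j = (if Inl i \<in> nb (Inr j) then 1 else 0)"
  using w_nb[of "Inr j" "Inl i"] by auto

text \<open>The four neighbours have half the value of the centre, so they are leaves by
  \<open>nb_half\<close>, and together with the centre they form a closed set.\<close>

lemma classified_D4:
  assumes i: "i \<in> {1..r}" and c: "card (nb (Inl i)) = 4" and half: "\<forall>y\<in>nb (Inl i). m i = 2 * case_sum m n y"
  shows "classified r s a m n"
proof -
  have "nb (Inl i) = Inr ` {j. Inr j \<in> nb (Inl i)}" using nb_InlD by blast
  then have "card {j. Inr j \<in> nb (Inl i)} = 4"
    using c by (metis card_image inj_Inr inj_on_subset top_greatest)
  then obtain gs where gs: "set gs = {j. Inr j \<in> nb (Inl i)}" "distinct gs" "length gs = 4"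
    using finite_distinct_list[of "{j. Inr j \<in> nb (Inl i)}"] distinct_card
    by (metis card.infinite zero_neq_numeral)
  then obtain j1 j2 j3 j4 where gs4: "gs = [j1, j2, j3, j4]"
    by (auto simp: length_Suc_conv numeral_eq_Suc)
  have gs_sub: "set gs \<subseteq> {1..s}" using nb_InlD gs(1) by blast
  have nb: "nb (Inl i) = Inr ` set gs" using nb_InlD gs(1) by blast
  have nbj: "nb (Inr j) = {Inl i}" if "j \<in> set gs" for j
    using nb_half[of "Inl i" "Inr j"] that i half nb by auto
  have "Inl ` {i} \<union> Inr ` set gs = verts"
    by (rule closed_eq_X) (use i nb nbj gs_sub in auto)
  note R = rows_cols(1)[OF this] and C = rows_cols(2)[OF this]
  have entry: "a i j = 1 \<and> m i = 2 * n j" if "j \<in> set gs" for j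
    using that gs_sub i nb half by (auto simp: a_eq)
  show ?thesis
  proof (rule classified_listsI[of "[i]" _ gs])
    fix \<sigma> \<tau> assume *: "map \<sigma> [1..<Suc r] = [i]" "map \<tau> [1..<Suc s] = gs" "r = length [i]" "s = length gs"
    have "type_D4 r s (\<lambda>i j. a (\<sigma> i) (\<tau> j)) (m \<circ> \<sigma>) (n \<circ> \<tau>) (n j1)"
      unfolding type_D4_def matrix_is_permuted vector_is_permuted *(1,2)
      using *(3,4) entry[of j1] entry[of j2] entry[of j3] entry[of j4] by (simp add: gs4)
    moreover have "n j1 > 0" using n_pos[of j1] gs_sub gs4 by auto
    ultimately show "affine_list r s (\<lambda>i j. a (\<sigma> i) (\<tau> j)) (m \<circ> \<sigma>) (n \<circ> \<tau>) \<or>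
      affine_list s r (\<lambda>j i. a (\<sigma> i) (\<tau> j)) (n \<circ> \<tau>) (m \<circ> \<sigma>)"
      unfolding affine_list_def by blast
  qed (use R C gs in auto)
qed

end

lemma card_3_sorted:
  fixes f :: "'a \<Rightarrow> nat"
  assumes "card S = 3"
  obtains x y z where "S = {x, y, z}" "x \<noteq> y" "x \<noteq> z" "y \<noteq> z" "f x \<le> f y" "f y \<le> f z"
proof -
  obtain u v w where S: "S = {u, v, w}" "u \<noteq> v" "u \<noteq> w" "v \<noteq> w"
    using assms by (auto simp: card_3_iff)
  have P: "S = {u, w, v}" "S = {v, u, w}" "S = {v, w, u}" "S = {w, u, v}" "S = {w, v, u}"
    using S(1) by auto
  consider "f u \<le> f v \<and> f v \<le> f w" | "f u \<le> f w \<and> f w \<le> f v" | "f v \<le> f u \<and> f u \<le> f w"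
    | "f v \<le> f w \<and> f w \<le> f u" | "f w \<le> f u \<and> f u \<le> f v" | "f w \<le> f v \<and> f v \<le> f u"
    by linarith
  then show ?thesis
    by cases (use S P that in metis)+
qed

text \<open>With \<open>k\<^sub>i + 2 = p\<^sub>i\<close> this is \<open>1/p\<^sub>1 + 1/p\<^sub>2 + 1/p\<^sub>3 = 1\<close>, whose solutions are
  \<open>(3, 3, 3)\<close>, \<open>(2, 4, 4)\<close> and \<open>(2, 3, 6)\<close>.\<close>
lemma unit_fractions_sum_1:
  fixes k1 k2 k3 c1 c2 c3 D :: nat
  assumes D: "D = (k1 + 2) * c1" "D = (k2 + 2) * c2" "D = (k3 + 2) * c3" "c1 + c2 + c3 = D" "D > 0"
    and le: "k1 \<le> k2" "k2 \<le> k3"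
  shows "k1 = 1 \<and> k2 = 1 \<and> k3 = 1 \<or> k1 = 0 \<and> k2 = 2 \<and> k3 = 2 \<or> k1 = 0 \<and> k2 = 1 \<and> k3 = 4"
proof -
  have pos: "c1 > 0" "c2 > 0" "c3 > 0" using D by (auto intro!: Nat.gr0I)
  have mono: "c' \<le> c" if "(k + 2) * c = (k' + 2) * c'" "k \<le> k'" for k k' c c' :: nat
  proof -
    have "(k + 2) * c' \<le> (k' + 2) * c'" using that(2) by (intro mult_right_mono) auto
    then have "(k + 2) * c' \<le> (k + 2) * c" using that(1) by simp
    then show ?thesis by (simp only: mult_le_cancel1)
  qed
  have c: "c2 \<le> c1" "c3 \<le> c2" using mono[of k1 c1 k2 c2] mono[of k2 c2 k3 c3] D le by auto
  have val: "k = j" if "D = (k + 2) * x" "D = (j + 2) * x" for k j x :: nat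
    using that D(5) by auto
  \<comment> \<open>\<open>c1\<close> is the largest of the three summands of \<open>D\<close>, so
    \<open>D \<le> 3 * c1\<close>, whereas \<open>k1 \<ge> 2\<close> would give
    \<open>D \<ge> 4 * c1\<close>.\<close>
  have "k1 \<le> 1"
  proof (rule ccontr)
    assume "\<not> k1 \<le> 1"
    then have "4 * c1 \<le> (k1 + 2) * c1" by (intro mult_right_mono) auto
    then show False using D c pos by linarith
  qed
  then consider "k1 = 1" | "k1 = 0" by linarith
  then show ?thesis
  proof cases
    case 1
    then have "D = 3 * c1" using D(1) by simp
    then have "c2 = c1" "c3 = c1" using D(4) c by linarith+
    then have "D = (1 + 2) * c2" "D = (1 + 2) * c3" using \<open>D = 3 * c1\<close> by simp_all
    then have "k2 = 1" "k3 = 1" using val[OF D(2)] val[OF D(3)] by blast+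
    then show ?thesis using 1 by simp
  next
    case 2
    then have "D = 2 * c1" using D(1) by simp
    then have c1: "c1 = c2 + c3" using D(4) by linarith
    \<comment> \<open>Now \<open>c2 + c3\<close> is half of \<open>D\<close> and
      \<open>c3 \<le> c2\<close>, so \<open>D \<le> 4 * c2\<close>, against
      \<open>D \<ge> 5 * c2\<close> for \<open>k2 \<ge> 3\<close>.\<close>
    have "k2 \<le> 2"
    proof (rule ccontr)
      assume "\<not> k2 \<le> 2"
      then have "5 * c2 \<le> (k2 + 2) * c2" by (intro mult_right_mono) auto
      then show False using D(2) \<open>D = 2 * c1\<close> c1 c pos by linarith
    qed
    then consider "k2 = 0" | "k2 = 1" | "k2 = 2" by linarith
    then show ?thesis
    proof cases
      case 1
      then have "D = 2 * c2" using D(2) by simp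
      then show ?thesis using \<open>D = 2 * c1\<close> c1 pos by linarith
    next
      case k2: 2
      then have "D = 3 * c2" using D(2) by simp
      then have "D = 6 * c3" using \<open>D = 2 * c1\<close> c1 by linarith
      then have "D = (4 + 2) * c3" by simp
      then show ?thesis using val[OF D(3)] 2 k2 by blast
    next
      case k2: 3
      then have "D = 4 * c2" using D(2) by simp
      then have "D = 4 * c3" using \<open>D = 2 * c1\<close> c1 by linarith
      then have "D = (2 + 2) * c3" by simp
      then show ?thesis using val[OF D(3)] 2 k2 by blast
    qed
  qed
qed

section \<open>Stars with three arms\<close>

context simple_null_graph
begin

text \<open>An arm with common difference \<open>c\<close> begins with the value
  \<open>d x - c\<close>. The three first values sum to \<open>2 * d x\<close>, so the three
  differences sum to \<open>d x\<close>, which is the equation of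
  \<open>unit_fractions_sum_1\<close>. Its solutions become \<open>type_E6\<close>,
  \<open>type_E7\<close> and \<open>type_E8\<close>, in this order.\<close>

lemma three_arms:
  assumes x: "x \<in> X" and less: "\<And>y. y \<in> nb x \<Longrightarrow> d y < d x" and card: "card (nb x) = 3"
  obtains y1 y2 y3 ys1 ys2 ys3 where
    "nb x = {y1, y2, y3}" "y1 \<noteq> y2" "y1 \<noteq> y3" "y2 \<noteq> y3"
    "arm x (y1 # ys1)" "arm x (y2 # ys2)" "arm x (y3 # ys3)"
    "length ys1 = 1 \<and> length ys2 = 1 \<and> length ys3 = 1 \<or>
     length ys1 = 0 \<and> length ys2 = 2 \<and> length ys3 = 2 \<or>
     length ys1 = 0 \<and> length ys2 = 1 \<and> length ys3 = 4"
proof -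
  have "\<forall>y\<in>nb x. \<exists>ys. arm x (y # ys)" using arm_exists[OF x _ less] by blast
  then obtain g where g: "\<And>y. y \<in> nb x \<Longrightarrow> arm x (y # g y)" by metis
  obtain y1 y2 y3 where y: "nb x = {y1, y2, y3}" "y1 \<noteq> y2" "y1 \<noteq> y3" "y2 \<noteq> y3"
    and le: "length (g y1) \<le> length (g y2)" "length (g y2) \<le> length (g y3)"
    using card_3_sorted[OF card, of "\<lambda>y. length (g y)"] by blast
  have arms: "arm x (y1 # g y1)" "arm x (y2 # g y2)" "arm x (y3 # g y3)" using g y(1) by auto
  from arm_d[OF arms(1)] arm_d[OF arms(2)] arm_d[OF arms(3)] obtain c1 c2 c3 where
    c: "d x = (length (g y1) + 2) * c1" "d y1 = (length (g y1) + 1) * c1"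
      "d x = (length (g y2) + 2) * c2" "d y2 = (length (g y2) + 1) * c2"
      "d x = (length (g y3) + 2) * c3" "d y3 = (length (g y3) + 1) * c3"
    by blast
  have "d y1 + (d y2 + d y3) = 2 * d x" using sum_nb[OF x] y by simp
  moreover have "d x = d y1 + c1" "d x = d y2 + c2" "d x = d y3 + c3" using c by simp_all
  ultimately have "c1 + c2 + c3 = d x" by linarith
  from unit_fractions_sum_1[OF c(1,3,5) this d_pos[OF x] le] show ?thesis
    using that[OF y arms] by blast
qed

end

context simple_affine_bipartite
begin

text \<open>Along an arm, columns stand at odd and rows at even distance from the centre. All values
  are multiples of the value \<open>c\<close> at the leaf \<open>l2\<close>.\<close>

lemma classified_E7:
  assumes i: "i \<in> {1..r}" and nb: "nb (Inl i) = {y1, y2, y3}" "y1 \<noteq> y2" "y1 \<noteq> y3" "y2 \<noteq> y3"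
    and arms: "arm (Inl i) [y1]" "arm (Inl i) [y2, u2, v2]" "arm (Inl i) [y3, u3, v3]"
  shows "classified r s a m n"
proof -
  obtain j1 where j1: "y1 = Inr j1" "j1 \<in> {1..s}" using nb_InlD[of y1 i] nb by auto
  obtain j2 where j2: "y2 = Inr j2" "j2 \<in> {1..s}" using nb_InlD[of y2 i] nb by auto
  obtain j3 where j3: "y3 = Inr j3" "j3 \<in> {1..s}" using nb_InlD[of y3 i] nb by auto
  obtain i2 where i2: "u2 = Inl i2" "i2 \<in> {1..r}" using nb_InrD[of u2 j2] arms j2 by auto
  obtain i3 where i3: "u3 = Inl i3" "i3 \<in> {1..r}" using nb_InrD[of u3 j3] arms j3 by auto
  obtain l2 where l2: "v2 = Inr l2" "l2 \<in> {1..s}" using nb_InlD[of v2 i2] arms i2 by auto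
  obtain l3 where l3: "v3 = Inr l3" "l3 \<in> {1..s}" using nb_InlD[of v3 i3] arms i3 by auto
  note vars = j1(1) j2(1) j3(1) i2(1) i3(1) l2(1) l3(1)
  have nbs: "nb (Inl i) = {Inr j1, Inr j2, Inr j3}" "nb (Inl i2) = {Inr j2, Inr l2}" "nb (Inl i3) = {Inr j3, Inr l3}"
      "nb (Inr j1) = {Inl i}" "nb (Inr j2) = {Inl i, Inl i2}" "nb (Inr j3) = {Inl i, Inl i3}"
      "nb (Inr l2) = {Inl i2}" "nb (Inr l3) = {Inl i3}"
    and j_ne: "j1 \<noteq> j2" "j1 \<noteq> j3" "j2 \<noteq> j3" and i_ne: "i2 \<noteq> i" "i3 \<noteq> i"
    and d_eq: "m i = 2 * n j1" "m i + m i2 = 2 * n j2" "m i + m i3 = 2 * n j3"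
      "n j2 + n l2 = 2 * m i2" "n j3 + n l3 = 2 * m i3" "m i2 = 2 * n l2" "m i3 = 2 * n l3"
    using nb arms unfolding vars by simp_all
  define c where "c = n l2"
  have c: "c > 0" using n_pos l2(2) by (simp add: c_def)
  have d: "n l2 = c" "m i2 = 2 * c" "n j2 = 3 * c" "m i = 4 * c" "n j1 = 2 * c" "n l3 = c" "m i3 = 2 * c" "n j3 = 3 * c"
    using d_eq c_def by linarith+
  \<comment> \<open>Disjointness of the arms is not part of \<open>arm\<close>: vertices are told
    apart by their neighbours or by their values.\<close>
  have ne: "i2 \<noteq> i3" "l2 \<noteq> l3"
    "j1 \<noteq> l2" "j1 \<noteq> l3" "j2 \<noteq> l2" "j2 \<noteq> l3" "j3 \<noteq> l2" "j3 \<noteq> l3"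
    using nbs d c j_ne by auto
  note ne = ne j_ne i_ne ne[symmetric] j_ne[symmetric] i_ne[symmetric]
  \<comment> \<open>Rows and columns are listed in the order met on the way from \<open>l2\<close>
    to \<open>l3\<close>, with the short arm \<open>j1\<close> in the middle.\<close>
  have "Inl ` set [i2, i, i3] \<union> Inr ` set [l2, j2, j1, j3, l3] = verts"
    by (rule closed_eq_X) (use i j1 j2 j3 i2 i3 l2 l3 nbs in auto)
  note R = rows_cols[OF this]
  have entries: "a x y = (if Inr y \<in> nb (Inl x) then 1 else 0)" if "x \<in> set [i2, i, i3]" "y \<in> set [l2, j2, j1, j3, l3]" for x y
    by (rule a_eq) (use that in \<open>simp_all only: R\<close>)
  note entries = entries[of i2, simplified nbs] entries[of i, simplified nbs] entries[of i3, simplified nbs]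
  show ?thesis
  proof (rule classified_listsI[of "[i2, i, i3]" _ "[l2, j2, j1, j3, l3]"])
    fix \<sigma> \<tau> assume *: "map \<sigma> [1..<Suc r] = [i2, i, i3]" "map \<tau> [1..<Suc s] = [l2, j2, j1, j3, l3]"
      "r = length [i2, i, i3]" "s = length [l2, j2, j1, j3, l3]"
    have "type_E7 r s (\<lambda>i j. a (\<sigma> i) (\<tau> j)) (m \<circ> \<sigma>) (n \<circ> \<tau>) c"
      unfolding type_E7_def matrix_is_permuted vector_is_permuted *(1,2)
      using *(3,4) by (simp add: entries ne d)
    then show "affine_list r s (\<lambda>i j. a (\<sigma> i) (\<tau> j)) (m \<circ> \<sigma>) (n \<circ> \<tau>) \<or>
      affine_list s r (\<lambda>j i. a (\<sigma> i) (\<tau> j)) (n \<circ> \<tau>) (m \<circ> \<sigma>)"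
      unfolding affine_list_def using c by blast
  qed (use R ne in auto)
qed

text \<open>With its centre in a row this star has four rows and three columns, so the table is
  matched after transposition.\<close>

lemma classified_E6:
  assumes i: "i \<in> {1..r}" and nb: "nb (Inl i) = {y1, y2, y3}" "y1 \<noteq> y2" "y1 \<noteq> y3" "y2 \<noteq> y3"
    and arms: "arm (Inl i) [y1, u1]" "arm (Inl i) [y2, u2]" "arm (Inl i) [y3, u3]"
  shows "classified r s a m n"
proof -
  obtain j1 where j1: "y1 = Inr j1" "j1 \<in> {1..s}" using nb_InlD[of y1 i] nb by auto
  obtain j2 where j2: "y2 = Inr j2" "j2 \<in> {1..s}" using nb_InlD[of y2 i] nb by auto
  obtain j3 where j3: "y3 = Inr j3" "j3 \<in> {1..s}" using nb_InlD[of y3 i] nb by auto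
  obtain i1 where i1: "u1 = Inl i1" "i1 \<in> {1..r}" using nb_InrD[of u1 j1] arms j1 by auto
  obtain i2 where i2: "u2 = Inl i2" "i2 \<in> {1..r}" using nb_InrD[of u2 j2] arms j2 by auto
  obtain i3 where i3: "u3 = Inl i3" "i3 \<in> {1..r}" using nb_InrD[of u3 j3] arms j3 by auto
  note vars = j1(1) j2(1) j3(1) i1(1) i2(1) i3(1)
  have nbs: "nb (Inl i) = {Inr j1, Inr j2, Inr j3}"
      "nb (Inl i1) = {Inr j1}" "nb (Inl i2) = {Inr j2}" "nb (Inl i3) = {Inr j3}"
      "nb (Inr j1) = {Inl i, Inl i1}" "nb (Inr j2) = {Inl i, Inl i2}" "nb (Inr j3) = {Inl i, Inl i3}"
    and j_ne: "j1 \<noteq> j2" "j1 \<noteq> j3" "j2 \<noteq> j3" and i_ne: "i1 \<noteq> i" "i2 \<noteq> i" "i3 \<noteq> i"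
    and d_eq: "m i + m i1 = 2 * n j1" "m i + m i2 = 2 * n j2" "m i + m i3 = 2 * n j3"
      "n j1 = 2 * m i1" "n j2 = 2 * m i2" "n j3 = 2 * m i3"
    using nb arms unfolding vars by simp_all
  define c where "c = m i1"
  have c: "c > 0" using m_pos i1(2) by (simp add: c_def)
  have d: "m i1 = c" "m i2 = c" "m i3 = c" "m i = 3 * c" "n j1 = 2 * c" "n j2 = 2 * c" "n j3 = 2 * c"
    using d_eq c_def by linarith+
  have "i1 \<noteq> i2" "i1 \<noteq> i3" "i2 \<noteq> i3" using nbs j_ne by auto
  note ne = this j_ne i_ne this[symmetric] j_ne[symmetric] i_ne[symmetric]
  have "Inl ` set [i, i1, i2, i3] \<union> Inr ` set [j1, j2, j3] = verts"
    by (rule closed_eq_X) (use i j1 j2 j3 i1 i2 i3 nbs in auto)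
  note R = rows_cols[OF this]
  have entries: "a x y = (if Inr y \<in> nb (Inl x) then 1 else 0)" if "x \<in> set [i, i1, i2, i3]" "y \<in> set [j1, j2, j3]" for x y
    by (rule a_eq) (use that in \<open>simp_all only: R\<close>)
  note entries = entries[of i, simplified nbs] entries[of i1, simplified nbs] entries[of i2, simplified nbs] entries[of i3, simplified nbs]
  show ?thesis
  proof (rule classified_listsI[of "[i, i1, i2, i3]" _ "[j1, j2, j3]"])
    fix \<sigma> \<tau> assume *: "map \<sigma> [1..<Suc r] = [i, i1, i2, i3]" "map \<tau> [1..<Suc s] = [j1, j2, j3]"
      "r = length [i, i1, i2, i3]" "s = length [j1, j2, j3]"
    have "type_E6 s r (\<lambda>j i. a (\<sigma> i) (\<tau> j)) (n \<circ> \<tau>) (m \<circ> \<sigma>) c"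
      unfolding type_E6_def matrix_is_permuted_transpose vector_is_permuted *(1,2)
      using *(3,4) by (simp add: entries ne d)
    then show "affine_list r s (\<lambda>i j. a (\<sigma> i) (\<tau> j)) (m \<circ> \<sigma>) (n \<circ> \<tau>) \<or>
      affine_list s r (\<lambda>j i. a (\<sigma> i) (\<tau> j)) (n \<circ> \<tau>) (m \<circ> \<sigma>)"
      unfolding affine_list_def using c by blast
  qed (use R ne in auto)
qed

lemma classified_E8:
  assumes i: "i \<in> {1..r}" and nb: "nb (Inl i) = {y1, y2, y3}" "y1 \<noteq> y2" "y1 \<noteq> y3" "y2 \<noteq> y3"
    and arms: "arm (Inl i) [y1]" "arm (Inl i) [y2, u2]" "arm (Inl i) [y3, u3, v3, w3, z3]"
  shows "classified r s a m n"
proof -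
  obtain j1 where j1: "y1 = Inr j1" "j1 \<in> {1..s}" using nb_InlD[of y1 i] nb by auto
  obtain j2 where j2: "y2 = Inr j2" "j2 \<in> {1..s}" using nb_InlD[of y2 i] nb by auto
  obtain j3 where j3: "y3 = Inr j3" "j3 \<in> {1..s}" using nb_InlD[of y3 i] nb by auto
  obtain i2 where i2: "u2 = Inl i2" "i2 \<in> {1..r}" using nb_InrD[of u2 j2] arms j2 by auto
  obtain i3 where i3: "u3 = Inl i3" "i3 \<in> {1..r}" using nb_InrD[of u3 j3] arms j3 by auto
  obtain j4 where j4: "v3 = Inr j4" "j4 \<in> {1..s}" using nb_InlD[of v3 i3] arms i3 by auto
  obtain i4 where i4: "w3 = Inl i4" "i4 \<in> {1..r}" using nb_InrD[of w3 j4] arms j4 by auto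
  obtain j5 where j5: "z3 = Inr j5" "j5 \<in> {1..s}" using nb_InlD[of z3 i4] arms i4 by auto
  note vars = j1(1) j2(1) j3(1) i2(1) i3(1) j4(1) i4(1) j5(1)
  have nbs: "nb (Inl i) = {Inr j1, Inr j2, Inr j3}"
      "nb (Inl i2) = {Inr j2}" "nb (Inl i3) = {Inr j3, Inr j4}" "nb (Inl i4) = {Inr j4, Inr j5}"
      "nb (Inr j1) = {Inl i}" "nb (Inr j2) = {Inl i, Inl i2}" "nb (Inr j3) = {Inl i, Inl i3}"
      "nb (Inr j4) = {Inl i3, Inl i4}" "nb (Inr j5) = {Inl i4}"
    and d_eq: "m i = 2 * n j1" "m i + m i2 = 2 * n j2" "n j2 = 2 * m i2" "m i + m i3 = 2 * n j3"
      "n j3 + n j4 = 2 * m i3" "m i3 + m i4 = 2 * n j4" "n j4 + n j5 = 2 * m i4" "m i4 = 2 * n j5"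
    using nb arms unfolding vars by simp_all
  define c where "c = n j5"
  have c: "c > 0" using n_pos j5(2) by (simp add: c_def)
  have d: "n j5 = c" "m i4 = 2 * c" "n j4 = 3 * c" "m i3 = 4 * c" "n j3 = 5 * c" "m i = 6 * c"
      "n j1 = 3 * c" "m i2 = 2 * c" "n j2 = 4 * c"
    using d_eq c_def by linarith+
  \<comment> \<open>Equal values occur only for the pairs \<open>i2\<close>, \<open>i4\<close> and
    \<open>j1\<close>, \<open>j4\<close>. These are separated by their neighbours, all other pairs
    by their values.\<close>
  have "j4 \<noteq> j5" using d c by auto
  then have "i2 \<noteq> i4" using nbs by auto
  have "i \<noteq> i4" "i \<noteq> i3" using d c by auto
  then have "j1 \<noteq> j4" using nbs by auto
  have "j1 \<noteq> j2" "j1 \<noteq> j3" "j2 \<noteq> j3" "j1 \<noteq> j5" "j2 \<noteq> j4" "j2 \<noteq> j5" "j3 \<noteq> j4" "j3 \<noteq> j5"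
      "i \<noteq> i2" "i2 \<noteq> i3" "i3 \<noteq> i4"
    using d c by auto
  note ne = this \<open>j4 \<noteq> j5\<close> \<open>i2 \<noteq> i4\<close> \<open>j1 \<noteq> j4\<close> \<open>i \<noteq> i4\<close> \<open>i \<noteq> i3\<close>
  note ne = ne ne[symmetric]
  have "Inl ` set [i2, i, i3, i4] \<union> Inr ` set [j2, j1, j3, j4, j5] = verts"
    by (rule closed_eq_X) (use i j1 j2 j3 i2 i3 i4 j4 j5 nbs in auto)
  note R = rows_cols[OF this]
  have entries: "a x y = (if Inr y \<in> nb (Inl x) then 1 else 0)" if "x \<in> set [i2, i, i3, i4]" "y \<in> set [j2, j1, j3, j4, j5]" for x y
    by (rule a_eq) (use that in \<open>simp_all only: R\<close>)
  note entries = entries[of i2, simplified nbs] entries[of i, simplified nbs] entries[of i3, simplified nbs] entries[of i4, simplified nbs]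
  show ?thesis
  proof (rule classified_listsI[of "[i2, i, i3, i4]" _ "[j2, j1, j3, j4, j5]"])
    fix \<sigma> \<tau> assume *: "map \<sigma> [1..<Suc r] = [i2, i, i3, i4]" "map \<tau> [1..<Suc s] = [j2, j1, j3, j4, j5]"
      "r = length [i2, i, i3, i4]" "s = length [j2, j1, j3, j4, j5]"
    have "type_E8 r s (\<lambda>i j. a (\<sigma> i) (\<tau> j)) (m \<circ> \<sigma>) (n \<circ> \<tau>) c"
      unfolding type_E8_def matrix_is_permuted vector_is_permuted *(1,2)
      using *(3,4) by (simp add: entries ne d)
    then show "affine_list r s (\<lambda>i j. a (\<sigma> i) (\<tau> j)) (m \<circ> \<sigma>) (n \<circ> \<tau>) \<or>
      affine_list s r (\<lambda>j i. a (\<sigma> i) (\<tau> j)) (n \<circ> \<tau>) (m \<circ> \<sigma>)"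
      unfolding affine_list_def using c by blast
  qed (use R ne in auto)
qed

lemma classified_star:
  assumes i: "i \<in> {1..r}" and less: "\<And>y. y \<in> nb (Inl i) \<Longrightarrow> case_sum m n y < m i"
  shows "classified r s a m n"
proof -
  have x: "Inl i \<in> verts" "\<And>y. y \<in> nb (Inl i) \<Longrightarrow> case_sum m n y < case_sum m n (Inl i)"
    using assms by auto
  from top_nbs[OF x] consider "card (nb (Inl i)) = 3"
    | "card (nb (Inl i)) = 4" "\<forall>y\<in>nb (Inl i). m i = 2 * case_sum m n y"
    by auto
  then show ?thesis
  proof cases
    case 1
    obtain y1 y2 y3 ys1 ys2 ys3 where y: "nb (Inl i) = {y1, y2, y3}" "y1 \<noteq> y2" "y1 \<noteq> y3" "y2 \<noteq> y3"
      and arms: "arm (Inl i) (y1 # ys1)" "arm (Inl i) (y2 # ys2)" "arm (Inl i) (y3 # ys3)"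
      and len: "length ys1 = 1 \<and> length ys2 = 1 \<and> length ys3 = 1 \<or>
        length ys1 = 0 \<and> length ys2 = 2 \<and> length ys3 = 2 \<or>
        length ys1 = 0 \<and> length ys2 = 1 \<and> length ys3 = 4"
      by (rule three_arms[OF x 1])
    from len consider u1 u2 u3 where "ys1 = [u1]" "ys2 = [u2]" "ys3 = [u3]"
      | u2 v2 u3 v3 where "ys1 = []" "ys2 = [u2, v2]" "ys3 = [u3, v3]"
      | u2 u3 v3 w3 z3 where "ys1 = []" "ys2 = [u2]" "ys3 = [u3, v3, w3, z3]"
      by (auto simp: length_Suc_conv numeral_eq_Suc)
    then show ?thesis
    proof cases
      case 1
      with arms show ?thesis using classified_E6[OF i y] by blast
    next
      case 2
      with arms show ?thesis using classified_E7[OF i y] by blast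
    next
      case 3
      with arms show ?thesis using classified_E8[OF i y] by blast
    qed
  qed (rule classified_D4[OF i])
qed

end

section \<open>Paths with two leaves at each end\<close>

context simple_null_graph
begin

lemma level_path_step:
  assumes "level_path x vs" "Suc t < length vs"
  shows "vs ! Suc t \<in> nb (vs ! t)"
  using assms by (cases t) (auto simp: level_path_def)

end

context simple_affine_bipartite
begin

lemma level_path_alternates:
  assumes "level_path (Inl i) vs"
  obtains h where "\<And>t. t < length vs \<Longrightarrow> vs ! t = (if even t then Inl (h t) else Inr (h t))"
proof -
  have "\<exists>k. vs ! t = (if even t then Inl k else Inr k)" if "t < length vs" for t
    using that
  proof (induction t)
    case 0
    then show ?case using assms by (auto simp: level_path_def)
  next
    case (Suc t)
    then have "vs ! Suc t \<in> nb (vs ! t)" using level_path_step[OF assms] by simp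
    then show ?case using Suc nb_InlD[of "vs ! Suc t"] nb_InrD[of "vs ! Suc t"] by (cases "even t") fastforce+
  qed
  then show ?thesis using that by metis
qed

text \<open>The path starts in a row with the leaves \<open>p\<close>, \<open>q\<close> and ends
  with the leaves \<open>p'\<close>, \<open>q'\<close>. Its length decides the side of the second
  pair: an odd length ends in a row and gives \<open>type_D_even\<close>, an even length ends in a
  column and gives \<open>type_D_odd\<close>.\<close>

lemma classified_D:
  assumes i: "i \<in> {1..r}" and path: "level_path (Inl i) vs"
    and nb_first: "nb (Inl i) = {vs ! 1, p, q}" "p \<noteq> q"
    and leaf: "2 * case_sum m n p = m i" "2 * case_sum m n q = m i" "nb p = {Inl i}" "nb q = {Inl i}"
    and nb_last: "nb (last vs) = {vs ! (length vs - 2), p', q'}" "p' \<noteq> q'"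
    and leaf': "2 * case_sum m n p' = m i" "2 * case_sum m n q' = m i" "nb p' = {last vs}" "nb q' = {last vs}"
  shows "classified r s a m n"
proof -
  define l where "l = length vs"
  obtain h where h: "\<And>t. t < l \<Longrightarrow> vs ! t = (if even t then Inl (h t) else Inr (h t))"
    unfolding l_def using level_path_alternates[OF path] by blast
  define c where "c = case_sum m n p"
  have mi: "m i = 2 * c" and cp: "case_sum m n p = c" "case_sum m n q = c" "case_sum m n p' = c" "case_sum m n q' = c"
    using leaf leaf' by (auto simp: c_def)
  have c: "c > 0" using m_pos[OF i] mi by simp
  have dist: "distinct vs" and l2: "l \<ge> 2" and v0: "vs ! 0 = Inl i"
    and dv: "\<And>v. v \<in> set vs \<Longrightarrow> v \<in> verts \<and> case_sum m n v = 2 * c"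
    and inner: "\<And>t. 0 < t \<Longrightarrow> Suc t < l \<Longrightarrow> nb (vs ! t) = {vs ! (t - 1), vs ! Suc t}"
    using path by (auto simp: level_path_def l_def mi)
  have last: "last vs = vs ! (l - 1)" using l2 by (subst last_conv_nth) (auto simp: l_def)
  have nb_l: "nb (vs ! (l - 1)) = {vs ! (l - 2), p', q'}"
    using nb_last(1) unfolding last l_def[symmetric] .
  have dvt: "vs ! t \<in> verts" "case_sum m n (vs ! t) = 2 * c" if "t < l" for t
    using dv[of "vs ! t"] that by (auto simp: l_def)
  have inj: "t < l \<Longrightarrow> u < l \<Longrightarrow> vs ! t = vs ! u \<longleftrightarrow> t = u" for t u
    using dist by (simp add: nth_eq_iff_index_eq l_def)
  have pX: "p \<in> verts" "q \<in> verts" "p' \<in> verts" "q' \<in> verts"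
    using nb_in_X[of p "Inl i"] nb_in_X[of q "Inl i"] nb_in_X[of p' "last vs"] nb_in_X[of q' "last vs"]
      nb_first(1) nb_last(1) by auto
  have first_ne: "Inl i \<noteq> last vs" using inj[of 0 "l - 1"] l2 v0 last by simp
  have leaf_ne: "p \<noteq> p'" "p \<noteq> q'" "q \<noteq> p'" "q \<noteq> q'"
    using leaf(3,4) leaf'(3,4) first_ne by auto
  have not_path: "vs ! t \<notin> {p, q, p', q'}" if "t < l" for t
    using dvt(2)[OF that] cp c by auto
  have adj_p: "p \<in> nb v \<longleftrightarrow> v = Inl i" "q \<in> nb v \<longleftrightarrow> v = Inl i" if "v \<in> verts" for v
    using nb_sym[OF that] nb_sym[OF pX(1), of v] nb_sym[OF pX(2), of v] leaf(3,4) by auto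
  have adj_p': "p' \<in> nb v \<longleftrightarrow> v = last vs" "q' \<in> nb v \<longleftrightarrow> v = last vs" if "v \<in> verts" for v
    using nb_sym[OF that] nb_sym[OF pX(3), of v] nb_sym[OF pX(4), of v] leaf'(3,4) by auto
  \<comment> \<open>On the path, adjacency means consecutive positions; \<open>not_path\<close>
    discards the leaves among the neighbours of the two ends.\<close>
  have adj: "vs ! u \<in> nb (vs ! t) \<longleftrightarrow> u = Suc t \<or> t = Suc u" if tu: "t < l" "u < l" for t u
  proof -
    consider "t = 0" | "t = l - 1" "t \<noteq> 0" | "0 < t" "Suc t < l" using tu by linarith
    then show ?thesis
    proof cases
      case 1
      have "vs ! u \<in> nb (vs ! t) \<longleftrightarrow> vs ! u = vs ! 1"
        unfolding 1 v0 nb_first(1) using not_path[OF tu(2)] by blast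
      also have "\<dots> \<longleftrightarrow> u = 1" using tu l2 by (intro inj) simp_all
      finally show ?thesis using 1 by auto
    next
      case 2
      have "vs ! u \<in> nb (vs ! t) \<longleftrightarrow> vs ! u = vs ! (l - 2)"
        unfolding 2 nb_l using not_path[OF tu(2)] by blast
      also have "\<dots> \<longleftrightarrow> u = l - 2" using tu l2 by (intro inj) simp_all
      finally show ?thesis using 2 tu l2 by auto
    next
      case 3
      have "vs ! u = vs ! (t - 1) \<longleftrightarrow> u = t - 1" "vs ! u = vs ! Suc t \<longleftrightarrow> u = Suc t"
        by (rule inj; use 3 tu in simp)+
      then show ?thesis unfolding inner[OF 3] using 3 by auto
    qed
  qed
  have "set vs \<union> {p, q, p', q'} = verts"
  proof (rule closed_eq_X)
    show "nb v \<subseteq> set vs \<union> {p, q, p', q'}" if "v \<in> set vs \<union> {p, q, p', q'}" for v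
    proof (cases "v \<in> set vs")
      case True
      then obtain t where t: "t < l" "v = vs ! t" by (auto simp: in_set_conv_nth l_def)
      then consider "t = 0" | "t = l - 1" "t \<noteq> 0" | "0 < t" "Suc t < l" by linarith
      then show ?thesis
        using t nb_first nb_last last v0 inner[of t] l2 by cases (auto simp: l_def)
    next
      case False
      have "vs \<noteq> []" using l2 by (auto simp: l_def)
      then have "Inl i \<in> set vs" "last vs \<in> set vs" using v0 nth_mem[of 0 vs] by auto
      with False that show ?thesis using leaf(3,4) leaf'(3,4) by auto
    qed
  qed (use pX dv in auto)
  note vs_eq = this
  have cover: "v = p \<or> v = q \<or> v = p' \<or> v = q' \<or> (\<exists>t<l. v = vs ! t)" if "v \<in> verts" for v
    using that unfolding vs_eq[symmetric] l_def by (auto simp: in_set_conv_nth)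
  obtain jp where jp: "p = Inr jp" using nb_InlD[of p i] nb_first(1) by auto
  obtain jq where jq: "q = Inr jq" using nb_InlD[of q i] nb_first(1) by auto
  show ?thesis
  proof (cases "odd l")
    case True
    \<comment> \<open>The table has \<open>2 * k + 1\<close> vertices, four of which are leaves, so
      the path has \<open>2 * k - 3\<close>.\<close>
    define k where "k = (l + 3) div 2"
    have k: "l = 2 * k - 3" "k \<ge> 3" using True l2 by (auto simp: k_def elim!: oddE)
    have "last vs = Inl (h (l - 1))" using last h[of "l - 1"] True l2 by simp
    then obtain jp' jq' where jp': "p' = Inr jp'" "q' = Inr jq'"
      using nb_InlD[of p' "h (l - 1)"] nb_InlD[of q' "h (l - 1)"] nb_last(1) by auto
    \<comment> \<open>Rows occupy the even positions, columns 3 to \<open>k\<close> the odd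
      positions \<open>2 * j - 5\<close>; columns 1, 2 and \<open>k + 1\<close>,
      \<open>k + 2\<close> are the leaves.\<close>
    define f where "f t = h (2 * t - 2)" for t
    define g where "g j = (if j = 1 then jp else if j = 2 then jq else if j \<le> k then h (2 * j - 5)
      else if j = k + 1 then jp' else jq')" for j
    have f: "Inl (f t) = vs ! (2 * t - 2)" "2 * t - 2 < l" if "t \<in> {1..k - 1}" for t
      using h[of "2 * t - 2"] that k by (auto simp: f_def)
    have g: "Inr (g j) = vs ! (2 * j - 5)" "2 * j - 5 < l" if "j \<in> {3..k}" for j
      using h[of "2 * j - 5"] that k by (auto simp: g_def)
    have g': "Inr (g 1) = p" "Inr (g 2) = q" "Inr (g (k + 1)) = p'" "Inr (g (k + 2)) = q'"
      using k(2) jp jq jp' by (auto simp: g_def)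
    have j_cases: "j = 1 \<or> j = 2 \<or> j \<in> {3..k} \<or> j = k + 1 \<or> j = k + 2" if "j \<in> {1..k + 2}" for j
      using that by auto
    have f_bij: "bij_betw f {1..k - 1} {1..r}"
    proof (rule bij_betwI')
      show "(f t = f u) = (t = u)" if "t \<in> {1..k - 1}" "u \<in> {1..k - 1}" for t u
        using inj[OF f(2)[OF that(1)] f(2)[OF that(2)]] f(1)[OF that(1)] f(1)[OF that(2)] that by auto
      show "f t \<in> {1..r}" if "t \<in> {1..k - 1}" for t
        using dvt(1)[OF f(2)[OF that]] f(1)[OF that] in_verts(1)[of "f t"] by simp
      show "\<exists>t\<in>{1..k - 1}. y = f t" if y: "y \<in> {1..r}" for y
      proof -
        obtain u where u: "u < l" "Inl y = vs ! u" using cover[of "Inl y"] y jp jq jp' by auto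
        then have "even u" "y = h u" using h[OF u(1)] by (auto split: if_splits)
        then show ?thesis using u k by (intro bexI[of _ "u div 2 + 1"]) (auto simp: f_def)
      qed
    qed
    have g_bij: "bij_betw g {1..k + 2} {1..s}"
    proof (rule bij_betwI')
      show "(g j = g j') = (j = j')" if "j \<in> {1..k + 2}" "j' \<in> {1..k + 2}" for j j'
      proof
        assume "g j = g j'"
        then have eq: "Inr (g j) = (Inr (g j') :: nat + nat)" by simp
        consider "j \<in> {3..k}" "j' \<in> {3..k}" | "j \<in> {3..k}" "j' \<notin> {3..k}" | "j \<notin> {3..k}" "j' \<in> {3..k}"
          | "j \<notin> {3..k}" "j' \<notin> {3..k}" by blast
        then show "j = j'"
        proof cases
          case 1
          then show ?thesis using eq g[of j] g[of j'] inj[of "2 * j - 5" "2 * j' - 5"] by auto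
        next
          case 2
          then show ?thesis using eq g[of j] not_path[of "2 * j - 5"] j_cases[OF that(2)] g' by auto
        next
          case 3
          then show ?thesis using eq g[of j'] not_path[of "2 * j' - 5"] j_cases[OF that(1)] g' by auto
        next
          case 4
          then show ?thesis using eq j_cases[OF that(1)] j_cases[OF that(2)] g' leaf_ne nb_first(2) nb_last(2)
            by (elim disjE) simp_all
        qed
      qed simp
      show "g j \<in> {1..s}" if "j \<in> {1..k + 2}" for j
      proof -
        have "Inr (g j) \<in> verts" using j_cases[OF that] g(1)[of j] dvt(1)[OF g(2)[of j]] g' pX
          by (elim disjE) (simp_all del: in_verts)
        then show ?thesis by simp
      qed
      show "\<exists>j\<in>{1..k + 2}. y = g j" if "y \<in> {1..s}" for y
      proof -
        have "Inr y = p \<or> Inr y = q \<or> Inr y = p' \<or> Inr y = q' \<or> (\<exists>t<l. Inr y = vs ! t)"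
          using cover[of "Inr y"] that by simp
        then consider "Inr y = p" | "Inr y = q" | "Inr y = p'" | "Inr y = q'" | u where "u < l" "Inr y = vs ! u"
          by blast
        then show ?thesis
        proof cases
          case 5
          then have u: "odd u" "y = h u" using h[of u] by (auto split: if_splits)
          then obtain w where "u = 2 * w + 1" by (elim oddE)
          then show ?thesis using 5 u k by (intro bexI[of _ "w + 3"]) (auto simp: g_def)
        next
          case 1
          then have "y = g 1" using g'(1) by (metis sum.inject(2))
          then show ?thesis by (intro bexI[of _ 1]) auto
        next
          case 2
          then have "y = g 2" using g'(2) by (metis sum.inject(2))
          then show ?thesis by (intro bexI[of _ 2]) auto
        next
          case 3
          then have "y = g (k + 1)" using g'(3) by (metis sum.inject(2))
          then show ?thesis by (intro bexI[of _ "k + 1"]) auto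
        next
          case 4
          then have "y = g (k + 2)" using g'(4) by (metis sum.inject(2))
          then show ?thesis by (intro bexI[of _ "k + 2"]) auto
        qed
      qed
    qed
    have entry: "a (f t) (g j) = (if t = 1 \<and> j \<in> {1, 2, 3} \<or> t \<in> {2..k - 2} \<and> j \<in> {t + 1, t + 2} \<or>
        t = k - 1 \<and> j \<in> {k, k + 1, k + 2} then 1 else 0)" (is "_ = (if ?P then _ else _)")
      if t: "t \<in> {1..k - 1}" and j: "j \<in> {1..k + 2}" for t j
    proof -
      have "a (f t) (g j) = (if Inr (g j) \<in> nb (vs ! (2 * t - 2)) then 1 else 0)"
        using a_eq[OF bij_betwE[OF f_bij, rule_format, OF t] bij_betwE[OF g_bij, rule_format, OF j]] f(1)[OF t] by simp
      moreover have first: "vs ! (2 * t - 2) = Inl i \<longleftrightarrow> t = 1"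
        unfolding v0[symmetric] using inj[OF f(2)[OF t], of 0] t l2 by auto
      moreover have last: "vs ! (2 * t - 2) = last vs \<longleftrightarrow> t = k - 1"
        unfolding last using inj[OF f(2)[OF t], of "l - 1"] t k by auto
      moreover have "Inr (g j) \<in> nb (vs ! (2 * t - 2)) \<longleftrightarrow> ?P"
        using j_cases[OF j]
      proof (elim disjE)
        assume j': "j = 1"
        have "Inr (g j) \<in> nb (vs ! (2 * t - 2)) \<longleftrightarrow> vs ! (2 * t - 2) = Inl i"
          unfolding j' g' by (rule adj_p(1)[OF dvt(1)[OF f(2)[OF t]]])
        also have "\<dots> \<longleftrightarrow> ?P" unfolding first using j' t k by auto
        finally show ?thesis .
      next
        assume j': "j = 2"
        have "Inr (g j) \<in> nb (vs ! (2 * t - 2)) \<longleftrightarrow> vs ! (2 * t - 2) = Inl i"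
          unfolding j' g' by (rule adj_p(2)[OF dvt(1)[OF f(2)[OF t]]])
        also have "\<dots> \<longleftrightarrow> ?P" unfolding first using j' t k by auto
        finally show ?thesis .
      next
        assume j3: "j \<in> {3..k}"
        have "Inr (g j) \<in> nb (vs ! (2 * t - 2)) \<longleftrightarrow> 2 * j - 5 = Suc (2 * t - 2) \<or> 2 * t - 2 = Suc (2 * j - 5)"
          unfolding g(1)[OF j3] by (rule adj[OF f(2)[OF t] g(2)[OF j3]])
        \<comment> \<open>A column \<open>j\<close> on the path lies between the rows
          \<open>j - 2\<close> and \<open>j - 1\<close>; the remaining entries of the first and last
          rows come from leaves.\<close>
        also have "\<dots> \<longleftrightarrow> j = t + 1 \<or> j = t + 2" using t j3 unfolding atLeastAtMost_iff by presburger
        also have "\<dots> \<longleftrightarrow> ?P" using t j3 k by auto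
        finally show ?thesis .
      next
        assume j': "j = k + 1"
        have "Inr (g j) \<in> nb (vs ! (2 * t - 2)) \<longleftrightarrow> vs ! (2 * t - 2) = last vs"
          unfolding j' g' by (rule adj_p'(1)[OF dvt(1)[OF f(2)[OF t]]])
        also have "\<dots> \<longleftrightarrow> ?P" unfolding last using j' t k by auto
        finally show ?thesis .
      next
        assume j': "j = k + 2"
        have "Inr (g j) \<in> nb (vs ! (2 * t - 2)) \<longleftrightarrow> vs ! (2 * t - 2) = last vs"
          unfolding j' g' by (rule adj_p'(2)[OF dvt(1)[OF f(2)[OF t]]])
        also have "\<dots> \<longleftrightarrow> ?P" unfolding last using j' t k by auto
        finally show ?thesis .
      qed
      ultimately show ?thesis by simp
    qed
    have mf: "m (f t) = 2 * c" if "t \<in> {1..k - 1}" for t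
      using dvt(2)[OF f(2)[OF that]] f(1)[OF that, symmetric] by simp
    have ng: "n (g j) = 2 * c" if "j \<in> {3..k}" for j
      using dvt(2)[OF g(2)[OF that]] g(1)[OF that, symmetric] by simp
    have ng': "n (g j) = c" if "j \<in> {1, 2, k + 1, k + 2}" for j
      using that cp unfolding g'[symmetric] by auto
    show ?thesis
    proof (rule classifiedI[OF f_bij g_bij])
      fix \<sigma> \<tau> assume \<sigma>: "\<And>i. i \<in> {1..r} \<Longrightarrow> \<sigma> i = f i" and \<tau>: "\<And>j. j \<in> {1..s} \<Longrightarrow> \<tau> j = g j"
        and rs: "k - 1 = r" "k + 2 = s"
      have "type_D_even r s (\<lambda>i j. a (\<sigma> i) (\<tau> j)) (m \<circ> \<sigma>) (n \<circ> \<tau>) c"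
        unfolding type_D_even_def o_def
      proof (intro exI[of _ k] conjI ballI)
        fix t j assume *: "t \<in> {1..r}" "j \<in> {1..s}"
        show "a (\<sigma> t) (\<tau> j) = (if t = 1 \<and> j \<in> {1, 2, 3} \<or> t \<in> {2..k - 2} \<and> j \<in> {t + 1, t + 2} \<or>
            t = k - 1 \<and> j \<in> {k, k + 1, k + 2} then 1 else 0)"
          unfolding \<sigma>[OF *(1)] \<tau>[OF *(2)] by (rule entry) (use * rs in simp_all)
      next
        fix j assume *: "j \<in> {1, 2, k + 1, k + 2}"
        then have "j \<in> {1..s}" using k rs by auto
        then show "n (\<tau> j) = c" using ng'[OF *] by (simp only: \<tau>)
      next
        fix j assume *: "j \<in> {3..k}"
        then have "j \<in> {1..s}" using rs by auto
        then show "n (\<tau> j) = 2 * c" using ng[OF *] by (simp only: \<tau>)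
      next
        fix t assume *: "t \<in> {1..k - 1}"
        then have "t \<in> {1..r}" using rs by simp
        then show "m (\<sigma> t) = 2 * c" using mf[OF *] by (simp only: \<sigma>)
      qed (use k rs in simp_all)
      then show "affine_list r s (\<lambda>i j. a (\<sigma> i) (\<tau> j)) (m \<circ> \<sigma>) (n \<circ> \<tau>) \<or>
          affine_list s r (\<lambda>j i. a (\<sigma> i) (\<tau> j)) (n \<circ> \<tau>) (m \<circ> \<sigma>)"
        unfolding affine_list_def using c by blast
    qed
  next
    case False
    \<comment> \<open>Here the table has \<open>2 * k\<close> vertices. The leaves are columns 1, 2
      and rows \<open>k - 1\<close>, \<open>k\<close>, so the path has \<open>2 * k - 4\<close>
      vertices and ends in column \<open>k\<close>.\<close>
    define k where "k = l div 2 + 2"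
    have k: "l = 2 * k - 4" "k \<ge> 3" using False l2 by (auto simp: k_def elim!: evenE)
    have "last vs = Inr (h (l - 1))" using last h[of "l - 1"] False l2 by simp
    then obtain ip' iq' where ip': "p' = Inl ip'" "q' = Inl iq'"
      using nb_InrD[of p' "h (l - 1)"] nb_InrD[of q' "h (l - 1)"] nb_last(1) by auto
    define f where "f t = (if t \<le> k - 2 then h (2 * t - 2) else if t = k - 1 then ip' else iq')" for t
    define g where "g j = (if j = 1 then jp else if j = 2 then jq else h (2 * j - 5))" for j
    have f: "Inl (f t) = vs ! (2 * t - 2)" "2 * t - 2 < l" if "t \<in> {1..k - 2}" for t
      using h[of "2 * t - 2"] that k by (auto simp: f_def)
    have g: "Inr (g j) = vs ! (2 * j - 5)" "2 * j - 5 < l" if "j \<in> {3..k}" for j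
      using h[of "2 * j - 5"] that k by (auto simp: g_def)
    have f': "Inl (f (k - 1)) = p'" "Inl (f k) = q'" using k(2) ip' by (auto simp: f_def)
    have g': "Inr (g 1) = p" "Inr (g 2) = q" using jp jq by (auto simp: g_def)
    have t_cases: "t \<in> {1..k - 2} \<or> t = k - 1 \<or> t = k" if "t \<in> {1..k}" for t
      using that by auto
    have j_cases: "j = 1 \<or> j = 2 \<or> j \<in> {3..k}" if "j \<in> {1..k}" for j
      using that by auto
    have f_bij: "bij_betw f {1..k} {1..r}"
    proof (rule bij_betwI')
      show "(f t = f u) = (t = u)" if "t \<in> {1..k}" "u \<in> {1..k}" for t u
      proof
        assume "f t = f u"
        then have eq: "Inl (f t) = (Inl (f u) :: nat + nat)" by simp
        consider "t \<in> {1..k - 2}" "u \<in> {1..k - 2}" | "t \<in> {1..k - 2}" "u \<notin> {1..k - 2}"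
          | "t \<notin> {1..k - 2}" "u \<in> {1..k - 2}" | "t \<notin> {1..k - 2}" "u \<notin> {1..k - 2}" by blast
        then show "t = u"
        proof cases
          case 1
          then show ?thesis using eq f[of t] f[of u] inj[of "2 * t - 2" "2 * u - 2"] by auto
        next
          case 2
          then show ?thesis using eq f[of t] not_path[of "2 * t - 2"] t_cases[OF that(2)] f' by auto
        next
          case 3
          then show ?thesis using eq f[of u] not_path[of "2 * u - 2"] t_cases[OF that(1)] f' by auto
        next
          case 4
          then show ?thesis using eq t_cases[OF that(1)] t_cases[OF that(2)] f' nb_last(2)
            by (elim disjE) simp_all
        qed
      qed simp
      show "f t \<in> {1..r}" if "t \<in> {1..k}" for t
      proof -
        have "Inl (f t) \<in> verts" using t_cases[OF that] f(1)[of t] dvt(1)[OF f(2)[of t]] f' pX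
          by (elim disjE) (simp_all del: in_verts)
        then show ?thesis by simp
      qed
      show "\<exists>t\<in>{1..k}. y = f t" if y: "y \<in> {1..r}" for y
      proof -
        have "Inl y = p' \<or> Inl y = q' \<or> (\<exists>t<l. Inl y = vs ! t)"
          using cover[of "Inl y"] y jp jq by simp
        then consider "Inl y = p'" | "Inl y = q'" | u where "u < l" "Inl y = vs ! u"
          by blast
        then show ?thesis
        proof cases
          case 1
          then have "y = f (k - 1)" using f'(1) by (metis sum.inject(1))
          then show ?thesis using k by (intro bexI[of _ "k - 1"]) auto
        next
          case 2
          then have "y = f k" using f'(2) by (metis sum.inject(1))
          then show ?thesis using k by (intro bexI[of _ k]) auto
        next
          case 3
          then have u: "even u" "y = h u" using h[of u] by (auto split: if_splits)
          then obtain w where "u = 2 * w" by (elim evenE)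
          then show ?thesis using 3 u k by (intro bexI[of _ "w + 1"]) (auto simp: f_def)
        qed
      qed
    qed
    have g_bij: "bij_betw g {1..k} {1..s}"
    proof (rule bij_betwI')
      show "(g j = g j') = (j = j')" if "j \<in> {1..k}" "j' \<in> {1..k}" for j j'
      proof
        assume "g j = g j'"
        then have eq: "Inr (g j) = (Inr (g j') :: nat + nat)" by simp
        consider "j \<in> {3..k}" "j' \<in> {3..k}" | "j \<in> {3..k}" "j' \<notin> {3..k}" | "j \<notin> {3..k}" "j' \<in> {3..k}"
          | "j \<notin> {3..k}" "j' \<notin> {3..k}" by blast
        then show "j = j'"
        proof cases
          case 1
          then show ?thesis using eq g[of j] g[of j'] inj[of "2 * j - 5" "2 * j' - 5"] by auto
        next
          case 2
          then show ?thesis using eq g[of j] not_path[of "2 * j - 5"] j_cases[OF that(2)] g' by auto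
        next
          case 3
          then show ?thesis using eq g[of j'] not_path[of "2 * j' - 5"] j_cases[OF that(1)] g' by auto
        next
          case 4
          then show ?thesis using eq j_cases[OF that(1)] j_cases[OF that(2)] g' nb_first(2)
            by (elim disjE) simp_all
        qed
      qed simp
      show "g j \<in> {1..s}" if "j \<in> {1..k}" for j
      proof -
        have "Inr (g j) \<in> verts" using j_cases[OF that] g(1)[of j] dvt(1)[OF g(2)[of j]] g' pX
          by (elim disjE) (simp_all del: in_verts)
        then show ?thesis by simp
      qed
      show "\<exists>j\<in>{1..k}. y = g j" if y: "y \<in> {1..s}" for y
      proof -
        have "Inr y = p \<or> Inr y = q \<or> (\<exists>t<l. Inr y = vs ! t)"
          using cover[of "Inr y"] y ip' by simp
        then consider "Inr y = p" | "Inr y = q" | u where "u < l" "Inr y = vs ! u"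
          by blast
        then show ?thesis
        proof cases
          case 1
          then have "y = g 1" using g'(1) by (metis sum.inject(2))
          then show ?thesis using k by (intro bexI[of _ 1]) auto
        next
          case 2
          then have "y = g 2" using g'(2) by (metis sum.inject(2))
          then show ?thesis using k by (intro bexI[of _ 2]) auto
        next
          case 3
          then have u: "odd u" "y = h u" using h[of u] by (auto split: if_splits)
          then obtain w where "u = 2 * w + 1" by (elim oddE)
          then show ?thesis using 3 u k by (intro bexI[of _ "w + 3"]) (auto simp: g_def)
        qed
      qed
    qed
    have entry: "a (f t) (g j) = (if t = 1 \<and> j \<in> {1, 2, 3} \<or> t \<in> {2..k - 2} \<and> j \<in> {t + 1, t + 2} \<or>
        t \<in> {k - 1, k} \<and> j = k then 1 else 0)" (is "_ = (if ?P then _ else _)")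
      if t: "t \<in> {1..k}" and j: "j \<in> {1..k}" for t j
    proof -
      have a: "a (f t) (g j) = (if Inr (g j) \<in> nb (Inl (f t)) then 1 else 0)"
        by (rule a_eq[OF bij_betwE[OF f_bij, rule_format, OF t] bij_betwE[OF g_bij, rule_format, OF j]])
      have "Inr (g j) \<in> nb (Inl (f t)) \<longleftrightarrow> ?P"
      proof (cases "t \<in> {1..k - 2}")
        case t': True
        have first: "vs ! (2 * t - 2) = Inl i \<longleftrightarrow> t = 1"
          unfolding v0[symmetric] using inj[OF f(2)[OF t'], of 0] t' l2 by auto
        show ?thesis
          unfolding f(1)[OF t'] using j_cases[OF j]
        proof (elim disjE)
          assume j': "j = 1"
          have "Inr (g j) \<in> nb (vs ! (2 * t - 2)) \<longleftrightarrow> vs ! (2 * t - 2) = Inl i"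
            unfolding j' g' by (rule adj_p(1)[OF dvt(1)[OF f(2)[OF t']]])
          also have "\<dots> \<longleftrightarrow> ?P" unfolding first using j' t' k by auto
          finally show "Inr (g j) \<in> nb (vs ! (2 * t - 2)) \<longleftrightarrow> ?P" .
        next
          assume j': "j = 2"
          have "Inr (g j) \<in> nb (vs ! (2 * t - 2)) \<longleftrightarrow> vs ! (2 * t - 2) = Inl i"
            unfolding j' g' by (rule adj_p(2)[OF dvt(1)[OF f(2)[OF t']]])
          also have "\<dots> \<longleftrightarrow> ?P" unfolding first using j' t' k by auto
          finally show "Inr (g j) \<in> nb (vs ! (2 * t - 2)) \<longleftrightarrow> ?P" .
        next
          assume j3: "j \<in> {3..k}"
          have "Inr (g j) \<in> nb (vs ! (2 * t - 2)) \<longleftrightarrow> 2 * j - 5 = Suc (2 * t - 2) \<or> 2 * t - 2 = Suc (2 * j - 5)"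
            unfolding g(1)[OF j3] by (rule adj[OF f(2)[OF t'] g(2)[OF j3]])
          also have "\<dots> \<longleftrightarrow> j = t + 1 \<or> j = t + 2" using t' j3 unfolding atLeastAtMost_iff by presburger
          also have "\<dots> \<longleftrightarrow> ?P" using t' j3 k by auto
          finally show "Inr (g j) \<in> nb (vs ! (2 * t - 2)) \<longleftrightarrow> ?P" .
        qed
      next
        case False
        \<comment> \<open>These two rows are the leaves at the end of the path, whose only neighbour
          is column \<open>k\<close>.\<close>
        then have t': "t = k - 1 \<or> t = k" using t_cases[OF t] by blast
        then have "nb (Inl (f t)) = {last vs}" using f' leaf'(3,4) by auto
        also have "last vs = Inr (g k)" using last g(1)[of k] k by simp
        finally have "Inr (g j) \<in> nb (Inl (f t)) \<longleftrightarrow> g j = g k" by simp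
        also have "\<dots> \<longleftrightarrow> j = k"
          using inj_onD[OF bij_betw_imp_inj_on[OF g_bij], of j k] j k by auto
        also have "\<dots> \<longleftrightarrow> ?P" using t' k j by auto
        finally show ?thesis .
      qed
      with a show ?thesis by simp
    qed
    have mf: "m (f t) = 2 * c" if "t \<in> {1..k - 2}" for t
      using dvt(2)[OF f(2)[OF that]] f(1)[OF that, symmetric] by simp
    have mf': "m (f t) = c" if "t \<in> {k - 1, k}" for t
      using that cp unfolding f'[symmetric] by auto
    have ng: "n (g j) = 2 * c" if "j \<in> {3..k}" for j
      using dvt(2)[OF g(2)[OF that]] g(1)[OF that, symmetric] by simp
    have ng': "n (g j) = c" if "j \<in> {1, 2}" for j
      using that cp unfolding g'[symmetric] by auto
    show ?thesis
    proof (rule classifiedI[OF f_bij g_bij])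
      fix \<sigma> \<tau> assume \<sigma>: "\<And>i. i \<in> {1..r} \<Longrightarrow> \<sigma> i = f i" and \<tau>: "\<And>j. j \<in> {1..s} \<Longrightarrow> \<tau> j = g j"
        and rs: "k = r" "k = s"
      have "type_D_odd r s (\<lambda>i j. a (\<sigma> i) (\<tau> j)) (m \<circ> \<sigma>) (n \<circ> \<tau>) c"
        unfolding type_D_odd_def o_def
      proof (intro exI[of _ k] conjI ballI)
        fix t j assume *: "t \<in> {1..k}" "j \<in> {1..k}"
        show "a (\<sigma> t) (\<tau> j) = (if t = 1 \<and> j \<in> {1, 2, 3} \<or> t \<in> {2..k - 2} \<and> j \<in> {t + 1, t + 2} \<or>
            t \<in> {k - 1, k} \<and> j = k then 1 else 0)"
          unfolding \<sigma>[OF *(1)[unfolded rs(1)]] \<tau>[OF *(2)[unfolded rs(2)]] by (rule entry) (use * in simp_all)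
      next
        fix j assume *: "j \<in> {1, 2::nat}"
        then have "j \<in> {1..s}" using k rs by auto
        then show "n (\<tau> j) = c" using ng'[OF *] by (simp only: \<tau>)
      next
        fix j assume *: "j \<in> {3..k}"
        then have "j \<in> {1..s}" using rs by auto
        then show "n (\<tau> j) = 2 * c" using ng[OF *] by (simp only: \<tau>)
      next
        fix t assume *: "t \<in> {1..k - 2}"
        then have "t \<in> {1..r}" using rs by auto
        then show "m (\<sigma> t) = 2 * c" using mf[OF *] by (simp only: \<sigma>)
      next
        fix t assume *: "t \<in> {k - 1, k}"
        then have "t \<in> {1..r}" using rs k by auto
        then show "m (\<sigma> t) = c" using mf'[OF *] by (simp only: \<sigma>)
      qed (use k rs in simp_all)
      then show "affine_list r s (\<lambda>i j. a (\<sigma> i) (\<tau> j)) (m \<circ> \<sigma>) (n \<circ> \<tau>) \<or>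
          affine_list s r (\<lambda>j i. a (\<sigma> i) (\<tau> j)) (n \<circ> \<tau>) (m \<circ> \<sigma>)"
        unfolding affine_list_def using c by blast
    qed
  qed
qed

end

section \<open>Cycles and the choice of the starting vertex\<close>

context simple_affine_bipartite
begin

lemma classified_A:
  assumes i: "i \<in> {1..r}" and path: "level_path (Inl i) vs" and l3: "length vs \<ge> 3"
    and nb_last: "nb (last vs) = {vs ! (length vs - 2), Inl i}"
    and nb_first: "nb (Inl i) = {vs ! 1, last vs}"
  shows "classified r s a m n"
proof -
  define l where "l = length vs"
  obtain h where h: "\<And>t. t < l \<Longrightarrow> vs ! t = (if even t then Inl (h t) else Inr (h t))"
    unfolding l_def using level_path_alternates[OF path] by blast
  define c where "c = m i"
  have c: "c > 0" using m_pos[OF i] by (simp add: c_def)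
  have dist: "distinct vs" and v0: "vs ! 0 = Inl i"
    and dv: "\<And>v. v \<in> set vs \<Longrightarrow> v \<in> verts \<and> case_sum m n v = c"
    and inner: "\<And>t. 0 < t \<Longrightarrow> Suc t < l \<Longrightarrow> nb (vs ! t) = {vs ! (t - 1), vs ! Suc t}"
    using path by (auto simp: level_path_def l_def c_def)
  have last: "last vs = vs ! (l - 1)" using l3 by (subst last_conv_nth) (auto simp: l_def)
  have nb_l: "nb (vs ! (l - 1)) = {vs ! (l - 2), vs ! 0}"
    using nb_last unfolding last l_def[symmetric] v0 .
  have nb_0: "nb (vs ! 0) = {vs ! 1, vs ! (l - 1)}" using nb_first unfolding last v0 .
  have dvt: "vs ! t \<in> verts" "case_sum m n (vs ! t) = c" if "t < l" for t
    using dv[of "vs ! t"] that by (auto simp: l_def)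
  have inj: "t < l \<Longrightarrow> u < l \<Longrightarrow> vs ! t = vs ! u \<longleftrightarrow> t = u" for t u
    using dist by (simp add: nth_eq_iff_index_eq l_def)
  \<comment> \<open>The last vertex is adjacent to a row, so it is a column and the cycle has even
    length.\<close>
  have "vs ! 0 \<in> nb (vs ! (l - 1))" using nb_l by simp
  then have "odd (l - 1)" using h[of "l - 1"] nb_InlD[of "vs ! 0"] v0 l3
    by (auto simp: l_def[symmetric] split: if_splits)
  then have "even l" using l3 by (simp add: l_def)
  define k where "k = l div 2"
  have k: "l = 2 * k" "k \<ge> 2" using \<open>even l\<close> l3 by (auto simp: k_def l_def[symmetric] elim!: evenE)
  have set_vs: "set vs = verts"
  proof (rule closed_eq_X)
    fix v assume "v \<in> set vs"
    then obtain t where t: "t < l" "v = vs ! t" by (auto simp: in_set_conv_nth l_def)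
    have sub: "vs ! u \<in> set vs" if "u < l" for u using that by (simp add: l_def)
    from t(1) consider "t = 0" | "t = l - 1" | "0 < t" "Suc t < l" by linarith
    then show "nb v \<subseteq> set vs"
    proof cases
      case 1
      show ?thesis unfolding t(2) 1 nb_0 using sub[of 1] sub[of "l - 1"] k by simp
    next
      case 2
      show ?thesis unfolding t(2) 2 nb_l using sub[of "l - 2"] sub[of 0] k by simp
    next
      case 3
      show ?thesis unfolding t(2) inner[OF 3] using sub[of "t - 1"] sub[of "Suc t"] 3 by simp
    qed
  qed (use dv l3 in auto)
  \<comment> \<open>With this numbering column \<open>j\<close> lies between rows \<open>j\<close>
    and \<open>j + 1\<close>. The table instead puts row \<open>i\<close> between columns
    \<open>i\<close> and \<open>i + 1\<close>, so it is matched after transposition.\<close>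
  define f where "f t = h (2 * t - 2)" for t
  define g where "g j = h (2 * j - 1)" for j
  have f: "Inl (f t) = vs ! (2 * t - 2)" "2 * t - 2 < l" if "t \<in> {1..k}" for t
    using h[of "2 * t - 2"] that k by (auto simp: f_def)
  have g: "Inr (g j) = vs ! (2 * j - 1)" "2 * j - 1 < l" if "j \<in> {1..k}" for j
    using h[of "2 * j - 1"] that k by (auto simp: g_def)
  have cover: "\<exists>t<l. v = vs ! t" if "v \<in> verts" for v
    using that unfolding set_vs[symmetric] l_def by (auto simp: in_set_conv_nth)
  have f_bij: "bij_betw f {1..k} {1..r}"
  proof (rule bij_betwI')
    show "(f t = f u) = (t = u)" if "t \<in> {1..k}" "u \<in> {1..k}" for t u
      using inj[OF f(2)[OF that(1)] f(2)[OF that(2)]] f(1)[OF that(1)] f(1)[OF that(2)] that by auto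
    show "f t \<in> {1..r}" if "t \<in> {1..k}" for t
      using dvt(1)[OF f(2)[OF that]] f(1)[OF that] in_verts(1)[of "f t"] by simp
    show "\<exists>t\<in>{1..k}. y = f t" if y: "y \<in> {1..r}" for y
    proof -
      obtain u where u: "u < l" "Inl y = vs ! u" using cover[of "Inl y"] y by auto
      then have "even u" "y = h u" using h[OF u(1)] by (auto split: if_splits)
      then show ?thesis using u k by (intro bexI[of _ "u div 2 + 1"]) (auto simp: f_def)
    qed
  qed
  have g_bij: "bij_betw g {1..k} {1..s}"
  proof (rule bij_betwI')
    show "(g t = g u) = (t = u)" if "t \<in> {1..k}" "u \<in> {1..k}" for t u
      using inj[OF g(2)[OF that(1)] g(2)[OF that(2)]] g(1)[OF that(1)] g(1)[OF that(2)] that by auto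
    show "g t \<in> {1..s}" if "t \<in> {1..k}" for t
      using dvt(1)[OF g(2)[OF that]] g(1)[OF that] in_verts(2)[of "g t"] by simp
    show "\<exists>t\<in>{1..k}. y = g t" if y: "y \<in> {1..s}" for y
    proof -
      obtain u where u: "u < l" "Inr y = vs ! u" using cover[of "Inr y"] y by auto
      then have u': "odd u" "y = h u" using h[OF u(1)] by (auto split: if_splits)
      then obtain w where "u = 2 * w + 1" by (elim oddE)
      then show ?thesis using u u' k by (intro bexI[of _ "w + 1"]) (auto simp: g_def)
    qed
  qed
  have entry: "a (f t) (g j) = (if t = j \<or> t mod k = (j + 1) mod k then 1 else 0)"
    if t: "t \<in> {1..k}" and j: "j \<in> {1..k}" for t j
  proof -
    have "a (f t) (g j) = (if Inl (f t) \<in> nb (Inr (g j)) then 1 else 0)"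
      by (rule a_eq'[OF bij_betwE[OF f_bij, rule_format, OF t] bij_betwE[OF g_bij, rule_format, OF j]])
    moreover have "Inl (f t) \<in> nb (Inr (g j)) \<longleftrightarrow> t = j \<or> t mod k = (j + 1) mod k"
    proof (cases "j = k")
      \<comment> \<open>Column \<open>k\<close> closes the cycle: its neighbours are row
        \<open>k\<close> and row 1, and 1 is \<open>k + 1\<close> modulo \<open>k\<close>.\<close>
      case True
      have "Inl (f t) \<in> nb (Inr (g j)) \<longleftrightarrow> vs ! (2 * t - 2) = vs ! (l - 2) \<or> vs ! (2 * t - 2) = vs ! 0"
        unfolding f(1)[OF t] g(1)[OF j] using nb_l k(1) True by simp
      also have "\<dots> \<longleftrightarrow> 2 * t - 2 = l - 2 \<or> 2 * t - 2 = 0"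
        using inj[OF f(2)[OF t], of "l - 2"] inj[OF f(2)[OF t], of 0] k by simp
      also have "\<dots> \<longleftrightarrow> t = k \<or> t = 1" using t k by auto
      also have "\<dots> \<longleftrightarrow> t = j \<or> t mod k = (j + 1) mod k"
        using t k True by (cases "t = k") (auto simp: mod_Suc)
      finally show ?thesis .
    next
      case False
      then have j': "j < k" "0 < 2 * j - 1" "Suc (2 * j - 1) < l" using j k by auto
      have "Inl (f t) \<in> nb (Inr (g j)) \<longleftrightarrow>
          vs ! (2 * t - 2) = vs ! (2 * j - 1 - 1) \<or> vs ! (2 * t - 2) = vs ! Suc (2 * j - 1)"
        unfolding f(1)[OF t] g(1)[OF j] inner[OF j'(2,3)] by simp
      also have "\<dots> \<longleftrightarrow> 2 * t - 2 = 2 * j - 1 - 1 \<or> 2 * t - 2 = Suc (2 * j - 1)"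
        using inj[OF f(2)[OF t], of "2 * j - 1 - 1"] inj[OF f(2)[OF t] j'(3)] g(2)[OF j] by auto
      also have "\<dots> \<longleftrightarrow> t = j \<or> t = j + 1" using t j unfolding atLeastAtMost_iff by presburger
      also have "\<dots> \<longleftrightarrow> t = j \<or> t mod k = (j + 1) mod k"
        using t j j'(1) by (cases "t = k"; cases "j + 1 = k") auto
      finally show ?thesis .
    qed
    ultimately show ?thesis by simp
  qed
  have mf: "m (f t) = c" if "t \<in> {1..k}" for t
    using dvt(2)[OF f(2)[OF that]] f(1)[OF that, symmetric] by simp
  have ng: "n (g j) = c" if "j \<in> {1..k}" for j
    using dvt(2)[OF g(2)[OF that]] g(1)[OF that, symmetric] by simp
  show ?thesis
  proof (rule classifiedI[OF f_bij g_bij])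
    fix \<sigma> \<tau> assume \<sigma>: "\<And>i. i \<in> {1..r} \<Longrightarrow> \<sigma> i = f i" and \<tau>: "\<And>j. j \<in> {1..s} \<Longrightarrow> \<tau> j = g j"
      and rs: "k = r" "k = s"
    have "type_A_odd s r (\<lambda>j i. a (\<sigma> i) (\<tau> j)) (n \<circ> \<tau>) (m \<circ> \<sigma>) c"
      unfolding type_A_odd_def o_def
    proof (intro exI[of _ k] conjI ballI)
      fix j t assume *: "j \<in> {1..k}" "t \<in> {1..k}"
      show "a (\<sigma> t) (\<tau> j) = (if t = j \<or> t mod k = (j + 1) mod k then 1 else 0)"
        unfolding \<sigma>[OF *(2)[unfolded rs(1)]] \<tau>[OF *(1)[unfolded rs(2)]] by (rule entry[OF *(2,1)])
    next
      fix j assume *: "j \<in> {1..k}"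
      then have "j \<in> {1..s}" using rs by simp
      then show "n (\<tau> j) = c" using ng[OF *] by (simp only: \<tau>)
    next
      fix t assume *: "t \<in> {1..k}"
      then have "t \<in> {1..r}" using rs by simp
      then show "m (\<sigma> t) = c" using mf[OF *] by (simp only: \<sigma>)
    qed (use k rs in simp_all)
    then show "affine_list r s (\<lambda>i j. a (\<sigma> i) (\<tau> j)) (m \<circ> \<sigma>) (n \<circ> \<tau>) \<or>
        affine_list s r (\<lambda>j i. a (\<sigma> i) (\<tau> j)) (n \<circ> \<tau>) (m \<circ> \<sigma>)"
      unfolding affine_list_def using c by blast
  qed
qed

text \<open>A vertex of maximal \<open>d\<close> from which the whole diagram can be read off: the centre of a star,
  an end of the path of maximal vertices, or any vertex of a cycle.\<close>
definition start_vertex :: "nat + nat \<Rightarrow> bool"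
  where "start_vertex x \<longleftrightarrow> x \<in> verts \<and> (\<forall>y\<in>verts. case_sum m n y \<le> case_sum m n x) \<and>
    ((\<forall>y\<in>nb x. case_sum m n y < case_sum m n x) \<or> card (nb x) \<noteq> 2 \<or>
     (\<forall>y\<in>verts. case_sum m n y = case_sum m n x \<longrightarrow> card (nb y) = 2))"

text \<open>Among the vertices of maximal value one whose number of neighbours is not 2 is
  preferred; if there is none, any of them satisfies the last alternative of
  \<open>start_vertex\<close>.\<close>

lemma start_vertex_exists: "\<exists>x. start_vertex x"
proof -
  have "Inl 1 \<in> verts" using nonempty by simp
  then have ne: "verts \<noteq> {}" by blast
  define D where "D = Max (case_sum m n ` verts)"
  have le: "\<forall>y\<in>verts. case_sum m n y \<le> D" using finite_X by (simp add: D_def)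
  have "D \<in> case_sum m n ` verts" unfolding D_def using finite_X ne by (intro Max_in) auto
  then obtain z where z: "z \<in> verts" "case_sum m n z = D" by blast
  show ?thesis
  proof (cases "\<exists>x\<in>verts. case_sum m n x = D \<and> card (nb x) \<noteq> 2")
    case True
    then show ?thesis using le unfolding start_vertex_def by auto
  next
    case False
    then have "start_vertex z" using le z unfolding start_vertex_def by auto
    then show ?thesis by blast
  qed
qed

text \<open>If all neighbours are smaller, the graph is a star. Otherwise both ends of a level path
  are examined with \<open>level\<close>, and the choice of the start makes them match: two
  neighbours at the start exclude leaves at the end, and leaves at the start exclude
  closing.\<close>

lemma classified_from_row:
  assumes "start_vertex (Inl i)"
  shows "classified r s a m n"
proof (cases "\<forall>y\<in>nb (Inl i). case_sum m n y < m i")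
  case True
  then show ?thesis using assms by (intro classified_star[of i]) (auto simp: start_vertex_def)
next
  case False
  from assms have i: "i \<in> {1..r}" and max: "\<And>y. y \<in> verts \<Longrightarrow> case_sum m n y \<le> m i"
    by (auto simp: start_vertex_def)
  from False obtain y where y: "y \<in> nb (Inl i)" "\<not> case_sum m n y < m i" by blast
  have yX: "y \<in> verts" using nb_in_X[OF y(1)] .
  have dy: "case_sum m n y = m i" using max[OF yX] y(2) by simp
  have iX: "Inl i \<in> verts" using i by simp
  obtain vs where path: "level_path (Inl i) vs"
    and "(\<exists>p q. nb (last vs) = {vs ! (length vs - 2), p, q} \<and> p \<noteq> q \<and>
           2 * case_sum m n p = case_sum m n (Inl i) \<and> 2 * case_sum m n q = case_sum m n (Inl i) \<and>
           nb p = {last vs} \<and> nb q = {last vs}) \<or>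
         length vs \<ge> 3 \<and> nb (last vs) = {vs ! (length vs - 2), Inl i}"
    using level_path_exists[OF iX y(1)] dy by auto
  then consider (branch) p' q' where "nb (last vs) = {vs ! (length vs - 2), p', q'}" "p' \<noteq> q'"
      "2 * case_sum m n p' = m i" "2 * case_sum m n q' = m i" "nb p' = {last vs}" "nb q' = {last vs}"
    | (closed) "length vs \<ge> 3" "nb (last vs) = {vs ! (length vs - 2), Inl i}"
    by auto
  note last_cases = this
  have l2: "length vs \<ge> 2" and dist: "distinct vs" and v1: "vs ! 1 \<in> nb (Inl i)"
    and dv: "\<And>v. v \<in> set vs \<Longrightarrow> v \<in> verts \<and> case_sum m n v = m i"
    using path by (auto simp: level_path_def)
  have "vs \<noteq> []" using l2 by auto
  then have last: "last vs \<in> verts" "case_sum m n (last vs) = m i" using dv[of "last vs"] by auto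
  have dv1: "case_sum m n (vs ! 1) = m i" using dv[of "vs ! 1"] l2 by simp
  have last_v1: "last vs \<noteq> vs ! 1" if "length vs \<ge> 3"
    using dist that \<open>vs \<noteq> []\<close> by (subst last_conv_nth) (auto simp: nth_eq_iff_index_eq)
  have closed_last: "last vs \<in> nb (Inl i)" if "nb (last vs) = {vs ! (length vs - 2), Inl i}"
    using nb_sym[OF last(1), of "Inl i"] that by simp
  \<comment> \<open>Along the edge from \<open>vs ! 1\<close> back to \<open>Inl i\<close>,
    \<open>level\<close> describes the first end of the path.\<close>
  from level[OF nb_in_X[OF v1] nb_sym[OF iX v1]] dv1
  consider z where "nb (Inl i) = {vs ! 1, z}" "z \<noteq> vs ! 1"
    | p q where "nb (Inl i) = {vs ! 1, p, q}" "p \<noteq> q" "2 * case_sum m n p = m i" "2 * case_sum m n q = m i"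
      "nb p = {Inl i}" "nb q = {Inl i}"
    by auto
  then show ?thesis
  proof cases
    case 1
    then have "card (nb (Inl i)) = 2" by auto
    \<comment> \<open>With exactly two neighbours, one of them equally large, only the last
      alternative of \<open>start_vertex\<close> remains.\<close>
    then have all2: "card (nb x) = 2" if "x \<in> verts" "case_sum m n x = m i" for x
      using assms False that by (auto simp: start_vertex_def)
    show ?thesis
    proof (cases rule: last_cases)
      case branch
      have "vs ! (length vs - 2) \<notin> {p', q'}"
        using branch(3,4) dv[of "vs ! (length vs - 2)"] l2 m_pos[OF i] by auto
      then have "card (nb (last vs)) = 3" using branch(1,2) by auto
      then show ?thesis using all2[OF last] by simp
    next
      case closed
      have "nb (Inl i) = {vs ! 1, last vs}"
        using closed_last[OF closed(2)] last_v1[OF closed(1)] 1 by auto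
      then show ?thesis using classified_A[OF i path closed] by blast
    qed
  next
    case 2
    show ?thesis
    proof (cases rule: last_cases)
      case branch
      show ?thesis by (rule classified_D[OF i path 2 branch])
    next
      case closed
      \<comment> \<open>If the path closed, its last vertex would be a neighbour of
        \<open>Inl i\<close> different from \<open>vs ! 1\<close> and, having the maximal value,
        from both leaves.\<close>
      have "last vs \<notin> {p, q}" using last(2) 2(3,4) m_pos[OF i] by auto
      then show ?thesis using closed_last[OF closed(2)] last_v1[OF closed(1)] 2(1) by auto
    qed
  qed
qed

end

section \<open>Transposition and the end of the classification\<close>

lemma edge_weight_transpose:
  "edge_weight (\<lambda>j i. a i j) (case_sum Inr Inl x) (case_sum Inr Inl y) = edge_weight a x y"
  by (cases x; cases y) auto

text \<open>A start vertex in a column becomes one in a row of the transposed matrix.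
  \<open>?swap\<close> is the corresponding isomorphism of graphs; neighbourhoods, their sizes and
  the values are transported along it, hence so is \<open>start_vertex\<close>.\<close>

lemma (in simple_affine_bipartite) classified_simple: "classified r s a m n"
proof -
  obtain x where x: "start_vertex x" using start_vertex_exists by blast
  show ?thesis
  proof (cases x)
    case (Inl i)
    then show ?thesis using x classified_from_row by blast
  next
    case (Inr j)
    let ?swap = "case_sum Inr Inl :: nat + nat \<Rightarrow> nat + nat"
    interpret T: affine_bipartite s r "\<lambda>j i. a i j" n m
      by (rule transpose[OF s_pos])
    interpret T: simple_affine_bipartite s r "\<lambda>j i. a i j" n m
      by unfold_locales (rule a_le_1)
    have swap2: "?swap (?swap y) = y" for y by (cases y) auto
    have image: "z \<in> ?swap ` S \<longleftrightarrow> ?swap z \<in> S" for z S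
      using swap2 by (metis (no_types, lifting) image_iff)
    have in_T: "z \<in> T.verts \<longleftrightarrow> ?swap z \<in> verts" for z by (cases z) auto
    then have verts: "T.verts = ?swap ` verts" using image by blast
    have "z \<in> T.nb (?swap y) \<longleftrightarrow> ?swap z \<in> nb y" for y z
      using edge_weight_transpose[of a y "?swap z"] unfolding T.nb_def nb_def in_T swap2 mem_Collect_eq by simp
    then have nb: "T.nb (?swap y) = ?swap ` nb y" for y using image by blast
    have ball_T: "(\<forall>z\<in>T.verts. P z) \<longleftrightarrow> (\<forall>y\<in>verts. P (?swap y))" for P
      unfolding verts by blast
    have ball_image: "(\<forall>z\<in>?swap ` S. P z) \<longleftrightarrow> (\<forall>y\<in>S. P (?swap y))" for S P
      by blast
    have d: "case_sum n m (?swap y) = case_sum m n y" for y by (cases y) auto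
    have inj: "inj_on ?swap S" for S by (metis inj_onI swap2)
    have "T.start_vertex (?swap x)"
      using x unfolding T.start_vertex_def start_vertex_def in_T swap2 ball_T nb ball_image card_image[OF inj] d .
    then have "classified s r (\<lambda>j i. a i j) n m" using Inr T.classified_from_row by simp
    then show ?thesis by (rule classified_transpose)
  qed
qed

lemma (in affine_bipartite) classified: "classified r s a m n"
proof (cases "\<forall>i\<in>{1..r}. \<forall>j\<in>{1..s}. a i j \<le> 1")
  case True
  then interpret simple_affine_bipartite r s a m n by unfold_locales auto
  show ?thesis by (rule classified_simple)
next
  case False
  then obtain i j where "i \<in> {1..r}" "j \<in> {1..s}" "\<not> a i j \<le> 1" by blast
  then show ?thesis by (intro classified_double[of i j]) auto
qed

section \<open>Weak PM-structures\<close>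

theorem theorem4p2:
  fixes scale :: "complex \<Rightarrow> 'l::ab_group_add \<Rightarrow> 'l"
    and sV :: "complex \<Rightarrow> 'v::ab_group_add \<Rightarrow> 'v"
    and sW :: "complex \<Rightarrow> 'w::ab_group_add \<Rightarrow> 'w"
    and V :: "nat \<Rightarrow> 'v set" and W :: "nat \<Rightarrow> 'w set"
    and r s N :: nat
    and m n :: "nat \<Rightarrow> nat"
    and a :: "nat \<Rightarrow> nat \<Rightarrow> nat"
  assumes "weak_PM_structure scale A B e form mulA mulB lact ract N"
    and "semisimple_decomposition scale A mulA sV r V m \<rho>A"
    and "semisimple_decomposition scale B mulB sW s W n \<rho>B"
    and "multiplicity_matrix scale A B lact ract sV r V \<rho>A sW s W \<rho>B a"
    and "\<not> decomposable r s a"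
  shows "\<exists>\<sigma> \<tau>. \<sigma> permutes {1..r} \<and> \<tau> permutes {1..s} \<and>
    (affine_list r s (\<lambda>i j. a (\<sigma> i) (\<tau> j)) (m \<circ> \<sigma>) (n \<circ> \<tau>) \<or>
     affine_list s r (\<lambda>j i. a (\<sigma> i) (\<tau> j)) (n \<circ> \<tau>) (m \<circ> \<sigma>))"
proof -
  from assms(4) obtain \<Psi> where "linear_iso_on scale (fscale (fscale (*))) UNIV
      (direct_sum {(i, j, p). i \<in> {1..r} \<and> j \<in> {1..s} \<and> p \<in> {1..a i j}}
        (\<lambda>(i, j, p). tensor_product (fscale (*)) sW (dual_space sV (V i)) (W j))) \<Psi>"
    "\<forall>x\<in>B. \<forall>v. \<forall>i\<in>{1..r}. \<forall>j\<in>{1..s}. \<forall>p\<in>{1..a i j}. \<Psi> (lact x v) (i, j, p) =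
      tensor_map (fscale (*)) sW (dual_space sV (V i)) (W j) id (\<rho>B x j) (\<Psi> v (i, j, p))"
    "\<forall>x\<in>A. \<forall>v. \<forall>i\<in>{1..r}. \<forall>j\<in>{1..s}. \<forall>p\<in>{1..a i j}. \<Psi> (ract v x) (i, j, p) =
      tensor_map (fscale (*)) sW (dual_space sV (V i)) (W j) (\<lambda>\<xi>. \<xi> \<circ> \<rho>A x i) id (\<Psi> v (i, j, p))"
    unfolding multiplicity_matrix_def by blast
  then interpret semisimple_PM_structure scale A B e form mulA mulB lact ract N sV sW V W r s m n a \<rho>A \<rho>B \<Psi>
    using assms(1-3) by (intro semisimple_PM_structure.intro semisimple_PM_structure_axioms.intro) blast+
  \<comment> \<open>Only numerical data pass from the structure to the graph: positive dimensions,
    the equations of \<open>null_vector\<close>, indecomposability and \<open>r_pos\<close>.\<close>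
  interpret affine_bipartite r s a m n
    using semisimple_decomposition_dim_pos[OF assms(2)] semisimple_decomposition_dim_pos[OF assms(3)]
      null_vector assms(5) r_pos by unfold_locales
  show ?thesis using classified unfolding classified_def .
qed

end
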